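(* Let $k\ge 3$, let $\alpha_1,\alpha_2,\alpha_3\in\mathbb{R}$ be pairwise distinct with $\alpha_1<\alpha_3$ and $\alpha_2<\alpha_3$, let $K:=\{(x,y)\in\mathbb{R}^2:(y-\alpha_1)(y-\alpha_2)(y-\alpha_3)=0\}$, and let $\beta=(\beta_{i,j})_{i,j\in\mathbb{Z}_+,\,i+j\le 2k}$ be a real bivariate sequence of degree $2k$ with $\beta_{0,0}>0$ and moment matrix $M_k=M_k(\beta)$. Let $\widetilde\alpha_2,\widetilde\alpha_3,\widetilde\beta_{i,j},A_{00},\widehat A_{01},\widetilde A_{11},\widetilde B_{00},\widehat a_{01},\widetilde a_{01},h,N$ be as defined in the context. Then the following statements are equivalent: (1) $\beta$ has a $K$-representing measure. (2) $M_k$ is positive semidefinite, the relations $$\beta_{i,j+3}=(\alpha_1+\alpha_2+\alpha_3)\beta_{i,j+2}-(\alpha_1\alpha_2+\alpha_1\alpha_3+\alpha_2\alpha_3)\beta_{i,j+1}+\alpha_1\alpha_2\alpha_3\,\beta_{i,j}$$ hold for every $i,j\in\mathbb{Z}_+$ with $i+j\le 2k-3$, $N$ is positive semidefinite, and one of the following statements holds: (a) $\widehat A_{01}-\widetilde\alpha_2\widetilde B_{00}$ is invertible. (b) $(\alpha_3-\alpha_1)\widetilde B_{00}-\widehat A_{01}$ is invertible. (c) Denoting by $v\in\mathbb{R}^{k-1}$ any vector such that $$\big((\alpha_3-\alpha_1)\widetilde B_{00}-\widehat A_{01}\big)\begin{pmatrix}v\\1\end{pmatrix}=0,$$ defining the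 real numbers $$t'=\frac{(\widehat a_{01})^Tv-\widetilde\alpha_3h^Tv+\widetilde\beta_{2k-1,1}}{\alpha_3-\alpha_1},\qquad u'=\begin{pmatrix}h^T&t'&(\widetilde a_{01})^T\end{pmatrix}\begin{pmatrix}\widetilde B_{00}&\widehat A_{01}\\(\widehat A_{01})^T&\widetilde A_{11}\end{pmatrix}^{\dagger}\begin{pmatrix}h\\t'\\\widetilde a_{01}\end{pmatrix}$$ and the $(k+1)\times(k+1)$ Hankel matrix $$A_\gamma:=A_{00}-\begin{pmatrix}\widetilde B_{00}&\begin{matrix}h\\t'\end{matrix}\\\begin{matrix}h^T&t'\end{matrix}&u'\end{pmatrix},\qquad \gamma\in\mathbb{R}^{2k+1},$$ it holds that $A_\gamma$ is invertible or $\operatorname{rank}A_\gamma=\operatorname{rank}A_\gamma(k-1)$, where $A_\gamma(k-1)$ denotes the upper left-hand $k\times k$ corner of $A_\gamma$. Moreover, if a $K$-representing measure for $\beta$ exists, then there is a $(\operatorname{rank}M_k)$-atomic $K$-representing measure if $\operatorname{rank}N\le\operatorname{rank}M_k$, and a $(\operatorname{rank}M_k+1)$-atomic one otherwise.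
   Context: $\mathbb{Z}_+$ denotes the nonnegative integers and $^\dagger$ the Moore–Penrose inverse. For closed $K\subseteq\mathbb{R}^2$, a $K$-representing measure for $\beta=(\beta_{i,j})_{i+j\le 2k}$ is a positive Borel measure $\mu$ with support contained in $K$ such that $\beta_{i,j}=\int_K x^iy^j\,d\mu$ whenever $i+j\le 2k$. A measure is $r$-atomic if it is of the form $\sum_{j=1}^r\rho_j\delta_{z_j}$ with $\rho_j>0$ and pairwise distinct points $z_j$. The moment matrix $M_k$ has rows and columns indexed by $X^iY^j$, $i+j\le k$, with entry $\beta_{i+i',j+j'}$ in row $X^iY^j$ and column $X^{i'}Y^{j'}$. For $\gamma=(\gamma_0,\dots,\gamma_{2k})\in\mathbb{R}^{2k+1}$, $A_\gamma=(\gamma_{i+j})_{i,j=0}^k$ is the associated Hankel matrix. Notation. Put $\widetilde\alpha_2=\alpha_2-\alpha_1$, $\widetilde\alpha_3=\alpha_3-\alpha_1$. For $i+j\le 2k$ let $\widetilde\beta_{i,j}=L_\beta\big(x^i(y-\alpha_1)^j\big)$, where $L_\beta$ is the linear functional on polynomials of degree at most $2k$ with $L_\beta(x^iy^j)=\beta_{i,j}$. Define also $$\widetilde\beta_{2k-3,4}=(\widetilde\alpha_2+\widetilde\alpha_3)\widetilde\beta_{2k-3,3}-\widetilde\alpha_2\widetilde\alpha_3\widetilde\beta_{2k-3,2},\quad \widetilde\beta_{2k-2,3}=(\widetilde\alpha_2+\widetilde\alpha_3)\widetilde\beta_{2k-2,2}-\widetilde\alpha_2\widetilde\alpha_3\widetilde\beta_{2k-2,1},$$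 $$\widetilde\beta_{2k-2,4}=(\widetilde\alpha_2+\widetilde\alpha_3)\widetilde\beta_{2k-2,3}-\widetilde\alpha_2\widetilde\alpha_3\widetilde\beta_{2k-2,2}.$$ - $N$ is the $3k\times 3k$ matrix with rows and columns indexed by $X^i,\ YX^i,\ Y^2X^i$, $0\le i\le k-1$, whose entry in row $Y^pX^i$ and column $Y^qX^j$ is $\widetilde\beta_{i+j,p+q}$. - $A_{00}=(\beta_{i+j,0})_{0\le i,j\le k}$, $\widehat A_{01}=(\widetilde\beta_{i+j,1})_{0\le i,j\le k-1}$, $\widetilde A_{11}=(\widetilde\beta_{i+j,2})_{0\le i,j\le k-1}$. - $\widetilde B_{00}=(\widetilde\alpha_2\widetilde\alpha_3)^{-1}\big((\widetilde\alpha_2+\widetilde\alpha_3)\widetilde\beta_{i+j,1}-\widetilde\beta_{i+j,2}\big)_{0\le i,j\le k-1}\in\mathbb{R}^{k\times k}$. - $\widetilde a_{01}=(\widetilde\beta_{k,1},\dots,\widetilde\beta_{2k-1,1})^T\in\mathbb{R}^k$, $\widehat a_{01}=(\widetilde\beta_{k,1},\dots,\widetilde\beta_{2k-2,1})^T\in\mathbb{R}^{k-1}$, $\widetilde a_{02}=(\widetilde\beta_{k,2},\dots,\widetilde\beta_{2k-2,2})^T\in\mathbb{R}^{k-1}$. - $h=(\widetilde\alpha_2\widetilde\alpha_3)^{-1}\big((\widetilde\alpha_2+\widetilde\alpha_3)\widehat a_{01}-\widetilde a_{02}\big)\in\mathbb{R}^{k-1}$. *)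

theory Defs
  imports
    "HOL-Analysis.Analysis"
    "HOL-Computational_Algebra.Polynomial"
    "Jordan_Normal_Form.DL_Rank"
begin

no_notation inner (infix "\<bullet>" 70)
hide_const (open) Finite_Cartesian_Product.mat Finite_Cartesian_Product.vec
  Determinants.det Finite_Cartesian_Product.row Finite_Cartesian_Product.column

definition measure_support :: "'a::topological_space measure \<Rightarrow> 'a set" where
  "measure_support \<mu> = {z. \<forall>U. open U \<and> z \<in> U \<longrightarrow> emeasure \<mu> U > 0}"

text \<open>A truncated sequence of degree \<open>2k\<close> is a function \<open>\<beta> :: nat \<Rightarrow> nat \<Rightarrow> real\<close> of which only the
  values \<open>\<beta> i j\<close> with \<open>i + j \<le> 2 * k\<close> are ever used.\<close>

definition representing_measure ::
    "(real \<times> real) set \<Rightarrow> nat \<Rightarrow> (nat \<Rightarrow> nat \<Rightarrow> real) \<Rightarrow> (real \<times> real) measure \<Rightarrow> bool" where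
  "representing_measure K k \<beta> \<mu> \<longleftrightarrow>
     sets \<mu> = sets borel \<and> measure_support \<mu> \<subseteq> K \<and>
     (\<forall>i j. i + j \<le> 2 * k \<longrightarrow>
        set_integrable \<mu> K (\<lambda>(x, y). x ^ i * y ^ j) \<and>
        \<beta> i j = set_lebesgue_integral \<mu> K (\<lambda>(x, y). x ^ i * y ^ j))"

definition atomic_measure :: "nat \<Rightarrow> 'a::topological_space measure \<Rightarrow> bool" where
  "atomic_measure r \<mu> \<longleftrightarrow>
     sets \<mu> = sets borel \<and>
     (\<exists>(\<rho> :: nat \<Rightarrow> real) z. inj_on z {..<r} \<and> (\<forall>j<r. \<rho> j > 0) \<and>
        (\<forall>A \<in> sets borel. emeasure \<mu> A = (\<Sum>j<r. ennreal (\<rho> j) * indicator A (z j))))"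

definition psd_mat :: "real mat \<Rightarrow> bool" where
  "psd_mat A \<longleftrightarrow> square_mat A \<and> transpose_mat A = A \<and>
     (\<forall>v \<in> carrier_vec (dim_row A). 0 \<le> v \<bullet> (A *\<^sub>v v))"

abbreviation mat_rank :: "real mat \<Rightarrow> nat" where
  "mat_rank A \<equiv> vec_space.rank (dim_row A) A"

text \<open>The Moore--Penrose inverse, as the unique solution of the four Penrose equations.\<close>

definition is_moore_penrose :: "real mat \<Rightarrow> real mat \<Rightarrow> bool" where
  "is_moore_penrose A X \<longleftrightarrow>
     X \<in> carrier_mat (dim_col A) (dim_row A) \<and>
     A * X * A = A \<and> X * A * X = X \<and>
     transpose_mat (A * X) = A * X \<and> transpose_mat (X * A) = X * A"

definition moore_penrose :: "real mat \<Rightarrow> real mat" where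
  "moore_penrose A = (THE X. is_moore_penrose A X)"

definition hankel_mat :: "nat \<Rightarrow> (nat \<Rightarrow> real) \<Rightarrow> real mat" where
  "hankel_mat n s = mat n n (\<lambda>(i, j). s (i + j))"

definition corner_mat :: "nat \<Rightarrow> real mat \<Rightarrow> real mat" where
  "corner_mat n A = mat n n (\<lambda>(i, j). A $$ (i, j))"

text \<open>Exponents \<open>(i, j)\<close> of the monomials \<open>X\<^sup>i Y\<^sup>j\<close> of degree at most \<open>k\<close>, in the order
  \<open>1, X, Y, X\<^sup>2, X Y, Y\<^sup>2, \<dots>\<close>.\<close>

definition monomials :: "nat \<Rightarrow> (nat \<times> nat) list" where
  "monomials k = concat (map (\<lambda>d. map (\<lambda>j. (d - j, j)) [0..<d + 1]) [0..<k + 1])"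

definition moment_mat :: "nat \<Rightarrow> (nat \<Rightarrow> nat \<Rightarrow> real) \<Rightarrow> real mat" where
  "moment_mat k \<beta> =
     (let ms = monomials k; n = length ms
      in mat n n (\<lambda>(r, c). \<beta> (fst (ms ! r) + fst (ms ! c)) (snd (ms ! r) + snd (ms ! c))))"

text \<open>Bivariate polynomials are represented as polynomials in \<open>y\<close> whose coefficients are polynomials
  in \<open>x\<close>, so the coefficient of \<open>x\<^sup>i y\<^sup>j\<close> is \<open>coeff (coeff p j) i\<close>.\<close>

definition riesz_functional :: "(nat \<Rightarrow> nat \<Rightarrow> real) \<Rightarrow> real poly poly \<Rightarrow> real" where
  "riesz_functional \<beta> p =
     (\<Sum>j\<le>degree p. \<Sum>i\<le>degree (coeff p j). coeff (coeff p j) i * \<beta> i j)"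

definition shifted_moment :: "real \<Rightarrow> (nat \<Rightarrow> nat \<Rightarrow> real) \<Rightarrow> nat \<Rightarrow> nat \<Rightarrow> real" where
  "shifted_moment \<alpha> \<beta> i j = riesz_functional \<beta> ([:monom 1 i:] * [:[:- \<alpha>:], 1:] ^ j)"

text \<open>The arguments \<open>a2\<close> and \<open>a3\<close> below stand for \<open>\<alpha>\<^sub>2 - \<alpha>\<^sub>1\<close> and \<open>\<alpha>\<^sub>3 - \<alpha>\<^sub>1\<close>, and \<open>b\<close> for the
  extended shifted sequence \<open>ext_moment k \<alpha>\<^sub>1 a2 a3 \<beta>\<close>. The value \<open>0\<close> in the last branch of
  \<open>ext_moment\<close> is a dummy that no matrix or vector below refers to.\<close>

definition ext_moment ::
    "nat \<Rightarrow> real \<Rightarrow> real \<Rightarrow> real \<Rightarrow> (nat \<Rightarrow> nat \<Rightarrow> real) \<Rightarrow> nat \<Rightarrow> nat \<Rightarrow> real" where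
  "ext_moment k \<alpha>\<^sub>1 a2 a3 \<beta> i j =
     (let b = shifted_moment \<alpha>\<^sub>1 \<beta>;
          b3 = (a2 + a3) * b (2 * k - 2) 2 - a2 * a3 * b (2 * k - 2) 1
      in if i + j \<le> 2 * k then b i j
         else if i = 2 * k - 3 \<and> j = 4 then
           (a2 + a3) * b (2 * k - 3) 3 - a2 * a3 * b (2 * k - 3) 2
         else if i = 2 * k - 2 \<and> j = 3 then b3
         else if i = 2 * k - 2 \<and> j = 4 then (a2 + a3) * b3 - a2 * a3 * b (2 * k - 2) 2
         else 0)"

text \<open>Row \<open>p * k + i\<close> (with \<open>i < k\<close>, \<open>p < 3\<close>) corresponds to the monomial \<open>Y\<^sup>p X\<^sup>i\<close>, and likewise
  for columns.\<close>

definition mat_N :: "nat \<Rightarrow> (nat \<Rightarrow> nat \<Rightarrow> real) \<Rightarrow> real mat" where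
  "mat_N k b = mat (3 * k) (3 * k) (\<lambda>(r, c). b (r mod k + c mod k) (r div k + c div k))"

definition mat_A00 :: "nat \<Rightarrow> (nat \<Rightarrow> nat \<Rightarrow> real) \<Rightarrow> real mat" where
  "mat_A00 k \<beta> = hankel_mat (k + 1) (\<lambda>m. \<beta> m 0)"

definition mat_A01 :: "nat \<Rightarrow> (nat \<Rightarrow> nat \<Rightarrow> real) \<Rightarrow> real mat" where
  "mat_A01 k b = hankel_mat k (\<lambda>m. b m 1)"

definition mat_A11 :: "nat \<Rightarrow> (nat \<Rightarrow> nat \<Rightarrow> real) \<Rightarrow> real mat" where
  "mat_A11 k b = hankel_mat k (\<lambda>m. b m 2)"

text \<open>On the lines \<open>y = a2\<close> and \<open>y = a3\<close> the polynomial \<open>((a2 + a3) y - y\<^sup>2) / (a2 a3)\<close> equals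
  \<open>1\<close>, and on \<open>y = 0\<close> it vanishes, so \<open>mat_B00\<close> and \<open>vec_h\<close> contain the \<open>x\<close>-moments contributed
  by the former two lines.\<close>

definition mat_B00 :: "nat \<Rightarrow> real \<Rightarrow> real \<Rightarrow> (nat \<Rightarrow> nat \<Rightarrow> real) \<Rightarrow> real mat" where
  "mat_B00 k a2 a3 b = inverse (a2 * a3) \<cdot>\<^sub>m hankel_mat k (\<lambda>m. (a2 + a3) * b m 1 - b m 2)"

text \<open>The vectors \<open>(b k 1, \<dots>, b (2k-1) 1)\<close>, \<open>(b k 1, \<dots>, b (2k-2) 1)\<close> and
  \<open>(b k 2, \<dots>, b (2k-2) 2)\<close>.\<close>

definition vec_a01 :: "nat \<Rightarrow> (nat \<Rightarrow> nat \<Rightarrow> real) \<Rightarrow> real vec" where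
  "vec_a01 k b = vec k (\<lambda>i. b (k + i) 1)"

definition vec_a01_hat :: "nat \<Rightarrow> (nat \<Rightarrow> nat \<Rightarrow> real) \<Rightarrow> real vec" where
  "vec_a01_hat k b = vec (k - 1) (\<lambda>i. b (k + i) 1)"

definition vec_a02 :: "nat \<Rightarrow> (nat \<Rightarrow> nat \<Rightarrow> real) \<Rightarrow> real vec" where
  "vec_a02 k b = vec (k - 1) (\<lambda>i. b (k + i) 2)"

definition vec_h :: "nat \<Rightarrow> real \<Rightarrow> real \<Rightarrow> (nat \<Rightarrow> nat \<Rightarrow> real) \<Rightarrow> real vec" where
  "vec_h k a2 a3 b = inverse (a2 * a3) \<cdot>\<^sub>v ((a2 + a3) \<cdot>\<^sub>v vec_a01_hat k b - vec_a02 k b)"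

abbreviation singleton_vec :: "real \<Rightarrow> real vec" where
  "singleton_vec t \<equiv> vec_of_list [t]"

definition t_prime :: "nat \<Rightarrow> real \<Rightarrow> real \<Rightarrow> (nat \<Rightarrow> nat \<Rightarrow> real) \<Rightarrow> real vec \<Rightarrow> real" where
  "t_prime k a2 a3 b v =
     (vec_a01_hat k b \<bullet> v - a3 * (vec_h k a2 a3 b \<bullet> v) + b (2 * k - 1) 1) / a3"

definition u_prime :: "nat \<Rightarrow> real \<Rightarrow> real \<Rightarrow> (nat \<Rightarrow> nat \<Rightarrow> real) \<Rightarrow> real \<Rightarrow> real" where
  "u_prime k a2 a3 b t =
     (let c = vec_h k a2 a3 b @\<^sub>v singleton_vec t @\<^sub>v vec_a01 k b;
          F = four_block_mat (mat_B00 k a2 a3 b) (mat_A01 k b)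
                             (transpose_mat (mat_A01 k b)) (mat_A11 k b)
      in c \<bullet> (moore_penrose F *\<^sub>v c))"

definition mat_A_gamma ::
    "nat \<Rightarrow> real \<Rightarrow> real \<Rightarrow> (nat \<Rightarrow> nat \<Rightarrow> real) \<Rightarrow> (nat \<Rightarrow> nat \<Rightarrow> real) \<Rightarrow> real \<Rightarrow> real \<Rightarrow> real mat" where
  "mat_A_gamma k a2 a3 \<beta> b t u =
     (let c = vec_h k a2 a3 b @\<^sub>v singleton_vec t
      in mat_A00 k \<beta> - four_block_mat (mat_B00 k a2 a3 b) (mat_of_cols k [c])
                                      (mat_of_rows k [c]) (mat 1 1 (\<lambda>_. u)))"

end

theory Submission imports Defs "HOL-Computational_Algebra.Fundamental_Theorem_Algebra" begin

text \<open>On each of the lines \<open>y = \<alpha> l\<close> a measure gives a one-dimensional moment problem in \<open>x\<close>.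
  The sequence \<open>\<beta>\<close> determines the \<open>x\<close>-moments on the three lines up to degree \<open>2k - 2\<close>; one
  parameter in degree \<open>2k - 1\<close> and the splitting of a known sum in degree \<open>2k\<close> remain free. The
  matrix \<open>N\<close> is congruent to the direct sum of the three \<open>k\<close>-by-\<open>k\<close> Hankel matrices, and \<open>M\<close> and \<open>N\<close>
  are two overlapping blocks of a form with a single unknown entry on the triples of polynomials of
  degree at most \<open>k\<close> with a common coefficient of \<open>x\<^sup>k\<close>. A semidefinite completion of least rank fixes
  the free parameter in degree \<open>2k - 1\<close>. The truncated Hamburger problem is then solvable on all lines
  iff the distance of \<open>x\<^sup>k\<close> to the triples of lower degree is zero or can be absorbed in the top moment
  of a line with invertible Hankel matrix. Conditions (a) and (b) are invertibility on the third and
  second line; if the second line is singular, its kernel vector \<open>(v, 1)\<close> determines the free parameter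
  and (c) covers invertibility on the first line and distance zero. The number of atoms is the rank of
  the completed form, which is the maximum of the ranks of \<open>M\<close> and \<open>N\<close>.\<close>

hide_const (open) VectorSpace.subspace Module.smult
no_notation vec_nth (infixl "$" 90)

section \<open>Positive semidefinite forms and their Gram matrices\<close>

text \<open>All forms here may be degenerate, so rank is counted by families that are orthonormal
  modulo null vectors, and one fact does most of the work: a null vector of a semidefinite form is
  orthogonal to everything. The obstacle is that semidefiniteness of the completed form does not
  make the lines solvable. On a line a null polynomial has to stay null after multiplication by x. A
  line with a null polynomial of degree below k has a monic one of degree k - 1, whose multiple by x
  must be null too; this forces the 2k-th moment of the line to its minimum. Only the sum of the
  three 2k-th moments is known, and its excess over the three minima is the squared distance of x^k.
  A positive excess can go only to a definite line, and one such line takes all of it. The choice of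
  the completion does no harm: the free parameter moves the moments of degree 2k - 1 along the
  weights of the second divided difference, none of which is zero, so one singular line fixes all
  three. If some line is definite, any completion will do.\<close>

locale symmetric_form =
  fixes B :: "'v::real_vector \<Rightarrow> 'v \<Rightarrow> real"
  assumes bilinear: "bilinear B"
    and commute: "B x y = B y x"
begin

lemma add_left: "B (x + y) z = B x z + B y z"
  and add_right: "B z (x + y) = B z x + B z y"
  and diff_left: "B (x - y) z = B x z - B y z"
  and diff_right: "B z (x - y) = B z x - B z y"
  and scale_left: "B (c *\<^sub>R x) z = c * B x z"
  and scale_right: "B z (c *\<^sub>R x) = c * B z x"
  and zero_left: "B 0 z = 0"
  and zero_right: "B z 0 = 0"
  using bilinear
  by (simp_all add: bilinear_ladd bilinear_radd bilinear_lsub bilinear_rsub bilinear_lmul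
      bilinear_rmul bilinear_lzero bilinear_rzero)

lemma sum_left: "B (\<Sum>i\<in>A. f i) z = (\<Sum>i\<in>A. B (f i) z)"
  using linear_sum[of "\<lambda>x. B x z" f A] bilinear by (simp add: bilinear_def)

lemma sum_right: "B z (\<Sum>i\<in>A. f i) = (\<Sum>i\<in>A. B z (f i))"
  using linear_sum[of "B z" f A] bilinear by (simp add: bilinear_def)

lemmas form_simps = add_left add_right diff_left diff_right scale_left scale_right
  zero_left zero_right sum_left sum_right

lemma form_quadratic:
  "B (x + a *\<^sub>R y + b *\<^sub>R z) (x + a *\<^sub>R y + b *\<^sub>R z) =
    B x x + a * a * B y y + b * b * B z z + 2 * a * B x y + 2 * b * B x z + 2 * a * b * B y z"
  using commute[of y x] commute[of z x] commute[of z y]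
  unfolding add_left add_right scale_left scale_right by (simp add: algebra_simps)

definition psd_on :: "'v set \<Rightarrow> bool" where
  "psd_on S \<longleftrightarrow> (\<forall>x\<in>S. 0 \<le> B x x)"

lemma psd_on_mono: "psd_on S \<Longrightarrow> T \<subseteq> S \<Longrightarrow> psd_on T"
  by (auto simp: psd_on_def)

text \<open>The substitute for Cauchy-Schwarz: if \<open>B x y\<close> were nonzero, the form would
  be unbounded below along the line through \<open>y\<close> in direction \<open>x\<close>, where it
  is affine because \<open>x\<close> is null.\<close>

lemma psd_null:
  assumes "subspace S" "psd_on S" "x \<in> S" "B x x = 0" "y \<in> S"
  shows "B x y = 0"
proof (rule ccontr)
  assume n: "B x y \<noteq> 0"
  define t where "t = - (B y y + 1) / (2 * B x y)"
  have "y + t *\<^sub>R x \<in> S" using assms by (simp add: subspace_add subspace_scale)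
  hence "0 \<le> B (y + t *\<^sub>R x) (y + t *\<^sub>R x)" using assms(2) by (auto simp: psd_on_def)
  also have "\<dots> = B y y + 2 * t * B x y"
    using assms(4) commute[of y x] by (simp add: form_simps)
  also have "\<dots> = -1" using n by (simp add: t_def field_simps)
  finally show False by simp
qed

section \<open>Orthonormal frames modulo null vectors\<close>

definition residual :: "nat \<Rightarrow> (nat \<Rightarrow> 'v) \<Rightarrow> 'v \<Rightarrow> 'v" where
  "residual r g x = x - (\<Sum>j<r. B x (g j) *\<^sub>R g j)"

text \<open>An orthonormal basis of \<open>S\<close> modulo the radical of the form.\<close>

definition frame :: "'v set \<Rightarrow> nat \<Rightarrow> (nat \<Rightarrow> 'v) \<Rightarrow> bool" where
  "frame S r g \<longleftrightarrow> (\<forall>j<r. g j \<in> S) \<and> (\<forall>i<r. \<forall>j<r. B (g i) (g j) = of_bool (i = j)) \<and>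
     (\<forall>x\<in>S. B (residual r g x) (residual r g x) = 0)"

lemma residual_add: "residual r g (x + y) = residual r g x + residual r g y"
  by (simp add: residual_def form_simps algebra_simps sum.distrib)

lemma residual_scale: "residual r g (c *\<^sub>R x) = c *\<^sub>R residual r g x"
  by (simp add: residual_def form_simps algebra_simps scaleR_sum_right)

lemma residual_mem:
  assumes "subspace S" "x \<in> S" "\<And>j. j < r \<Longrightarrow> g j \<in> S"
  shows "residual r g x \<in> S"
  unfolding residual_def using assms
  by (intro subspace_diff subspace_sum subspace_scale) auto

lemma residual_orth:
  assumes "frame S r g" "j < r"
  shows "B (residual r g x) (g j) = 0"
proof -
  have "(\<Sum>i<r. B x (g i) * B (g i) (g j)) = (\<Sum>i<r. if i = j then B x (g j) else 0)"
    using assms by (intro sum.cong) (auto simp: frame_def)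
  thus ?thesis using assms(2) by (simp add: residual_def form_simps)
qed

lemma residual_form:
  assumes "frame S r g"
  shows "B (residual r g x) (residual r g y) = B (residual r g x) y"
proof -
  have "B (residual r g x) (\<Sum>j<r. B y (g j) *\<^sub>R g j) = 0"
    using residual_orth[OF assms] by (simp add: form_simps)
  thus ?thesis unfolding residual_def[of r g y] by (simp add: diff_right)
qed

text \<open>A frame of \<open>S\<close> only says that residuals of elements of \<open>S\<close> are
  null. Semidefiniteness on the larger \<open>T\<close> turns null into orthogonal to all of
  \<open>T\<close>, which allows a frame of \<open>S\<close> to be extended beyond
  \<open>S\<close>.\<close>

lemma residual_null:
  assumes "frame S r g" "subspace T" "psd_on T" "S \<subseteq> T" "x \<in> S" "y \<in> T"
  shows "B (residual r g x) y = 0"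
proof (rule psd_null[OF assms(2,3)])
  show "residual r g x \<in> T"
    using assms by (intro residual_mem) (auto simp: frame_def)
qed (use assms in \<open>auto simp: frame_def\<close>)

lemma frame_parseval:
  assumes "frame S r g" "subspace S" "psd_on S" "x \<in> S" "y \<in> S"
  shows "B x y = (\<Sum>j<r. B x (g j) * B y (g j))"
  using residual_null[OF assms(1-3) order_refl assms(4,5)] commute
  by (simp add: residual_def form_simps)

lemma frame_insert_null:
  assumes "frame S r g" "subspace S" "psd_on (span (insert u S))"
    and "B (residual r g u) (residual r g u) = 0"
  shows "frame (span (insert u S)) r g"
  unfolding frame_def
proof (intro conjI ballI)
  let ?T = "span (insert u S)"
  have ST: "S \<subseteq> ?T" by (meson insert_subset span_superset subset_trans subset_insertI)
  show "\<forall>j<r. g j \<in> ?T" using assms(1) ST by (auto simp: frame_def)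
  show "\<forall>i<r. \<forall>j<r. B (g i) (g j) = of_bool (i = j)" using assms(1) by (auto simp: frame_def)
  fix x assume "x \<in> ?T"
  then obtain c where "x - c *\<^sub>R u \<in> span S" by (auto simp: span_breakdown_eq)
  hence y: "x - c *\<^sub>R u \<in> S" using assms(2) by (simp add: span_eq_iff[THEN iffD2])
  define y where "y = x - c *\<^sub>R u"
  have x: "x = y + c *\<^sub>R u" and "y \<in> S" using y by (simp_all add: y_def)
  have u: "residual r g u \<in> ?T"
    using assms(1) ST by (intro residual_mem) (auto simp: frame_def span_base)
  have "B (residual r g y) (residual r g u) = 0"
    by (rule residual_null[OF assms(1) _ assms(3) ST \<open>y \<in> S\<close> u]) simp
  thus "B (residual r g x) (residual r g x) = 0"
    using assms(1,4) \<open>y \<in> S\<close> commute[of "residual r g u" "residual r g y"]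
    by (simp add: x residual_add residual_scale form_simps frame_def)
qed

text \<open>One Gram-Schmidt step with the normalised residual of \<open>u\<close>. Against the
  longer family the residual of \<open>u\<close> is the zero vector itself, so
  \<open>y + c *\<^sub>R u\<close> inherits its residual from \<open>y\<close> in
  \<open>S\<close>.\<close>

lemma frame_insert_pos:
  assumes "frame S r g" "subspace S" "psd_on (span (insert u S))"
    and pos: "B (residual r g u) (residual r g u) > 0"
  shows "\<exists>g'. frame (span (insert u S)) (Suc r) g'"
proof -
  let ?T = "span (insert u S)"
  define q where "q = sqrt (B (residual r g u) (residual r g u))"
  define v where "v = (1 / q) *\<^sub>R residual r g u"
  define g' where "g' = g(r := v)"
  have q: "q > 0" "q * q = B (residual r g u) (residual r g u)" using pos by (auto simp: q_def)
  have ST: "S \<subseteq> ?T" by (meson insert_subset span_superset subset_trans subset_insertI)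
  have u: "residual r g u \<in> ?T"
    using assms(1) ST by (intro residual_mem) (auto simp: frame_def span_base)
  hence v: "v \<in> ?T" by (simp add: v_def span_scale)
  have vg: "B v (g j) = 0" if "j < r" for j
    using residual_orth[OF assms(1) that] by (simp add: v_def form_simps)
  have gv: "B (g j) v = 0" if "j < r" for j
    using vg[OF that] commute[of "g j" v] by simp
  have vv: "B v v = 1" using q(1) by (simp add: v_def form_simps q(2)[symmetric])
  have "frame ?T (Suc r) g'"
    unfolding frame_def
  proof (intro conjI ballI)
    show "\<forall>j<Suc r. g' j \<in> ?T" using assms(1) ST v by (auto simp: frame_def g'_def)
    show "\<forall>i<Suc r. \<forall>j<Suc r. B (g' i) (g' j) = of_bool (i = j)"
      using assms(1) vg vv gv by (auto simp: frame_def g'_def less_Suc_eq)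
    fix x assume "x \<in> ?T"
    then obtain c where "x - c *\<^sub>R u \<in> span S" by (auto simp: span_breakdown_eq)
    hence y: "x - c *\<^sub>R u \<in> S" using assms(2) by (simp add: span_eq_iff[THEN iffD2])
    define y where "y = x - c *\<^sub>R u"
    have x: "x = y + c *\<^sub>R u" and yS: "y \<in> S" using y by (simp_all add: y_def)
    have res: "residual (Suc r) g' z = residual r g z - B z v *\<^sub>R v" for z
      by (simp add: residual_def g'_def)
    have "B (residual r g y) v = 0"
      by (rule residual_null[OF assms(1) _ assms(3) ST yS v]) simp
    moreover have "B (residual r g z) v = B z v" for z
      using gv by (simp add: residual_def form_simps)
    ultimately have yv: "B y v = 0" by simp
    have "B u v = B (residual r g u) v" using gv by (simp add: residual_def form_simps)
    also have "\<dots> = q" using q by (simp add: v_def form_simps field_simps)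
    finally have "residual (Suc r) g' x = residual r g y + c *\<^sub>R (residual r g u - q *\<^sub>R v)"
      using yv by (simp add: res x residual_add residual_scale form_simps scaleR_diff_right)
    also have "residual r g u - q *\<^sub>R v = 0" using q by (simp add: v_def)
    finally show "B (residual (Suc r) g' x) (residual (Suc r) g' x) = 0"
      using assms(1) yS by (simp add: frame_def)
  qed
  thus ?thesis by blast
qed

lemma span_image_Suc: "span (insert (f n) (span (f ` {..<n}))) = span (f ` {..<Suc n})"
  by (simp add: lessThan_Suc span_insert span_span)

text \<open>Gram-Schmidt over the generators. A generator with null residual adds nothing to the
  family, so its length is the rank of the form and not the dimension of the span.\<close>

lemma frame_exists:
  fixes f :: "nat \<Rightarrow> 'v"
  assumes "psd_on (span (f ` {..<n}))"
  shows "\<exists>r g. frame (span (f ` {..<n})) r g"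
  using assms
proof (induction n)
  case 0
  have "frame (span (f ` {..<0})) 0 (\<lambda>_. 0)" by (simp add: frame_def residual_def zero_left)
  thus ?case by blast
next
  case (Suc n)
  let ?S = "span (f ` {..<n})"
  have e: "span (insert (f n) ?S) = span (f ` {..<Suc n})"
    by (rule span_image_Suc)
  have "?S \<subseteq> span (f ` {..<Suc n})" by (intro span_mono) auto
  then obtain r g where fr: "frame ?S r g" using Suc psd_on_mono by blast
  let ?u = "residual r g (f n)"
  have "?u \<in> span (f ` {..<Suc n})"
    using fr \<open>?S \<subseteq> _\<close> by (intro residual_mem) (auto simp: frame_def span_base)
  hence "B ?u ?u \<ge> 0" using Suc.prems by (auto simp: psd_on_def)
  moreover have "\<exists>r g. frame (span (insert (f n) ?S)) r g" if "B ?u ?u = 0"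
    using frame_insert_null[OF fr, of "f n"] that Suc.prems by (auto simp: e)
  moreover have "\<exists>r g. frame (span (insert (f n) ?S)) r g" if "B ?u ?u > 0"
    using frame_insert_pos[OF fr, of "f n"] that Suc.prems by (auto simp: e)
  ultimately show ?case by (auto simp: e less_eq_real_def)
qed

end

section \<open>Rank and invertibility of Gram matrices\<close>

lemma span_image_lessThan_obtain:
  fixes f :: "nat \<Rightarrow> 'v::real_vector"
  assumes "x \<in> span (f ` {..<n})"
  obtains c where "x = (\<Sum>i<n. c i *\<^sub>R f i)"
proof -
  let ?R = "{x. \<exists>c. x = (\<Sum>i<n. c i *\<^sub>R f i)}"
  have "subspace ?R"
  proof (rule subspaceI)
    show "0 \<in> ?R" by (auto intro!: exI[of _ "\<lambda>_. 0"])
  next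
    fix x y assume "x \<in> ?R" "y \<in> ?R"
    then obtain c d where "x = (\<Sum>i<n. c i *\<^sub>R f i)" "y = (\<Sum>i<n. d i *\<^sub>R f i)" by auto
    hence "x + y = (\<Sum>i<n. (c i + d i) *\<^sub>R f i)" by (simp add: scaleR_add_left sum.distrib)
    thus "x + y \<in> ?R" by auto
  next
    fix a x assume "x \<in> ?R"
    then obtain c where "x = (\<Sum>i<n. c i *\<^sub>R f i)" by auto
    hence "a *\<^sub>R x = (\<Sum>i<n. (a * c i) *\<^sub>R f i)" by (simp add: scaleR_sum_right)
    thus "a *\<^sub>R x \<in> ?R" by auto
  qed
  moreover have "f ` {..<n} \<subseteq> ?R"
  proof clarsimp
    fix j assume "j < n"
    hence "f j = (\<Sum>i<n. (if i = j then 1 else 0) *\<^sub>R f i)"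
      by (simp add: if_distrib[of "\<lambda>c. c *\<^sub>R _"] cong: if_cong)
    thus "\<exists>c. f j = (\<Sum>i<n. c i *\<^sub>R f i)"
      by (intro exI[of _ "\<lambda>i. if i = j then 1 else 0"])
  qed
  ultimately have "x \<in> ?R" using assms span_minimal by blast
  thus thesis using that by blast
qed

text \<open>\<open>Y\<close> is onto because of its right inverse, so \<open>Y\<^sup>T * Y\<close>
  and \<open>Y\<^sup>T\<close> have the same column space; the transposed identity makes
  \<open>Y\<^sup>T\<close> injective, so its \<open>r\<close> columns are independent.\<close>

lemma mat_rank_factor:
  fixes Y Q :: "real mat"
  assumes Y: "Y \<in> carrier_mat r n" and Q: "Q \<in> carrier_mat n r" and YQ: "Y * Q = 1\<^sub>m r"
  shows "mat_rank (Y\<^sup>T * Y) = r"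
proof -
  interpret vec_space "TYPE(real)" n .
  have YT: "Y\<^sup>T \<in> carrier_mat n r" using Y by simp
  have QY: "Q\<^sup>T * Y\<^sup>T = 1\<^sub>m r" using YQ transpose_mult[OF Y Q] by simp
  have "col_space (Y\<^sup>T * Y) = col_space (Y\<^sup>T)"
  proof -
    have "\<exists>x\<in>carrier_vec n. Y\<^sup>T * Y *\<^sub>v x = Y\<^sup>T *\<^sub>v z" if z: "z \<in> carrier_vec r" for z
    proof
      have "Y\<^sup>T * Y *\<^sub>v (Q *\<^sub>v z) = Y\<^sup>T *\<^sub>v ((Y * Q) *\<^sub>v z)"
        using Y Q z assoc_mult_mat_vec[OF YT Y, of "Q *\<^sub>v z"] assoc_mult_mat_vec[OF Y Q z] by simp
      thus "Y\<^sup>T * Y *\<^sub>v (Q *\<^sub>v z) = Y\<^sup>T *\<^sub>v z" using YQ z by simp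
    qed (use Q z in auto)
    moreover have "\<exists>z\<in>carrier_vec r. Y\<^sup>T *\<^sub>v z = Y\<^sup>T * Y *\<^sub>v x" if "x \<in> carrier_vec n" for x
      using assoc_mult_mat_vec[OF YT Y that] Y that by (intro bexI[of _ "Y *\<^sub>v x"]) auto
    ultimately show ?thesis
      using Y by (subst (1 2) col_space_eq) (auto simp: set_eq_iff; metis)+
  qed
  hence "rank (Y\<^sup>T * Y) = rank (Y\<^sup>T)" by (simp add: rank_def col_space_def)
  moreover have "rank (Y\<^sup>T) = r"
  proof (rule lin_indpt_full_rank[OF YT])
    have inj: "z = 0\<^sub>v r" if z: "z \<in> carrier_vec r" "Y\<^sup>T *\<^sub>v z = 0\<^sub>v n" for z
    proof -
      have "z = Q\<^sup>T * Y\<^sup>T *\<^sub>v z" using QY z by simp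
      also have "\<dots> = Q\<^sup>T *\<^sub>v (Y\<^sup>T *\<^sub>v z)" using Q YT z by (intro assoc_mult_mat_vec) auto
      also have "\<dots> = 0\<^sub>v r" using z Q by (auto simp: mult_mat_vec_def)
      finally show ?thesis .
    qed
    show d: "distinct (cols Y\<^sup>T)"
    proof (rule ccontr)
      assume "\<not> distinct (cols Y\<^sup>T)"
      then obtain i j where ij: "i < r" "j < r" "i \<noteq> j" "col Y\<^sup>T i = col Y\<^sup>T j"
        using Y by (auto simp: distinct_conv_nth)
      have "col (Q\<^sup>T * Y\<^sup>T) i = col (Q\<^sup>T * Y\<^sup>T) j"
        using ij Q YT by (simp add: col_mult2[of _ r n _ r])
      hence "unit_vec r i = (unit_vec r j :: real vec)" using ij by (simp add: QY)
      thus False using ij by (metis index_unit_vec(1) zero_neq_one)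
    qed
    show "lin_indpt (set (cols Y\<^sup>T))"
      using lin_depE[OF YT _ d] inj by blast
  qed
  ultimately show ?thesis using Y by simp
qed

lemma invertible_mat_iff_kernel:
  fixes A :: "real mat"
  assumes A: "A \<in> carrier_mat n n"
  shows "invertible_mat A \<longleftrightarrow> (\<forall>v\<in>carrier_vec n. A *\<^sub>v v = 0\<^sub>v n \<longrightarrow> v = 0\<^sub>v n)"
proof
  assume "invertible_mat A"
  then obtain X where X: "A * X = 1\<^sub>m n" "X * A = 1\<^sub>m (dim_row X)"
    using A by (auto simp: invertible_mat_def inverts_mat_def)
  have "dim_row X = n" using arg_cong[OF X(2), of dim_col] A by simp
  moreover have "dim_col X = n" using arg_cong[OF X(1), of dim_col] by simp
  ultimately have Xc: "X \<in> carrier_mat n n" by auto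
  show "\<forall>v\<in>carrier_vec n. A *\<^sub>v v = 0\<^sub>v n \<longrightarrow> v = 0\<^sub>v n"
  proof (intro ballI impI)
    fix v :: "real Matrix.vec" assume v: "v \<in> carrier_vec n" "A *\<^sub>v v = 0\<^sub>v n"
    have "v = X * A *\<^sub>v v" using X(2) Xc v by simp
    also have "\<dots> = X *\<^sub>v (A *\<^sub>v v)" using Xc A v(1) by (intro assoc_mult_mat_vec) auto
    also have "\<dots> = 0\<^sub>v n" using v Xc by (auto simp: mult_mat_vec_def)
    finally show "v = 0\<^sub>v n" .
  qed
next
  assume "\<forall>v\<in>carrier_vec n. A *\<^sub>v v = 0\<^sub>v n \<longrightarrow> v = 0\<^sub>v n"
  hence "det A \<noteq> 0" using det_0_iff_vec_prod_zero_field[OF A] by auto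
  from det_non_zero_imp_unit[OF A this, of "()"]
  obtain X where "X \<in> carrier_mat n n" "X * A = 1\<^sub>m n" "A * X = 1\<^sub>m n"
    by (auto simp: Units_def ring_mat_def)
  thus "invertible_mat A"
    using A by (auto simp: invertible_mat_def inverts_mat_def square_mat.simps)
qed

text \<open>The common shape of the moment matrix, of \<open>N\<close> and of the Hankel matrices.
  Positivity and rank of such a matrix depend only on the span of the \<open>f i\<close>, so neither
  the order of the monomials nor their linear relations on the lines matter.\<close>

definition gram :: "('v \<Rightarrow> 'v \<Rightarrow> real) \<Rightarrow> nat \<Rightarrow> (nat \<Rightarrow> 'v) \<Rightarrow> real mat" where
  "gram B n f = mat n n (\<lambda>(i, j). B (f i) (f j))"

lemma gram_carrier [simp]: "gram B n f \<in> carrier_mat n n"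
  and dim_row_gram [simp]: "dim_row (gram B n f) = n"
  and dim_col_gram [simp]: "dim_col (gram B n f) = n"
  and index_gram [simp]: "i < n \<Longrightarrow> j < n \<Longrightarrow> gram B n f $$ (i, j) = B (f i) (f j)"
  by (auto simp: gram_def)

context symmetric_form
begin

lemma transpose_gram: "(gram B n f)\<^sup>T = gram B n f"
  by (intro eq_matI) (auto simp: commute)

lemma gram_mult_vec:
  assumes "v \<in> carrier_vec n" "i < n"
  shows "(gram B n f *\<^sub>v v) $ i = B (f i) (\<Sum>j<n. (v $ j) *\<^sub>R f j)"
  using assms by (simp add: form_simps scalar_prod_def atLeast0LessThan mult.commute)

lemma gram_quadratic:
  assumes "v \<in> carrier_vec n" "w \<in> carrier_vec n"
  shows "w \<bullet> (gram B n f *\<^sub>v v) = B (\<Sum>i<n. (w $ i) *\<^sub>R f i) (\<Sum>j<n. (v $ j) *\<^sub>R f j)"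
proof -
  have "w \<bullet> (gram B n f *\<^sub>v v) = (\<Sum>i<n. w $ i * (gram B n f *\<^sub>v v) $ i)"
    by (simp add: scalar_prod_def atLeast0LessThan)
  also have "\<dots> = (\<Sum>i<n. w $ i * B (f i) (\<Sum>j<n. (v $ j) *\<^sub>R f j))"
    by (intro sum.cong refl) (simp only: gram_mult_vec[OF assms(1)] lessThan_iff)
  finally show ?thesis by (simp add: sum_left scale_left)
qed

lemma psd_mat_gram:
  fixes f :: "nat \<Rightarrow> 'v"
  shows "psd_mat (gram B n f) \<longleftrightarrow> psd_on (span (f ` {..<n}))"
proof
  assume L: "psd_mat (gram B n f)"
  show "psd_on (span (f ` {..<n}))"
    unfolding psd_on_def
  proof
    fix x assume "x \<in> span (f ` {..<n})"
    then obtain c where x: "x = (\<Sum>i<n. c i *\<^sub>R f i)" by (rule span_image_lessThan_obtain)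
    have "0 \<le> vec n c \<bullet> (gram B n f *\<^sub>v vec n c)" using L by (auto simp: psd_mat_def)
    also have "\<dots> = B x x" by (subst gram_quadratic) (auto simp: x)
    finally show "0 \<le> B x x" .
  qed
next
  assume R: "psd_on (span (f ` {..<n}))"
  show "psd_mat (gram B n f)"
    unfolding psd_mat_def
  proof (intro conjI ballI)
    fix v :: "real Matrix.vec" assume v: "v \<in> carrier_vec (dim_row (gram B n f))"
    have "(\<Sum>i<n. (v $ i) *\<^sub>R f i) \<in> span (f ` {..<n})"
      by (intro span_sum span_scale span_base) auto
    thus "0 \<le> v \<bullet> (gram B n f *\<^sub>v v)" using R v by (subst gram_quadratic) (auto simp: psd_on_def)
  qed (auto simp: transpose_gram square_mat.simps)
qed

text \<open>\<open>Y\<close> holds the products of the generators with the frame and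
  \<open>Q\<close> expresses the frame by the generators: Parseval gives the factorisation,
  orthonormality the right inverse. The rank and the Moore-Penrose inverse are both obtained from
  it.\<close>

lemma gram_factor:
  fixes f :: "nat \<Rightarrow> 'v"
  assumes fr: "frame (span (f ` {..<n})) r g" and psd: "psd_on (span (f ` {..<n}))"
  obtains Y Q where "Y \<in> carrier_mat r n" "Q \<in> carrier_mat n r" "gram B n f = Y\<^sup>T * Y"
    "Y * Q = 1\<^sub>m r"
proof -
  let ?S = "span (f ` {..<n})"
  have "\<exists>c. g j = (\<Sum>i<n. c i *\<^sub>R f i)" if "j < r" for j
  proof -
    have "g j \<in> ?S" using fr that by (auto simp: frame_def)
    thus ?thesis by (rule span_image_lessThan_obtain) blast
  qed
  then obtain c where c: "\<And>j. j < r \<Longrightarrow> g j = (\<Sum>i<n. c j i *\<^sub>R f i)" by metis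
  define Y where "Y = mat r n (\<lambda>(j, i). B (f i) (g j))"
  define Q where "Q = mat n r (\<lambda>(i, j). c j i)"
  show thesis
  proof (rule that[of Y Q])
    show "gram B n f = Y\<^sup>T * Y"
    proof (rule eq_matI)
      fix i j assume "i < dim_row (Y\<^sup>T * Y)" "j < dim_col (Y\<^sup>T * Y)"
      hence ij: "i < n" "j < n" by (auto simp: Y_def)
      have "B (f i) (f j) = (\<Sum>l<r. B (f i) (g l) * B (f j) (g l))"
        using ij by (intro frame_parseval[OF fr _ psd]) (auto simp: span_base)
      thus "gram B n f $$ (i, j) = (Y\<^sup>T * Y) $$ (i, j)"
        using ij by (simp add: Y_def scalar_prod_def atLeast0LessThan)
    qed (auto simp: Y_def)
    show "Y * Q = 1\<^sub>m r"
    proof (rule eq_matI)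
      fix i j assume "i < dim_row (1\<^sub>m r)" "j < dim_col (1\<^sub>m r)"
      hence ij: "i < r" "j < r" by auto
      have "(Y * Q) $$ (i, j) = (\<Sum>l<n. B (f l) (g i) * c j l)"
        using ij by (simp add: Y_def Q_def scalar_prod_def atLeast0LessThan)
      also have "\<dots> = B (\<Sum>l<n. c j l *\<^sub>R f l) (g i)" by (simp add: form_simps mult.commute)
      also have "\<dots> = B (g j) (g i)" using c[OF ij(2)] by simp
      also have "\<dots> = of_bool (j = i)" using fr ij by (simp add: frame_def)
      finally show "(Y * Q) $$ (i, j) = 1\<^sub>m r $$ (i, j)" using ij by auto
    qed (auto simp: Y_def Q_def)
  qed (auto simp: Y_def Q_def)
qed

lemma mat_rank_gram:
  assumes "frame (span (f ` {..<n})) r g" "psd_on (span (f ` {..<n}))"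
  shows "mat_rank (gram B n f) = r"
proof -
  obtain Y Q where "Y \<in> carrier_mat r n" "Q \<in> carrier_mat n r" "gram B n f = Y\<^sup>T * Y"
    "Y * Q = 1\<^sub>m r" using gram_factor[OF assms] .
  thus ?thesis using mat_rank_factor[of Y r n Q] by metis
qed

text \<open>The matrix of mixed products of the two frames has orthonormal rows, so \<open>r\<close>
  is the rank of a square matrix of size \<open>r'\<close>.\<close>

lemma frame_size_le:
  assumes fr: "frame S r g" "frame S r' g'" and S: "subspace S" "psd_on S"
  shows "r \<le> r'"
proof -
  define Y where "Y = mat r r' (\<lambda>(i, j). B (g i) (g' j))"
  have Y: "Y \<in> carrier_mat r r'" by (simp add: Y_def)
  have YY: "Y * Y\<^sup>T = 1\<^sub>m r"
  proof (rule eq_matI)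
    fix i j assume "i < dim_row (1\<^sub>m r)" "j < dim_col (1\<^sub>m r)"
    hence ij: "i < r" "j < r" by auto
    have "(Y * Y\<^sup>T) $$ (i, j) = (\<Sum>l<r'. B (g i) (g' l) * B (g j) (g' l))"
      using ij by (simp add: Y_def scalar_prod_def atLeast0LessThan)
    also have "\<dots> = B (g i) (g j)"
      using ij fr by (intro frame_parseval[OF fr(2) S, symmetric]) (auto simp: frame_def)
    finally show "(Y * Y\<^sup>T) $$ (i, j) = 1\<^sub>m r $$ (i, j)"
      using ij fr(1) by (simp add: frame_def)
  qed (simp_all add: Y_def)
  have "mat_rank (Y\<^sup>T * Y) = r" using Y YY by (intro mat_rank_factor) auto
  moreover have "mat_rank (Y\<^sup>T * Y) \<le> r'"
    using Y by (intro vec_space.rank_le_nc) auto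
  ultimately show ?thesis by simp
qed

lemma frame_size_unique:
  "frame S r g \<Longrightarrow> frame S r' g' \<Longrightarrow> subspace S \<Longrightarrow> psd_on S \<Longrightarrow> r = r'"
  using frame_size_le by (metis le_antisym)

lemma invertible_gram_iff:
  fixes f :: "nat \<Rightarrow> 'v"
  assumes psd: "psd_on (span (f ` {..<n}))"
  shows "invertible_mat (gram B n f) \<longleftrightarrow>
    (\<forall>c. B (\<Sum>i<n. c i *\<^sub>R f i) (\<Sum>i<n. c i *\<^sub>R f i) = 0 \<longrightarrow> (\<forall>i<n. c i = 0))"
    (is "?L \<longleftrightarrow> ?R")
proof -
  have "\<not> ?L \<longleftrightarrow> (\<exists>v. v \<in> carrier_vec n \<and> v \<noteq> 0\<^sub>v n \<and> gram B n f *\<^sub>v v = 0\<^sub>v n)"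
    using invertible_mat_iff_kernel[of "gram B n f" n] by auto
  also have "\<dots> \<longleftrightarrow> \<not> ?R"
  proof
    assume "\<exists>v. v \<in> carrier_vec n \<and> v \<noteq> 0\<^sub>v n \<and> gram B n f *\<^sub>v v = 0\<^sub>v n"
    then obtain v where v: "v \<in> carrier_vec n" "v \<noteq> 0\<^sub>v n" "gram B n f *\<^sub>v v = 0\<^sub>v n" by blast
    have "B (\<Sum>i<n. (v $ i) *\<^sub>R f i) (\<Sum>i<n. (v $ i) *\<^sub>R f i) = 0"
      using gram_quadratic[OF v(1) v(1), of f] v by simp
    moreover have "\<exists>i<n. v $ i \<noteq> 0" using v by auto
    ultimately show "\<not> ?R" by blast
  next
    assume "\<not> ?R"
    then obtain c i where c: "B (\<Sum>i<n. c i *\<^sub>R f i) (\<Sum>i<n. c i *\<^sub>R f i) = 0" "i < n" "c i \<noteq> 0"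
      by auto
    let ?x = "\<Sum>i<n. c i *\<^sub>R f i"
    have x: "?x \<in> span (f ` {..<n})" by (intro span_sum span_scale span_base) auto
    have "gram B n f *\<^sub>v vec n c = 0\<^sub>v n"
    proof (rule eq_vecI)
      fix j assume j: "j < dim_vec (0\<^sub>v n)"
      have "B ?x (f j) = 0" using psd_null[OF _ psd x c(1)] j by (simp add: span_base)
      moreover have "(gram B n f *\<^sub>v vec n c) $ j = B (f j) ?x"
        using j by (subst gram_mult_vec) auto
      ultimately show "(gram B n f *\<^sub>v vec n c) $ j = 0\<^sub>v n $ j"
        using j commute by simp
    qed simp
    moreover have "vec n c \<noteq> 0\<^sub>v n" using c by (metis index_vec index_zero_vec(1))
    ultimately show "\<exists>v. v \<in> carrier_vec n \<and> v \<noteq> 0\<^sub>v n \<and> gram B n f *\<^sub>v v = 0\<^sub>v n"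
      by (intro exI[of _ "vec n c"]) simp
  qed
  finally show ?thesis by blast
qed

text \<open>\<open>w\<close> is the frame part of \<open>u\<close>. An element \<open>s\<close> of
  \<open>S\<close> is a combination of frame vectors only up to its residual, which semidefiniteness
  on \<open>T\<close> makes orthogonal to \<open>u - w\<close>.\<close>

lemma projection_exists:
  assumes fr: "frame S r g" and S: "subspace S" "S \<subseteq> T" and T: "subspace T" "psd_on T"
    and u: "u \<in> T"
  obtains w where "w \<in> S" "\<And>s. s \<in> S \<Longrightarrow> B (u - w) s = 0"
proof
  have "u - residual r g u = (\<Sum>j<r. B u (g j) *\<^sub>R g j)" by (simp add: residual_def)
  also have "\<dots> \<in> S" using fr S by (intro subspace_sum subspace_scale) (auto simp: frame_def)
  finally show "u - residual r g u \<in> S" .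
  fix s assume s: "s \<in> S"
  have "residual r g u \<in> T" using fr S u by (intro residual_mem T) (auto simp: frame_def)
  hence "B (residual r g s) (residual r g u) = 0" by (rule residual_null[OF fr T S(2) s])
  thus "B (u - (u - residual r g u)) s = 0"
    using residual_form[OF fr, of u s] commute[of "residual r g u"] by simp
qed

text \<open>The rank grows exactly if \<open>u\<close> has positive squared distance from
  \<open>S\<close>. The residual of \<open>u\<close> differs from \<open>u - w\<close> only by the
  null residual of \<open>w\<close>, so any orthogonal projection \<open>w\<close> may replace the
  one given by the frame.\<close>

lemma frame_insert_orth:
  assumes fr: "frame S r g" and S: "subspace S" and psd: "psd_on (span (insert u S))"
    and w: "w \<in> S" "\<And>s. s \<in> S \<Longrightarrow> B (u - w) s = 0"
  shows "\<exists>g'. frame (span (insert u S)) (r + of_bool (B (u - w) (u - w) \<noteq> 0)) g'"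
proof -
  let ?T = "span (insert u S)"
  have ST: "S \<subseteq> ?T" by (meson insert_subset span_superset subset_trans subset_insertI)
  have T: "subspace ?T" "u \<in> ?T" by (auto simp: span_base)
  have uw: "u - w \<in> ?T" using T ST w(1) by (auto intro: subspace_diff)
  have "residual r g (u - w) = u - w"
    using w fr by (simp add: residual_def frame_def)
  hence u: "residual r g u = (u - w) + residual r g w"
    using residual_add[of r g "u - w" w] by simp
  have "B (residual r g w) y = 0" if "y \<in> ?T" for y
    by (rule residual_null[OF fr T(1) psd ST w(1) that])
  moreover have "residual r g w \<in> ?T"
    using fr ST w by (intro residual_mem T) (auto simp: frame_def)
  ultimately have n: "B (residual r g u) (residual r g u) = B (u - w) (u - w)"
    using uw commute[of "u - w" "residual r g w"] by (simp only: u add_left add_right)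
  have "B (u - w) (u - w) \<ge> 0" using psd uw by (auto simp: psd_on_def)
  thus ?thesis
    using frame_insert_null[OF fr S psd] frame_insert_pos[OF fr S psd] n
    by (cases "B (u - w) (u - w) = 0") auto
qed

lemma mat_rank_gram_Suc:
  fixes f :: "nat \<Rightarrow> 'v"
  assumes psd: "psd_on (span (f ` {..<Suc n}))"
    and w: "w \<in> span (f ` {..<n})" "\<And>s. s \<in> span (f ` {..<n}) \<Longrightarrow> B (f n - w) s = 0"
  shows "mat_rank (gram B (Suc n) f) =
    mat_rank (gram B n f) + of_bool (B (f n - w) (f n - w) \<noteq> 0)"
proof -
  let ?S = "span (f ` {..<n})"
  have psd': "psd_on ?S" using psd by (rule psd_on_mono) (intro span_mono, auto)
  obtain r g where fr: "frame ?S r g" using frame_exists[OF psd'] by blast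
  obtain g' where "frame (span (f ` {..<Suc n})) (r + of_bool (B (f n - w) (f n - w) \<noteq> 0)) g'"
    using frame_insert_orth[OF fr _ _ w] psd by (auto simp: span_image_Suc)
  from mat_rank_gram[OF this psd] mat_rank_gram[OF fr psd'] show ?thesis by simp
qed

text \<open>The entry \<open>B u w\<close> is the only one that the two semidefinite restrictions leave
  undetermined; \<open>t\<close> is chosen so that the components of \<open>u\<close> and \<open>w\<close> orthogonal to \<open>S\<close>
  become collinear, which keeps the rank as small as possible.\<close>

lemma psd_completion:
  fixes \<kappa> \<omega> :: "'v \<Rightarrow> real"
  assumes fr: "frame S r g" and S: "subspace S"
    and lin: "linear \<kappa>" "linear \<omega>"
    and zero: "\<And>s. s \<in> S \<Longrightarrow> \<kappa> s = 0" "\<And>s. s \<in> S \<Longrightarrow> \<omega> s = 0"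
    and vals: "\<kappa> u = 0" "\<kappa> w = 1" "\<omega> u = 1" "\<omega> w = 0"
    and psd: "psd_on (span (insert u S))" "psd_on (span (insert w S))"
    and B': "\<And>t. B' t = (\<lambda>x y. B x y + t * (\<kappa> x * \<omega> y + \<omega> x * \<kappa> y))"
  obtains t and p q :: bool where
    "symmetric_form (B' t)"
    "symmetric_form.psd_on (B' t) (span (insert w (span (insert u S))))"
    "\<exists>g. frame (span (insert u S)) (r + of_bool p) g"
    "\<exists>g. frame (span (insert w S)) (r + of_bool q) g"
    "\<exists>g. symmetric_form.frame (B' t) (span (insert w (span (insert u S)))) (r + of_bool (p \<or> q)) g"
proof -
  let ?Tu = "span (insert u S)" and ?Tw = "span (insert w S)"
  define u' where "u' = residual r g u"
  define w' where "w' = residual r g w"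
  define U where "U = B u' u'"
  define W where "W = B w' w'"
  \<comment> \<open>The equality case of Cauchy-Schwarz: the completed form takes the value
    \<open>sqrt U * sqrt W\<close> at \<open>u'\<close> and \<open>w'\<close>, which makes it the
    perfect square \<open>(a * sqrt U + b * sqrt W)\<^sup>2\<close> on their span.\<close>
  define t where "t = sqrt (U * W) - B u' w'"
  define C where "C = B' t"
  have C_eq: "C = (\<lambda>x y. B x y + t * (\<kappa> x * \<omega> y + \<omega> x * \<kappa> y))" by (simp add: C_def B')
  have ST: "S \<subseteq> ?Tu" "S \<subseteq> ?Tw"
    by (meson insert_subset span_superset subset_trans subset_insertI)+
  have gS: "g j \<in> S" if "j < r" for j using fr that by (auto simp: frame_def)
  have u'T: "u' \<in> ?Tu" unfolding u'_def using gS ST by (intro residual_mem) (auto simp: span_base)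
  have w'T: "w' \<in> ?Tw" unfolding w'_def using gS ST by (intro residual_mem) (auto simp: span_base)
  have U0: "U \<ge> 0" and W0: "W \<ge> 0" using psd u'T w'T by (auto simp: psd_on_def U_def W_def)
  have lins: "\<kappa> (x + y) = \<kappa> x + \<kappa> y" "\<kappa> (x - y) = \<kappa> x - \<kappa> y" "\<kappa> (c *\<^sub>R x) = c * \<kappa> x"
      "\<omega> (x + y) = \<omega> x + \<omega> y" "\<omega> (x - y) = \<omega> x - \<omega> y" "\<omega> (c *\<^sub>R x) = c * \<omega> x" for x y c
    using lin by (simp_all add: linear_add linear_diff linear_cmul)
  have us: "u - u' \<in> S" and ws: "w - w' \<in> S"
    using gS S by (auto simp: u'_def w'_def residual_def intro!: subspace_sum subspace_scale)
  have vals': "\<kappa> u' = 0" "\<kappa> w' = 1" "\<omega> u' = 1" "\<omega> w' = 0"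
    using zero(1)[OF us] zero(1)[OF ws] zero(2)[OF us] zero(2)[OF ws] vals by (auto simp: lins)
  have sf: "symmetric_form C"
  proof
    show "bilinear C"
      unfolding bilinear_def C_eq
      by (intro conjI allI linearI) (auto simp: form_simps lins algebra_simps)
    show "C x y = C y x" for x y by (simp add: C_eq commute[of x y] algebra_simps)
  qed
  interpret C: symmetric_form C by (rule sf)
  \<comment> \<open>Both functionals vanish on \<open>S\<close>, so the correction is invisible once
    an argument lies in \<open>S\<close>: residuals and the frame of \<open>S\<close> are the same
    for both forms.\<close>
  have CS: "C s x = B s x" if "s \<in> S" for s x using zero that by (simp add: C_eq)
  have res: "C.residual r g x = residual r g x" for x
    unfolding C.residual_def residual_def
    using CS[OF gS] by (auto simp: C.commute[of x] commute[of x] intro!: sum.cong)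
  have resS: "residual r g s \<in> S" if "s \<in> S" for s
    using gS S that by (intro residual_mem) auto
  have fr': "C.frame S r g"
    unfolding C.frame_def res using fr gS resS by (auto simp: frame_def CS)
  have Cuu: "C u' u' = U" and Cww: "C w' w' = W" and Cuw: "C u' w' = sqrt U * sqrt W"
    by (auto simp: C_eq vals' U_def W_def t_def real_sqrt_mult)
  have nullu: "B (residual r g s) u' = 0" and nullw: "B (residual r g s) w' = 0" if "s \<in> S" for s
    using residual_null[OF fr _ psd(1) ST(1) that u'T] residual_null[OF fr _ psd(2) ST(2) that w'T]
    by auto
  have orthu: "B u' s = 0" and orthw: "B w' s = 0" if "s \<in> S" for s
    using nullu[OF that] nullw[OF that] residual_form[OF fr, of u s] residual_form[OF fr, of w s]
    by (auto simp: u'_def w'_def commute)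
  have dec: "\<exists>a b s. s \<in> S \<and> x = s + a *\<^sub>R u' + b *\<^sub>R w'" if x: "x \<in> span (insert w ?Tu)" for x
  proof -
    obtain b where "x - b *\<^sub>R w \<in> span ?Tu" using x by (auto simp: span_breakdown_eq)
    hence "x - b *\<^sub>R w \<in> ?Tu" by (simp add: span_span)
    then obtain a where "x - b *\<^sub>R w - a *\<^sub>R u \<in> span S" by (auto simp: span_breakdown_eq)
    hence s: "x - b *\<^sub>R w - a *\<^sub>R u \<in> S" using S by (simp add: span_eq_iff[THEN iffD2])
    have "x - b *\<^sub>R w - a *\<^sub>R u + a *\<^sub>R (u - u') + b *\<^sub>R (w - w') \<in> S"
      using S s us ws by (intro subspace_add subspace_scale)
    moreover have "x = (x - b *\<^sub>R w - a *\<^sub>R u + a *\<^sub>R (u - u') + b *\<^sub>R (w - w')) + a *\<^sub>R u' + b *\<^sub>R w'"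
      by (simp add: algebra_simps)
    ultimately show ?thesis by blast
  qed
  have psdS: "psd_on S" using psd(1) ST(1) by (rule psd_on_mono)
  have psd': "C.psd_on (span (insert w ?Tu))"
    unfolding C.psd_on_def
  proof
    fix x assume "x \<in> span (insert w ?Tu)"
    then obtain a b s where s: "s \<in> S" and x: "x = s + a *\<^sub>R u' + b *\<^sub>R w'" using dec by blast
    have c: "C s u' = 0" "C s w' = 0" "C s s = B s s"
      using orthu[OF s] orthw[OF s] CS[OF s] commute[of s u'] commute[of s w'] by auto
    have "C x x = B s s + a * a * U + 2 * a * b * (sqrt U * sqrt W) + b * b * W"
      unfolding x C.form_quadratic by (simp add: c Cuu Cww Cuw)
    also have "\<dots> = B s s + (a * sqrt U + b * sqrt W)\<^sup>2"
      using U0 W0 by (simp add: power2_eq_square algebra_simps)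
    finally show "0 \<le> C x x" using psdS s by (simp add: psd_on_def)
  qed
  define p q where "p = (U \<noteq> 0)" and "q = (W \<noteq> 0)"
  have r1: "\<exists>g. frame ?Tu (r + of_bool p) g"
    using frame_insert_orth[OF fr S psd(1) us] orthu by (simp add: p_def U_def)
  have r2: "\<exists>g. frame ?Tw (r + of_bool q) g"
    using frame_insert_orth[OF fr S psd(2) ws] orthw by (simp add: q_def W_def)
  have "?Tu \<subseteq> span (insert w ?Tu)" by (meson insert_subset span_superset subset_trans subset_insertI)
  hence psdu': "C.psd_on ?Tu" by (rule C.psd_on_mono[OF psd'])
  have "C u' s = 0" if "s \<in> S" for s using orthu that CS[OF that] C.commute commute by metis
  hence "\<exists>g. C.frame ?Tu (r + of_bool p) g"
    using C.frame_insert_orth[OF fr' S psdu' us] by (simp add: Cuu p_def)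
  then obtain g' where g': "C.frame ?Tu (r + of_bool p) g'" by blast
  \<comment> \<open>\<open>c *\<^sub>R u'\<close> is the projection of \<open>w'\<close> on
    \<open>u'\<close> for the completed form. For \<open>U = 0\<close> the quotient is
    \<open>0\<close>, which is still right because \<open>sqrt U * sqrt W\<close> vanishes
    too.\<close>
  define c where "c = sqrt W / sqrt U"
  define w1 where "w1 = (w - w') + c *\<^sub>R u'"
  have w1: "w1 \<in> ?Tu" unfolding w1_def using ws ST u'T by (auto intro: span_add span_scale)
  have ww1: "w - w1 = w' - c *\<^sub>R u'" by (simp add: w1_def)
  have cU: "c * U = sqrt U * sqrt W"
    using U0 by (cases "U = 0") (simp_all add: c_def field_simps)
  have Cs: "C u' s = 0" "C w' s = 0" if "s \<in> S" for s
    using orthu orthw that CS[OF that] C.commute commute by metis+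
  have o1: "C (w - w1) u' = 0"
    using Cuw cU by (simp add: ww1 C.form_simps Cuu C.commute[of w' u'])
  have "C (w - w1) y = 0" if y: "y \<in> ?Tu" for y
  proof -
    obtain a where "y - a *\<^sub>R u \<in> span S" using span_breakdown_eq[THEN iffD1, OF y] by blast
    hence s: "y - a *\<^sub>R u \<in> S" using S by (simp add: span_eq_iff[THEN iffD2])
    have "y - a *\<^sub>R u + a *\<^sub>R (u - u') \<in> S" using s us S by (intro subspace_add subspace_scale)
    hence "C (w - w1) (y - a *\<^sub>R u + a *\<^sub>R (u - u')) = 0"
      using Cs by (simp add: ww1 C.diff_left C.scale_left)
    thus ?thesis using o1 by (simp add: C.diff_right C.add_right C.scale_right algebra_simps)
  qed
  note fin = C.frame_insert_orth[OF g' _ psd' w1 this]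
  have "C (w - w1) (w - w1) = W - c * (sqrt U * sqrt W)"
    using o1 Cuw by (simp add: ww1 C.form_simps Cww C.commute[of w' u'])
  \<comment> \<open>\<open>w\<close> adds a direction only if \<open>u\<close> did not, which turns
    the two rank increments into their disjunction.\<close>
  also have "\<dots> = (if U = 0 then W else 0)"
    using U0 W0 by (auto simp: c_def)
  finally have eq: "r + of_bool p + of_bool (C (w - w1) (w - w1) \<noteq> 0) = r + of_bool (p \<or> q)"
    by (auto simp: p_def q_def)
  hence r3: "\<exists>g. C.frame (span (insert w ?Tu)) (r + of_bool (p \<or> q)) g"
    using fin[OF subspace_span] unfolding eq by blast
  show thesis
    using that[OF sf[unfolded C_def] psd'[unfolded C_def] r1 r2 r3[unfolded C_def]] .
qed

end


section \<open>Moment functionals and Gauss quadrature\<close>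

text \<open>Gives polynomials, and through \<open>^\<close> also vectors of polynomials, the
  \<open>span\<close>, \<open>subspace\<close> and \<open>linear\<close> in which the forms above
  are stated.\<close>

instantiation poly :: ("{comm_ring_1, real_algebra_1}") real_vector
begin

definition scaleR_poly :: "real \<Rightarrow> 'a poly \<Rightarrow> 'a poly" where
  "scaleR_poly c p = smult (of_real c) p"

instance
  by standard (simp_all add: scaleR_poly_def smult_add_right smult_add_left)

end

lemma scaleR_real_poly [simp]: "c *\<^sub>R p = smult c (p :: real poly)"
  by (simp add: scaleR_poly_def)

definition mom :: "(nat \<Rightarrow> real) \<Rightarrow> real poly \<Rightarrow> real" where
  "mom m p = (\<Sum>i\<le>degree p. coeff p i * m i)"

lemma mom_eq: "degree p \<le> n \<Longrightarrow> mom m p = (\<Sum>i\<le>n. coeff p i * m i)"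
  unfolding mom_def by (rule sum.mono_neutral_left) (auto simp: coeff_eq_0)

lemma mom_add: "mom m (p + q) = mom m p + mom m q"
proof -
  let ?n = "max (degree p) (degree q)"
  have "mom m (p + q) = (\<Sum>i\<le>?n. coeff (p + q) i * m i)" by (rule mom_eq[OF degree_add_le_max])
  thus ?thesis by (simp add: mom_eq[of p ?n] mom_eq[of q ?n] sum.distrib algebra_simps)
qed

lemma mom_smult: "mom m (smult c p) = c * mom m p"
  by (simp add: mom_eq[OF degree_smult_le] mom_def sum_distrib_left mult.assoc)

lemma linear_mom: "linear (mom m)"
  by (rule linearI) (auto simp: mom_add mom_smult)

lemma mom_0 [simp]: "mom m 0 = 0"
  by (simp add: mom_def)

lemma mom_diff: "mom m (p - q) = mom m p - mom m q"
  using linear_mom by (rule linear_diff)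

lemma mom_sum: "mom m (\<Sum>i\<in>A. f i) = (\<Sum>i\<in>A. mom m (f i))"
  using linear_mom by (rule linear_sum)

lemma mom_monom [simp]: "mom m (monom c i) = c * m i"
  by (simp add: mom_eq[OF degree_monom_le] coeff_monom if_distrib[of "\<lambda>x. x * _"] cong: if_cong)

interpretation mom: symmetric_form "\<lambda>p q. mom m (p * q)" for m
proof
  show "bilinear (\<lambda>p q. mom m (p * q))"
    unfolding bilinear_def by (auto intro!: linearI simp: mom_add mom_smult algebra_simps)
qed (simp add: mult.commute)

text \<open>The index is the dimension. Stated by coefficients because \<open>degree 0 = 0\<close>
  would exclude the zero polynomial from the case \<open>n = 0\<close>.\<close>

definition polys :: "nat \<Rightarrow> real poly set" where
  "polys n = {p. \<forall>i\<ge>n. coeff p i = 0}"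

lemma polys_iff: "p \<in> polys n \<longleftrightarrow> p = 0 \<or> degree p < n"
  by (auto simp: polys_def coeff_eq_0)
     (metis leading_coeff_0_iff linorder_not_le)

lemma polys_Suc_iff: "p \<in> polys (Suc n) \<longleftrightarrow> degree p \<le> n"
  by (auto simp: polys_iff)

lemma subspace_polys [simp]: "subspace (polys n)"
  by (rule subspaceI) (auto simp: polys_def)

lemma polys_mono: "m \<le> n \<Longrightarrow> polys m \<subseteq> polys n"
  by (auto simp: polys_def)

lemma monom_in_polys [simp]: "i < n \<Longrightarrow> monom c i \<in> polys n"
  by (auto simp: polys_def)

lemma polys_expand: "p \<in> polys n \<Longrightarrow> p = (\<Sum>i<n. monom (coeff p i) i)"
  by (rule poly_eqI) (auto simp: coeff_sum polys_def intro: linorder_not_less[THEN iffD1])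

lemma span_monom: "span ((\<lambda>i. monom 1 i) ` {..<n}) = polys n"
proof
  show "span ((\<lambda>i. monom 1 i) ` {..<n}) \<subseteq> polys n"
    by (rule span_minimal) auto
  show "polys n \<subseteq> span ((\<lambda>i. monom 1 i) ` {..<n})"
  proof
    fix p assume "p \<in> polys n"
    hence "(\<Sum>i<n. coeff p i *\<^sub>R monom 1 i) = p"
      using polys_expand[of p n] by (simp add: smult_monom)
    moreover have "(\<Sum>i<n. coeff p i *\<^sub>R monom 1 i) \<in> span ((\<lambda>i. monom 1 i) ` {..<n})"
      by (intro span_sum span_scale span_base) auto
    ultimately show "p \<in> span ((\<lambda>i. monom 1 i) ` {..<n})" by metis
  qed
qed

lemma mult_in_polys: "p \<in> polys m \<Longrightarrow> q \<in> polys n \<Longrightarrow> p * q \<in> polys (m + n - 1)"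
  by (auto simp: polys_iff intro: le_less_trans[OF degree_mult_le])

lemma mom_cong:
  assumes "p \<in> polys n" "\<And>i. i < n \<Longrightarrow> m i = m' i"
  shows "mom m p = mom m' p"
  using assms by (auto simp: mom_def polys_iff intro!: sum.cong)

section \<open>Real simple roots and Gauss quadrature\<close>

lemma map_poly_of_real_mult:
    "map_poly complex_of_real (p * q) = map_poly complex_of_real p * map_poly complex_of_real q"
  and map_poly_of_real_add:
    "map_poly complex_of_real (p + q) = map_poly complex_of_real p + map_poly complex_of_real q"
  by (rule poly_eqI; simp add: coeff_map_poly coeff_mult)+

lemma poly_map_poly_of_real:
  "poly (map_poly complex_of_real p) (complex_of_real x) = complex_of_real (poly p x)"
  by (induction p) (simp_all add: map_poly_pCons)

text \<open>The excluded factors are the real quadratics with a pair of conjugate roots and, for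
  \<open>c = 0\<close>, the squares of linear polynomials. Without them all complex roots are real
  and simple.\<close>

lemma card_real_roots:
  fixes q :: "real poly"
  assumes q: "q \<noteq> 0" and sq: "\<And>a c s. q \<noteq> ([:-a, 1:]\<^sup>2 + [:c\<^sup>2:]) * s"
  shows "card {x. poly q x = 0} = degree q"
proof -
  define Q where "Q = map_poly complex_of_real q"
  note h = map_poly_of_real_mult map_poly_of_real_add
  have Q0: "Q \<noteq> 0" using q by (simp add: Q_def map_poly_eq_0_iff)
  have deg: "degree Q = degree q" by (simp add: Q_def degree_map_poly)
  have real: "Im z = 0" if z: "poly Q z = 0" for z
  proof (rule ccontr)
    assume im: "Im z \<noteq> 0"
    \<comment> \<open>The real quadratic with roots \<open>z\<close> and its conjugate. The
      remainder of \<open>q\<close> modulo \<open>w\<close> is real of degree at most one and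
      vanishes at the nonreal \<open>z\<close>, hence is zero.\<close>
    define w where "w = [:-Re z, 1:]\<^sup>2 + [:(Im z)\<^sup>2:]"
    have w: "w = [:(Re z)\<^sup>2 + (Im z)\<^sup>2, - 2 * Re z, 1:]" by (simp add: w_def power2_eq_square)
    hence dw: "degree w = 2" "w \<noteq> 0" by auto
    define r where "r = q mod w"
    have "degree r < 2" using degree_mod_less[OF dw(2), of q] dw by (auto simp: r_def)
    hence r': "r = [:coeff r 0, coeff r 1:]"
      by (intro poly_eqI) (auto simp: coeff_pCons coeff_eq_0 split: nat.split)
    obtain c d where r: "r = [:d, c:]" using r' by metis
    have "q = w * (q div w) + r" by (simp add: r_def)
    hence "Q = map_poly complex_of_real w * map_poly complex_of_real (q div w) + map_poly complex_of_real r"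
      unfolding Q_def by (metis h)
    moreover have "poly (map_poly complex_of_real w) z = 0"
      by (simp add: w map_poly_pCons complex_eq_iff power2_eq_square algebra_simps)
    ultimately have "poly (map_poly complex_of_real r) z = 0" using z by simp
    hence "complex_of_real d + z * complex_of_real c = 0" by (simp add: r map_poly_pCons)
    hence "c = 0 \<and> d = 0" using im by (auto simp: complex_eq_iff)
    hence "q = w * (q div w)" using \<open>q = w * (q div w) + r\<close> by (simp add: r)
    thus False using sq unfolding w_def by blast
  qed
  have "rsquarefree Q"
    unfolding rsquarefree_roots
  proof (intro allI notI)
    fix z assume z: "poly Q z = 0 \<and> poly (pderiv Q) z = 0"
    define x where "x = Re z"
    have zx: "z = complex_of_real x" using real z by (simp add: x_def complex_eq_iff)
    have "poly q x = 0" using z by (simp add: Q_def zx poly_map_poly_of_real)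
    then obtain s where s: "q = [:-x, 1:] * s" by (auto simp: poly_eq_0_iff_dvd)
    have "Q = [:-z, 1:] * map_poly complex_of_real s"
      unfolding Q_def s h by (simp add: map_poly_pCons zx)
    hence "poly (pderiv Q) z = poly (map_poly complex_of_real s) z"
      by (simp only: pderiv_mult poly_add poly_mult) (simp add: pderiv_pCons)
    hence "poly (map_poly complex_of_real s) z = 0" using z by simp
    hence "poly s x = 0" by (simp add: zx poly_map_poly_of_real)
    then obtain s' where s': "s = [:-x, 1:] * s'" by (auto simp: poly_eq_0_iff_dvd)
    have "q = ([:-x, 1:]\<^sup>2 + [:0\<^sup>2:]) * s'"
      by (simp only: s s' power2_eq_square mult.assoc mult_zero_left pCons_0_0 add_0_right)
    thus False using sq by blast
  qed
  from complex_poly_decompose_rsquarefree[OF this]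
  have "degree Q = degree (\<Prod>z|poly Q z = 0. [:-z, 1:])"
    using Q0 by (metis degree_smult_eq leading_coeff_0_iff)
  also have "\<dots> = card {z. poly Q z = 0}" by (subst degree_prod_eq_sum_degree) auto
  also have "{z. poly Q z = 0} = complex_of_real ` {x. poly q x = 0}"
  proof (intro equalityI subsetI)
    fix z assume "z \<in> {z. poly Q z = 0}"
    hence z: "poly Q z = 0" by simp
    hence zx: "z = complex_of_real (Re z)" using real by (simp add: complex_eq_iff)
    hence "poly q (Re z) = 0" using z unfolding Q_def by (metis of_real_eq_0_iff poly_map_poly_of_real)
    thus "z \<in> complex_of_real ` {x. poly q x = 0}" using zx by blast
  qed (auto simp: Q_def poly_map_poly_of_real)
  also have "card \<dots> = card {x. poly q x = 0}" by (intro card_image inj_onI) auto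
  finally show ?thesis by (simp add: deg)
qed

lemma lagrange_basis_exists:
  fixes z :: "nat \<Rightarrow> real"
  assumes inj: "inj_on z {..<r}"
  obtains l where "\<And>i j. i < r \<Longrightarrow> j < r \<Longrightarrow> poly (l j) (z i) = of_bool (i = j)"
    "\<And>j. j < r \<Longrightarrow> l j \<in> polys r"
proof -
  define l where "l j = (\<Prod>i\<in>{..<r} - {j}. smult (1 / (z j - z i)) [:- z i, 1:])" for j
  have lz: "poly (l j) (z i) = of_bool (i = j)" if "i < r" "j < r" for i j
  proof (cases "i = j")
    case True
    have "z j \<noteq> z i" if "i \<in> {..<r} - {j}" for i
      using inj that \<open>j < r\<close> by (auto dest: inj_onD)
    thus ?thesis using True by (auto simp: l_def poly_prod diff_divide_distrib[symmetric] intro!: prod.neutral)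
  next
    case False
    thus ?thesis using that by (auto simp: l_def poly_prod intro!: prod_zero bexI[of _ i])
  qed
  have lp: "l j \<in> polys r" if "j < r" for j
  proof -
    have "degree (l j) \<le> (\<Sum>i\<in>{..<r} - {j}. 1)"
      unfolding l_def
      by (rule order.trans[OF degree_prod_sum_le], simp, unfold o_def, rule sum_mono,
          rule order.trans[OF degree_smult_le], simp)
    also have "\<dots> < r" using that by simp
    finally show ?thesis by (simp add: polys_iff)
  qed
  show thesis using that lz lp by blast
qed

text \<open>The nodes are the roots of \<open>q\<close>. A forbidden factor with cofactor s would
  give q s = ((x - a) s)^2 + (c s)^2, whose moment is zero by orthogonality, against definiteness.
  Division by \<open>q\<close> reduces exactness below degree \<open>r + d\<close> to interpolation
  below degree \<open>r\<close>. The parameter \<open>d\<close> is separate from \<open>r\<close>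
  because the definite and the singular case supply orthogonality up to different degrees.\<close>

lemma gauss_quadrature:
  assumes psd: "mom.psd_on m (polys r)"
    and pd: "\<And>p. p \<in> polys r \<Longrightarrow> mom m (p * p) = 0 \<Longrightarrow> p = 0"
    and q: "degree q = r" "q \<noteq> 0"
    and orth: "\<And>p. p \<in> polys d \<Longrightarrow> mom m (q * p) = 0" and "r \<le> d"
  shows "\<exists>z \<rho>. inj_on z {..<r} \<and> (\<forall>j<r. \<rho> j > 0) \<and>
    (\<forall>f\<in>polys (r + d). mom m f = (\<Sum>j<r. \<rho> j * poly f (z j)))"
proof -
  have "card {x. poly q x = 0} = degree q"
  proof (rule card_real_roots[OF q(2)])
    fix a c s
    show "q \<noteq> ([:-a, 1:]\<^sup>2 + [:c\<^sup>2:]) * s"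
    proof
      assume qs: "q = ([:-a, 1:]\<^sup>2 + [:c\<^sup>2:]) * s"
      hence s0: "s \<noteq> 0" using q by auto
      have e: "[:-a, 1:]\<^sup>2 + [:c\<^sup>2:] = [:a\<^sup>2 + c\<^sup>2, - 2 * a, 1:]" by (simp add: power2_eq_square)
      have "degree q = 2 + degree s" unfolding qs e using s0 by (subst degree_mult_eq) auto
      hence sr: "s \<in> polys r" "[:-a, 1:] * s \<in> polys r" "s \<in> polys d"
        using q s0 \<open>r \<le> d\<close> by (auto simp: polys_iff degree_mult_eq simp del: mult_pCons_left)
      have "0 = mom m (q * s)" using orth[OF sr(3)] by simp
      also have "q * s = ([:-a, 1:] * s) * ([:-a, 1:] * s) + smult (c\<^sup>2) (s * s)"
        by (simp only: qs power2_eq_square distrib_right mult_smult_left mult_smult_right smult_smult mult_ac)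
           (simp add: algebra_simps smult_add_left)
      finally have "mom m (([:-a, 1:] * s) * ([:-a, 1:] * s)) + c\<^sup>2 * mom m (s * s) = 0"
        by (simp only: mom_add mom_smult)
      moreover have "mom m (([:-a, 1:] * s) * ([:-a, 1:] * s)) \<ge> 0" "c\<^sup>2 * mom m (s * s) \<ge> 0"
        using psd sr unfolding mom.psd_on_def by (auto intro!: mult_nonneg_nonneg)
      ultimately have "mom m (([:-a, 1:] * s) * ([:-a, 1:] * s)) = 0" by linarith
      hence "[:-a, 1:] * s = 0" by (rule pd[OF sr(2)])
      thus False using s0 unfolding mult_eq_0_iff by simp
    qed
  qed
  hence card: "card {x. poly q x = 0} = r" using q by simp
  have fin: "finite {x. poly q x = 0}" using q poly_roots_finite by blast
  obtain z where z: "bij_betw z {..<r} {x. poly q x = 0}"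
    using ex_bij_betw_nat_finite[OF fin] card by (auto simp: atLeast0LessThan)
  have inj: "inj_on z {..<r}" and qz: "\<And>j. j < r \<Longrightarrow> poly q (z j) = 0"
    using z by (auto simp: bij_betw_def)
  obtain l where lz: "\<And>i j. i < r \<Longrightarrow> j < r \<Longrightarrow> poly (l j) (z i) = of_bool (i = j)"
    and lp: "\<And>j. j < r \<Longrightarrow> l j \<in> polys r"
    using lagrange_basis_exists[OF inj] by blast
  define \<rho> where "\<rho> j = mom m (l j)" for j
  have rep: "mom m f = (\<Sum>j<r. \<rho> j * poly f (z j))" if f: "f \<in> polys (r + d)" for f
  proof -
    have "f div q \<in> polys d"
    proof (cases "f div q = 0")
      case False
      have "f mod q \<in> polys (r + d)" using degree_mod_less[OF q(2), of f] q(1) by (auto simp: polys_iff)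
      hence "f - f mod q \<in> polys (r + d)" using f by (intro subspace_diff) auto
      hence "q * (f div q) \<in> polys (r + d)" by (simp add: minus_mod_eq_mult_div)
      thus ?thesis using False q by (auto simp: polys_iff degree_mult_eq)
    qed (simp add: polys_iff)
    hence "mom m (q * (f div q)) = 0" by (rule orth)
    hence 1: "mom m f = mom m (f mod q)"
      using mom_add[of m "q * (f div q)" "f mod q"] by simp
    have fz: "poly (f mod q) (z j) = poly f (z j)" if "j < r" for j
      using arg_cong[OF mult_div_mod_eq[of q f], of "\<lambda>p. poly p (z j)"] qz[OF that]
      unfolding poly_add poly_mult by simp
    have "f mod q - (\<Sum>j<r. smult (poly f (z j)) (l j)) = 0" (is "?g = 0")
    proof (rule ccontr)
      assume g: "?g \<noteq> 0"
      have "f mod q \<in> polys r" using degree_mod_less[OF q(2), of f] q(1) by (auto simp: polys_iff)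
      moreover have "(\<Sum>j<r. smult (poly f (z j)) (l j)) \<in> polys r"
        using lp subspace_scale[OF subspace_polys, of _ r] by (intro subspace_sum) auto
      ultimately have "?g \<in> polys r" by (intro subspace_diff) auto
      hence dg: "degree ?g < r" using g by (auto simp: polys_iff)
      have "poly ?g (z i) = 0" if i: "i < r" for i
      proof -
        have "(\<Sum>j<r. poly f (z j) * poly (l j) (z i)) = (\<Sum>j<r. if j = i then poly f (z i) else 0)"
          using lz[OF i] by (intro sum.cong) auto
        thus ?thesis using i by (simp add: poly_sum fz)
      qed
      hence "z ` {..<r} \<subseteq> {x. poly ?g x = 0}" by blast
      hence "r \<le> card {x. poly ?g x = 0}"
        using card_mono[OF poly_roots_finite[OF g], of "z ` {..<r}"] card_image[OF inj] by simp
      also have "\<dots> \<le> degree ?g" using g by (rule card_poly_roots_bound)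
      finally show False using dg by simp
    qed
    hence "f mod q = (\<Sum>j<r. smult (poly f (z j)) (l j))" by simp
    thus ?thesis by (simp add: 1 mom_sum mom_smult \<rho>_def mult.commute)
  qed
  \<comment> \<open>The formula is tested on the square of a Lagrange polynomial, whose degree is
    small enough because \<open>r \<le> d\<close>.\<close>
  have "\<rho> j > 0" if j: "j < r" for j
  proof -
    have "l j * l j \<in> polys (r + r - 1)" using lp[OF j] lp[OF j] by (rule mult_in_polys)
    hence "l j * l j \<in> polys (r + d)" using polys_mono[of "r + r - 1" "r + d"] \<open>r \<le> d\<close> by fastforce
    from rep[OF this] have "mom m (l j * l j) = (\<Sum>i<r. \<rho> i * poly (l j * l j) (z i))" .
    also have "\<dots> = (\<Sum>i<r. if i = j then \<rho> j else 0)"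
      using lz j by (intro sum.cong) auto
    finally have "mom m (l j * l j) = (\<Sum>i<r. if i = j then \<rho> j else 0)" .
    hence "mom m (l j * l j) = \<rho> j" using j by simp
    moreover have "l j \<noteq> 0" using lz[OF j j] by auto
    ultimately show ?thesis
      using psd pd[OF lp[OF j]] lp[OF j] by (fastforce simp: mom.psd_on_def less_le)
  qed
  thus ?thesis using inj rep by blast
qed

text \<open>In the singular case the nodes are the roots of a null polynomial of least degree
  \<open>r\<close>: the form is definite below \<open>r\<close>, and \<open>shift\<close> keeps that
  polynomial null under multiplication by powers of x up to degree \<open>k\<close>. That
  \<open>k + 1\<close> nodes occur only for a definite functional serves the later count of
  atoms.\<close>

lemma truncated_hamburger:
  assumes psd: "mom.psd_on m (polys (Suc k))"
    and shift: "\<And>p. p \<in> polys k \<Longrightarrow> mom m (p * p) = 0 \<Longrightarrow> mom m (pCons 0 p * pCons 0 p) = 0"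
  shows "\<exists>r z \<rho>. inj_on z {..<r} \<and> (\<forall>j<r. \<rho> j > 0) \<and>
    (\<forall>f\<in>polys (2 * k + 1). mom m f = (\<Sum>j<r. \<rho> j * poly f (z j))) \<and>
    (r \<le> k \<or> r = Suc k \<and> (\<forall>p\<in>polys (Suc k). mom m (p * p) = 0 \<longrightarrow> p = 0))"
proof (cases "\<forall>p\<in>polys (Suc k). mom m (p * p) = 0 \<longrightarrow> p = 0")
  case True
  obtain r g where fr: "mom.frame m (polys (Suc k)) r g"
    using mom.frame_exists[of m "\<lambda>i. monom 1 i" "Suc k"] psd unfolding span_monom by blast
  \<comment> \<open>The orthogonal polynomial of degree \<open>k + 1\<close>. It involves
    \<open>m (2 * k + 1)\<close>, a moment beyond the data: every value of it yields a quadrature,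
    and in the end only exactness up to degree \<open>2 * k\<close> is claimed.\<close>
  define q where "q = mom.residual m r g (monom 1 (Suc k))"
  have g: "g j \<in> polys (Suc k)" if "j < r" for j using fr that by (auto simp: mom.frame_def)
  have "(\<Sum>j<r. mom m (monom 1 (Suc k) * g j) *\<^sub>R g j) \<in> polys (Suc k)"
    using g by (intro subspace_sum subspace_scale) auto
  hence qd: "coeff q (Suc k) = 1" and "q \<in> polys (Suc (Suc k))"
    unfolding q_def mom.residual_def polys_def by (auto simp: coeff_diff)
  hence "degree q \<le> Suc k" "q \<noteq> 0" by (auto simp: polys_Suc_iff)
  moreover have "degree q \<ge> Suc k" using qd by (intro le_degree) simp
  ultimately have q: "degree q = Suc k" "q \<noteq> 0" by auto
  have "mom m (q * p) = 0" if p: "p \<in> polys (Suc k)" for p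
  proof -
    have "mom.residual m r g p \<in> polys (Suc k)" by (rule mom.residual_mem[OF subspace_polys p g])
    moreover have "mom m (mom.residual m r g p * mom.residual m r g p) = 0"
      using fr p by (auto simp: mom.frame_def)
    ultimately have "mom.residual m r g p = 0" using True by blast
    thus ?thesis using mom.residual_form[OF fr, of "monom 1 (Suc k)" p] by (simp add: q_def)
  qed
  from gauss_quadrature[where d = "Suc k", OF psd _ q this order_refl] True
  obtain z \<rho> where *: "inj_on z {..<Suc k}" "\<forall>j<Suc k. \<rho> j > 0"
    "\<forall>f\<in>polys (Suc k + Suc k). mom m f = (\<Sum>j<Suc k. \<rho> j * poly f (z j))" by blast
  have "polys (2 * k + 1) \<subseteq> polys (Suc k + Suc k)" by (rule polys_mono) simp
  thus ?thesis using * True by (intro exI[of _ "Suc k"] exI[of _ z] exI[of _ \<rho>]) blast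
next
  case False
  define P where "P n \<longleftrightarrow> (\<exists>p\<in>polys (Suc k). p \<noteq> 0 \<and> mom m (p * p) = 0 \<and> degree p = n)" for n
  have "\<exists>n. P n" using False by (auto simp: P_def)
  define r where "r = (LEAST n. P n)"
  have "P r" unfolding r_def using \<open>\<exists>n. P n\<close> by (rule LeastI_ex)
  then obtain p where p: "p \<in> polys (Suc k)" "p \<noteq> 0" "mom m (p * p) = 0" "degree p = r"
    by (auto simp: P_def)
  have rk: "r \<le> k" using p by (auto simp: polys_Suc_iff)
  have pd: "s = 0" if "s \<in> polys r" "mom m (s * s) = 0" for s
  proof (rule ccontr)
    assume "s \<noteq> 0"
    hence "degree s < r" using that by (auto simp: polys_iff)
    moreover have "P (degree s)" using that \<open>s \<noteq> 0\<close> \<open>degree s < r\<close> rk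
      unfolding P_def by (auto simp: polys_Suc_iff)
    ultimately show False unfolding r_def using not_less_Least by blast
  qed
  have mult_monom_null: "monom 1 i * p \<in> polys (Suc k) \<and> mom m ((monom 1 i * p) * (monom 1 i * p)) = 0"
    if "r + i \<le> k" for i
    using that
  proof (induction i)
    case 0
    thus ?case using p by (simp add: monom_0)
  next
    case (Suc i)
    have e: "monom 1 (Suc i) * p = pCons 0 (monom 1 i * p)"
      by (simp add: monom_Suc)
    have "degree (monom 1 i * p) = i + r" using p by (simp add: degree_mult_eq degree_monom_eq)
    hence "monom 1 i * p \<in> polys k" "pCons 0 (monom 1 i * p) \<in> polys (Suc k)"
      using Suc.prems by (auto simp: polys_iff)
    thus ?case unfolding e using shift Suc by auto
  qed
  have orth: "mom m (p * g) = 0" if g: "g \<in> polys (2 * k + 1 - r)" for g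
  proof -
    have "mom m (p * monom 1 n) = 0" if n: "n < 2 * k + 1 - r" for n
    proof -
      \<comment> \<open>Splits x^n so that \<open>monom 1 i * p\<close> has degree at most
        \<open>k\<close>, hence is null, while the other factor x^j also has degree at most
        \<open>k\<close>; this reaches every \<open>n\<close> up to
        \<open>2 * k - r\<close>.\<close>
      define i where "i = min n (k - r)"
      define j where "j = n - i"
      have ij: "n = j + i" "r + i \<le> k" "j < Suc k" using n rk by (auto simp: i_def j_def)
      have "mom m ((monom 1 i * p) * monom 1 j) = 0"
        using mom.psd_null[OF subspace_polys psd, of "monom 1 i * p" "monom 1 j"] mult_monom_null[OF ij(2)] ij(3)
        by simp
      moreover have "(monom 1 i * p) * monom 1 j = p * monom 1 n"
        by (simp add: ij(1) mult.assoc mult.commute[of p] mult_monom add.commute)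
      ultimately show ?thesis by simp
    qed
    moreover have "p * g = (\<Sum>n<2 * k + 1 - r. smult (coeff g n) (p * monom 1 n))"
      by (subst polys_expand[OF g]) (simp add: sum_distrib_left smult_monom flip: mult_smult_right)
    ultimately show ?thesis by (simp add: mom_sum mom_smult)
  qed
  have "polys r \<subseteq> polys (Suc k)" using rk by (intro polys_mono) simp
  hence "mom.psd_on m (polys r)" by (rule mom.psd_on_mono[OF psd])
  from gauss_quadrature[where d = "2 * k + 1 - r", OF this pd p(4,2) orth] rk
  obtain z \<rho> where "inj_on z {..<r}" "\<forall>j<r. \<rho> j > 0"
    "\<forall>f\<in>polys (r + (2 * k + 1 - r)). mom m f = (\<Sum>j<r. \<rho> j * poly f (z j))" by fastforce
  moreover have "r + (2 * k + 1 - r) = 2 * k + 1" using rk by simp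
  ultimately show ?thesis using rk by (intro exI[of _ r] exI[of _ z] exI[of _ \<rho>]) simp
qed


section \<open>Measures on a finite union of horizontal lines\<close>

text \<open>A polynomial restricted to the lines \<open>y = \<alpha> l\<close> is the vector of its restrictions, each a
  polynomial in \<open>x\<close>; \<open>m l\<close> is the sequence of \<open>x\<close>-moments on the \<open>l\<close>-th line.\<close>

definition lform :: "('n::finite \<Rightarrow> nat \<Rightarrow> real) \<Rightarrow> real poly ^ 'n \<Rightarrow> real poly ^ 'n \<Rightarrow> real" where
  "lform m f g = (\<Sum>l\<in>UNIV. mom (m l) (vec_nth f l * vec_nth g l))"

interpretation lform: symmetric_form "lform m" for m :: "'n::finite \<Rightarrow> nat \<Rightarrow> real"
proof
  show "bilinear (lform m)"
    unfolding bilinear_def lform_def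
    by (auto intro!: linearI simp: mom_add mom_smult algebra_simps sum.distrib sum_distrib_left)
qed (simp add: lform_def mult.commute)

definition low_space :: "nat \<Rightarrow> (real poly ^ 'n::finite) set" where
  "low_space k = {f. \<forall>l. vec_nth f l \<in> polys k}"

text \<open>Of the moments of degree \<open>2 * k\<close> only the sum over the lines is known. When
  the coefficients of x^k agree on all lines, the form sees nothing but this sum.\<close>

definition mid_space :: "nat \<Rightarrow> (real poly ^ 'n::finite) set" where
  "mid_space k = {f. (\<forall>l. vec_nth f l \<in> polys (Suc k)) \<and>
     (\<forall>l l'. coeff (vec_nth f l) k = coeff (vec_nth f l') k)}"

lemma subspace_low [simp]: "subspace (low_space k)"
  by (rule subspaceI) (auto simp: low_space_def polys_def)

lemma subspace_mid [simp]: "subspace (mid_space k)"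
proof (rule subspaceI)
  fix f g :: "real poly ^ 'n" assume "f \<in> mid_space k" "g \<in> mid_space k"
  thus "f + g \<in> mid_space k"
    by (auto simp: mid_space_def polys_def intro!: arg_cong2[of _ _ _ _ "(+)"])
qed (auto simp: mid_space_def polys_def)

lemma low_subset_mid: "low_space k \<subseteq> mid_space k"
  by (auto simp: low_space_def mid_space_def polys_def)

text \<open>For three distinct lines this fixes \<open>m l i\<close> up to
  \<open>i = 2 * k - 2\<close>; for \<open>i = 2 * k - 1\<close> and \<open>i = 2 * k\<close> only
  two and one of the required three equations fall within the data.\<close>

definition line_moments :: "nat \<Rightarrow> ('n::finite \<Rightarrow> real) \<Rightarrow> (nat \<Rightarrow> nat \<Rightarrow> real) \<Rightarrow> ('n \<Rightarrow> nat \<Rightarrow> real) \<Rightarrow> bool"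
  where "line_moments k \<alpha> \<beta> m \<longleftrightarrow>
    (\<forall>i j. i + j \<le> 2 * k \<longrightarrow> \<beta> i j = (\<Sum>l\<in>UNIV. \<alpha> l ^ j * m l i))"

text \<open>The second conjunct is recursive generation. A measure forces it: a polynomial whose
  square has integral zero vanishes almost everywhere, and so does its multiple by x. By
  \<open>truncated_hamburger\<close> it also suffices.\<close>

definition hamburger :: "nat \<Rightarrow> (nat \<Rightarrow> real) \<Rightarrow> bool" where
  "hamburger k s \<longleftrightarrow> mom.psd_on s (polys (Suc k)) \<and>
     (\<forall>p\<in>polys k. mom s (p * p) = 0 \<longrightarrow> mom s (pCons 0 p * pCons 0 p) = 0)"

definition definite_on :: "(nat \<Rightarrow> real) \<Rightarrow> real poly set \<Rightarrow> bool" where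
  "definite_on s S \<longleftrightarrow> (\<forall>p\<in>S. mom s (p * p) = 0 \<longrightarrow> p = 0)"

definition lines :: "('n \<Rightarrow> real) \<Rightarrow> (real \<times> real) set" where
  "lines \<alpha> = {(x, y). y \<in> range \<alpha>}"

lemma closed_lines:
  fixes \<alpha> :: "'n::finite \<Rightarrow> real"
  shows "closed (lines \<alpha>)"
proof -
  have "lines \<alpha> = (\<Union>l. {z :: real \<times> real. snd z = \<alpha> l})"
    by (rule Set.set_eqI) (simp add: lines_def case_prod_beta image_iff)
  moreover have "closed {z :: real \<times> real. snd z = \<alpha> l}" for l
    by (intro closed_Collect_eq continuous_intros)
  ultimately show ?thesis by (simp add: closed_UN)
qed

section \<open>Atomic measures on the lines and their number of atoms\<close>

lemma finite_atomic_measure: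
  fixes z :: "nat \<Rightarrow> real \<times> real"
  assumes inj: "inj_on z {..<n}" and pos: "\<And>j. j < n \<Longrightarrow> \<rho> j > 0"
  obtains \<mu> where "atomic_measure n \<mu>" "sets \<mu> = sets borel"
    "\<And>f :: real \<times> real \<Rightarrow> real. f \<in> borel_measurable borel \<Longrightarrow> integrable \<mu> f"
    "\<And>f :: real \<times> real \<Rightarrow> real. f \<in> borel_measurable borel \<Longrightarrow>
      integral\<^sup>L \<mu> f = (\<Sum>j<n. \<rho> j * f (z j))"
    "\<And>A. A \<in> sets borel \<Longrightarrow> z ` {..<n} \<inter> A = {} \<Longrightarrow> emeasure \<mu> A = 0"
proof -
  define P where "P = point_measure {..<n} (\<lambda>j. ennreal (\<rho> j))"
  define \<mu> where "\<mu> = distr P borel z"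
  have zm: "z \<in> measurable P borel" by (simp add: P_def)
  have em: "emeasure \<mu> A = (\<Sum>j<n. ennreal (\<rho> j) * indicator A (z j))" if "A \<in> sets borel" for A
  proof -
    have "emeasure \<mu> A = emeasure P (z -` A \<inter> space P)"
      unfolding \<mu>_def using zm that by (rule emeasure_distr)
    also have "\<dots> = (\<Sum>j\<in>z -` A \<inter> {..<n}. ennreal (\<rho> j))"
      unfolding P_def space_point_measure by (subst emeasure_point_measure_finite) auto
    also have "\<dots> = (\<Sum>j<n. ennreal (\<rho> j) * indicator A (z j))"
      by (rule sum.mono_neutral_cong_left) (auto simp: indicator_def)
    finally show ?thesis .
  qed
  have P: "integrable P h" "integral\<^sup>L P h = (\<Sum>j<n. \<rho> j * h j)" for h :: "nat \<Rightarrow> real"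
    using pos unfolding P_def
    using integrable_point_measure_finite[of "{..<n}" \<rho> h]
      lebesgue_integral_point_measure_finite[of "{..<n}" \<rho> h] by (simp_all add: less_imp_le)
  show thesis
  proof (rule that[of \<mu>])
    show "sets \<mu> = sets borel" by (simp add: \<mu>_def)
    show "atomic_measure n \<mu>"
      unfolding atomic_measure_def using inj pos em by (auto simp: \<mu>_def)
    show "integrable \<mu> f" if "f \<in> borel_measurable borel" for f :: "real \<times> real \<Rightarrow> real"
      unfolding \<mu>_def using integrable_distr_eq[OF zm that] P by blast
    show "integral\<^sup>L \<mu> f = (\<Sum>j<n. \<rho> j * f (z j))" if "f \<in> borel_measurable borel"
      for f :: "real \<times> real \<Rightarrow> real"
      unfolding \<mu>_def using integral_distr[OF zm that] P by simp
    show "emeasure \<mu> A = 0" if "A \<in> sets borel" "z ` {..<n} \<inter> A = {}" for A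
      using that by (subst em) (auto simp: indicator_def)
  qed
qed

lemma representing_from_atoms:
  fixes \<alpha> :: "'n::finite \<Rightarrow> real"
  assumes inj: "inj_on z {..<n}" and pos: "\<And>j. j < n \<Longrightarrow> \<rho> j > 0"
    and K: "\<And>j. j < n \<Longrightarrow> z j \<in> lines \<alpha>"
    and rep: "\<And>i j. i + j \<le> 2 * k \<Longrightarrow> \<beta> i j = (\<Sum>h<n. \<rho> h * (fst (z h) ^ i * snd (z h) ^ j))"
  shows "\<exists>\<mu>. representing_measure (lines \<alpha>) k \<beta> \<mu> \<and> atomic_measure n \<mu>"
proof -
  obtain \<mu> where \<mu>: "atomic_measure n \<mu>" "sets \<mu> = sets borel"
    "\<And>f :: real \<times> real \<Rightarrow> real. f \<in> borel_measurable borel \<Longrightarrow> integrable \<mu> f"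
    "\<And>f :: real \<times> real \<Rightarrow> real. f \<in> borel_measurable borel \<Longrightarrow>
      integral\<^sup>L \<mu> f = (\<Sum>j<n. \<rho> j * f (z j))"
    "\<And>A. A \<in> sets borel \<Longrightarrow> z ` {..<n} \<inter> A = {} \<Longrightarrow> emeasure \<mu> A = 0"
    using finite_atomic_measure[of z n \<rho>] inj pos by blast
  have cl: "closed (lines \<alpha>)" by (rule closed_lines)
  have meas: "(\<lambda>w. indicator (lines \<alpha>) w *\<^sub>R (case w of (x, y) \<Rightarrow> x ^ i * y ^ j))
      \<in> borel_measurable borel" for i j :: nat
  proof -
    have "(\<lambda>w :: real \<times> real. fst w ^ i * snd w ^ j) \<in> borel_measurable borel"
      by (intro borel_measurable_continuous_onI continuous_intros)
    thus ?thesis using cl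
      by (intro borel_measurable_scaleR borel_measurable_indicator) (auto simp: case_prod_beta)
  qed
  have "measure_support \<mu> \<subseteq> lines \<alpha>"
  proof
    fix w assume w: "w \<in> measure_support \<mu>"
    show "w \<in> lines \<alpha>"
    proof (rule ccontr)
      assume "w \<notin> lines \<alpha>"
      moreover have "open (- lines \<alpha>)" using cl by (simp add: open_Compl)
      ultimately have "emeasure \<mu> (- lines \<alpha>) > 0" using w by (auto simp: measure_support_def)
      moreover have "emeasure \<mu> (- lines \<alpha>) = 0"
        using K cl by (intro \<mu>(5)) auto
      ultimately show False by simp
    qed
  qed
  moreover have "set_integrable \<mu> (lines \<alpha>) (\<lambda>(x, y). x ^ i * y ^ j)" for i j
    unfolding set_integrable_def by (intro \<mu>(3) meas)
  moreover have "\<beta> i j = set_lebesgue_integral \<mu> (lines \<alpha>) (\<lambda>(x, y). x ^ i * y ^ j)"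
    if "i + j \<le> 2 * k" for i j
    unfolding set_lebesgue_integral_def \<mu>(4)[OF meas] rep[OF that]
    using K by (intro sum.cong) (auto simp: case_prod_beta)
  ultimately show ?thesis using \<mu>(1,2) by (auto simp: representing_measure_def)
qed

text \<open>The number of atoms is the rank of the form on \<open>mid_space\<close> because
  evaluations at the atoms are independent there. A line with \<open>k + 1\<close> nodes needs
  Lagrange polynomials of degree \<open>k\<close>, whose top coefficient the other lines must share
  while vanishing at their own nodes; \<open>one\<close> leaves those lines at most \<open>k\<close>
  nodes each, so there is room.\<close>

lemma atomic_representation:
  fixes \<alpha> :: "'n::finite \<Rightarrow> real"
  assumes dec: "line_moments k \<alpha> \<beta> m" and ham: "\<And>l. hamburger k (m l)" and inj: "inj \<alpha>"
    and one: "\<And>l l'. definite_on (m l) (polys (Suc k)) \<Longrightarrow> definite_on (m l') (polys (Suc k)) \<Longrightarrow> l = l'"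
  shows "\<exists>n \<mu> g. representing_measure (lines \<alpha>) k \<beta> \<mu> \<and> atomic_measure n \<mu> \<and>
    lform.frame m (mid_space k) n g"
proof -
  define Q where "Q l r z \<rho> \<longleftrightarrow> inj_on z {..<r} \<and> (\<forall>j<r. \<rho> j > 0) \<and>
    (\<forall>f\<in>polys (2 * k + 1). mom (m l) f = (\<Sum>j<r. \<rho> j * poly f (z j))) \<and>
    (r \<le> k \<or> r = Suc k \<and> definite_on (m l) (polys (Suc k)))"
    for l r and z \<rho> :: "nat \<Rightarrow> real"
  have "\<exists>r z \<rho>. Q l r z \<rho>" for l
    using truncated_hamburger[of "m l" k] ham[of l]
    unfolding Q_def hamburger_def definite_on_def by blast
  then obtain r z \<rho> where Q: "\<And>l. Q l (r l) (z l) (\<rho> l)" by metis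
  have zi: "\<And>l. inj_on (z l) {..<r l}" and pos: "\<And>l j. j < r l \<Longrightarrow> \<rho> l j > 0"
    and rep: "\<And>l f. f \<in> polys (2 * k + 1) \<Longrightarrow> mom (m l) f = (\<Sum>j<r l. \<rho> l j * poly f (z l j))"
    and r: "\<And>l. r l \<le> k \<or> r l = Suc k \<and> definite_on (m l) (polys (Suc k))"
    using Q unfolding Q_def by blast+
  define A where "A = (SIGMA l:UNIV. {..<r l})"
  define n where "n = card A"
  have finA: "finite A" by (simp add: A_def)
  obtain e where e: "bij_betw e {..<n} A"
    using ex_bij_betw_nat_finite[OF finA] by (auto simp: n_def atLeast0LessThan)
  define L where "L i = fst (e i)" for i
  define J where "J i = snd (e i)" for i
  have eA: "J i < r (L i)" if "i < n" for i
  proof -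
    have "e i \<in> A" using bij_betwE[OF e] that by blast
    thus ?thesis by (auto simp: A_def L_def J_def)
  qed
  have einj: "i = i'" if "i < n" "i' < n" "L i = L i'" "J i = J i'" for i i'
  proof -
    have "e i = e i'" using that by (simp add: L_def J_def prod_eq_iff)
    thus ?thesis using inj_onD[OF bij_betw_imp_inj_on[OF e]] that by blast
  qed
  define w where "w i = (z (L i) (J i), \<alpha> (L i))" for i
  define c where "c i = \<rho> (L i) (J i)" for i
  have sumA: "(\<Sum>i<n. F (L i) (J i)) = (\<Sum>l\<in>UNIV. \<Sum>j<r l. F l j)" for F :: "'n \<Rightarrow> nat \<Rightarrow> real"
  proof -
    have "(\<Sum>i<n. F (L i) (J i)) = (\<Sum>a\<in>A. F (fst a) (snd a))"
      unfolding L_def J_def using sum.reindex_bij_betw[OF e, of "\<lambda>a. F (fst a) (snd a)"] by simp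
    thus ?thesis unfolding A_def by (simp add: sum.Sigma case_prod_beta)
  qed
  have winj: "inj_on w {..<n}"
  proof (rule inj_onI)
    fix i i' assume i: "i \<in> {..<n}" "i' \<in> {..<n}" "w i = w i'"
    hence "L i = L i'" using inj by (auto simp: w_def dest: injD)
    moreover have "J i = J i'"
      using i eA[of i] eA[of i'] \<open>L i = L i'\<close> zi[of "L i"] by (auto simp: w_def dest: inj_onD)
    ultimately show "i = i'" using einj i by auto
  qed
  have cpos: "c i > 0" if "i < n" for i using pos eA that by (simp add: c_def)
  have "\<exists>\<mu>. representing_measure (lines \<alpha>) k \<beta> \<mu> \<and> atomic_measure n \<mu>"
  proof (rule representing_from_atoms[OF winj cpos])
    show "w i \<in> lines \<alpha>" if "i < n" for i by (simp add: w_def lines_def)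
    fix i j assume ij: "i + j \<le> 2 * k"
    have "\<beta> i j = (\<Sum>l\<in>UNIV. \<alpha> l ^ j * m l i)" using dec ij by (simp add: line_moments_def)
    also have "\<dots> = (\<Sum>l\<in>UNIV. \<Sum>h<r l. \<rho> l h * (z l h ^ i * \<alpha> l ^ j))"
    proof (rule sum.cong[OF refl])
      fix l
      have "m l i = (\<Sum>h<r l. \<rho> l h * z l h ^ i)"
        using rep[of "monom 1 i" l] ij by (simp add: poly_monom)
      thus "\<alpha> l ^ j * m l i = (\<Sum>h<r l. \<rho> l h * (z l h ^ i * \<alpha> l ^ j))"
        by (simp add: sum_distrib_left mult_ac)
    qed
    also have "\<dots> = (\<Sum>h<n. c h * (fst (w h) ^ i * snd (w h) ^ j))"
      unfolding c_def w_def fst_conv snd_conv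
      by (rule sumA[symmetric, of "\<lambda>l h. \<rho> l h * (z l h ^ i * \<alpha> l ^ j)"])
    finally show "\<beta> i j = (\<Sum>h<n. c h * (fst (w h) ^ i * snd (w h) ^ j))" .
  qed simp_all
  moreover have "\<exists>g. lform.frame m (mid_space k) n g"
  proof -
    define ev where "ev i f = poly (vec_nth f (L i)) (z (L i) (J i))" for i and f :: "real poly ^ 'n"
    have form: "lform m f g = (\<Sum>i<n. c i * (ev i f * ev i g))"
      if "f \<in> mid_space k" "g \<in> mid_space k" for f g
    proof -
      have "vec_nth f l * vec_nth g l \<in> polys (2 * k + 1)" for l
        using that mult_in_polys[of "vec_nth f l" "Suc k" "vec_nth g l" "Suc k"]
        by (auto simp: mid_space_def mult_2)
      hence "lform m f g = (\<Sum>l\<in>UNIV. \<Sum>j<r l. \<rho> l j * poly (vec_nth f l * vec_nth g l) (z l j))"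
        by (simp add: lform_def rep)
      thus ?thesis
        using sumA[of "\<lambda>l j. \<rho> l j * (poly (vec_nth f l) (z l j) * poly (vec_nth g l) (z l j))"]
        by (simp add: c_def ev_def)
    qed
    have "\<exists>f\<in>mid_space k. \<forall>i'<n. ev i' f = of_bool (i' = i)" if i: "i < n" for i
    proof -
      obtain b where b: "\<And>i' j'. i' < r (L i) \<Longrightarrow> j' < r (L i) \<Longrightarrow>
          poly (b j') (z (L i) i') = of_bool (i' = j')" "\<And>j. j < r (L i) \<Longrightarrow> b j \<in> polys (r (L i))"
        using lagrange_basis_exists[OF zi[of "L i"]] by blast
      define p where "p = b (J i)"
      define a where "a = coeff p k"
      have pr: "p \<in> polys (r (L i))" using b(2) eA[OF i] by (simp add: p_def)
      hence pk: "p \<in> polys (Suc k)"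
        using polys_mono[of "r (L i)" "Suc k"] r[of "L i"] by fastforce
      \<comment> \<open>Vanishes at all nodes of line \<open>l\<close>; the power of x lifts the
        degree to \<open>k\<close>, where the coefficient is \<open>a\<close>, if there are at most
        \<open>k\<close> nodes. Otherwise, for \<open>l\<close> other than \<open>L i\<close>, the
        number \<open>a\<close> is zero.\<close>
      define v where "v l = smult a (monom 1 (k - r l) * (\<Prod>j<r l. [:- z l j, 1:]))" for l
      define f where "f = (\<chi> l. if l = L i then p else v l)"
      have vl: "v l \<in> polys (Suc k) \<and> coeff (v l) k = a" if l: "l \<noteq> L i" for l
      proof (cases "a = 0")
        case True
        thus ?thesis by (simp add: v_def polys_def)
      next
        case False
        hence "r (L i) \<noteq> Suc k \<longrightarrow> False" using pr r[of "L i"] by (auto simp: a_def polys_def)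
        hence "definite_on (m (L i)) (polys (Suc k))" using r[of "L i"] by auto
        hence "r l \<le> k" using r[of l] one[of l "L i"] l by auto
        define q where "q = (\<Prod>j<r l. [:- z l j, 1:])"
        have "lead_coeff q = 1" unfolding q_def by (simp add: lead_coeff_prod)
        moreover have "degree q = r l" unfolding q_def by (subst degree_prod_eq_sum_degree) auto
        moreover have "q \<noteq> 0" unfolding q_def by simp
        ultimately have d: "degree (monom 1 (k - r l) * q) = k"
          using \<open>r l \<le> k\<close> by (auto simp: degree_mult_eq degree_monom_eq)
        have "lead_coeff (monom 1 (k - r l) * q) = 1"
          by (simp only: lead_coeff_mult lead_coeff_monom \<open>lead_coeff q = 1\<close> mult_1)
        hence "coeff (monom 1 (k - r l) * q) k = 1" by (simp only: d)
        thus ?thesis using d degree_smult_le[of a "monom 1 (k - r l) * q"]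
          by (auto simp: v_def q_def[symmetric] polys_Suc_iff)
      qed
      have "f \<in> mid_space k"
        using pk vl by (auto simp: mid_space_def f_def a_def)
      moreover have "ev i' f = of_bool (i' = i)" if i': "i' < n" for i'
      proof (cases "L i' = L i")
        case True
        hence "ev i' f = of_bool (J i' = J i)"
          using b(1)[of "J i'" "J i"] eA[OF i] eA[OF i'] by (simp add: ev_def f_def p_def)
        thus ?thesis using einj[OF i' i True] by auto
      next
        case False
        hence "ev i' f = 0" using eA[OF i'] by (auto simp: ev_def f_def v_def poly_prod)
        thus ?thesis using False by auto
      qed
      ultimately show ?thesis by blast
    qed
    then obtain h where h: "\<And>i. i < n \<Longrightarrow> h i \<in> mid_space k"
      "\<And>i i'. i < n \<Longrightarrow> i' < n \<Longrightarrow> ev i' (h i) = of_bool (i' = i)" by metis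
    define g where "g i = (1 / sqrt (c i)) *\<^sub>R h i" for i
    have gm: "g i \<in> mid_space k" if "i < n" for i
      using h(1)[OF that] by (auto simp: g_def intro: subspace_scale)
    have lin: "linear (ev i)" for i
      by (rule linearI) (auto simp: ev_def)
    have eg: "ev i' (g i) = of_bool (i' = i) / sqrt (c i)" if "i < n" "i' < n" for i i'
      using h(2)[OF that] by (simp add: g_def linear_cmul[OF lin])
    have fg: "lform m f (g i) = sqrt (c i) * ev i f" if f: "f \<in> mid_space k" and i: "i < n" for f i
    proof -
      have "lform m f (g i) = (\<Sum>i'<n. if i' = i then sqrt (c i) * ev i f else 0)"
        unfolding form[OF f gm[OF i]]
        using cpos[OF i] by (intro sum.cong) (auto simp: eg[OF i] real_div_sqrt field_simps)
      thus ?thesis using i by simp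
    qed
    have "lform.frame m (mid_space k) n g"
      unfolding lform.frame_def
    proof (intro conjI ballI allI impI)
      show "lform m (g i) (g j) = of_bool (i = j)" if "i < n" "j < n" for i j
        using fg[OF gm[OF that(1)] that(2)] eg[OF that] cpos[OF that(2)] by auto
      fix f :: "real poly ^ 'n" assume f: "f \<in> mid_space k"
      define f' where "f' = lform.residual m n g f"
      have "f' \<in> mid_space k" unfolding f'_def using gm f by (intro lform.residual_mem) auto
      moreover have "ev i f' = 0" if i: "i < n" for i
      proof -
        have "ev i f' = ev i f - (\<Sum>j<n. lform m f (g j) * ev i (g j))"
          by (simp add: f'_def lform.residual_def linear_diff[OF lin] linear_sum[OF lin] linear_cmul[OF lin])
        also have "(\<Sum>j<n. lform m f (g j) * ev i (g j)) = (\<Sum>j<n. if j = i then ev i f else 0)"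
        proof (rule sum.cong[OF refl])
          fix j assume "j \<in> {..<n}"
          thus "lform m f (g j) * ev i (g j) = (if j = i then ev i f else 0)"
            using fg[OF f, of j] eg[of j i] i cpos[OF i] by auto
        qed
        finally show ?thesis using i by simp
      qed
      ultimately show "lform m (lform.residual m n g f) (lform.residual m n g f) = 0"
        unfolding f'_def[symmetric] by (simp add: form)
    qed (use gm in auto)
    thus ?thesis by blast
  qed
  ultimately show ?thesis by blast
qed

lemma line_moments_of_measure:
  fixes \<alpha> :: "'n::finite \<Rightarrow> real"
  assumes rep: "representing_measure (lines \<alpha>) k \<beta> \<mu>" and inj: "inj \<alpha>"
  obtains m where "line_moments k \<alpha> \<beta> m" "\<And>l. hamburger k (m l)"
proof -
  have sets: "sets \<mu> = sets borel" using rep by (simp add: representing_measure_def)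
  define I where "I l = (indicator {w :: real \<times> real. snd w = \<alpha> l} :: _ \<Rightarrow> real)" for l
  define m where "m l i = integral\<^sup>L \<mu> (\<lambda>w. I l w * fst w ^ i)" for l i
  have clI: "closed {w :: real \<times> real. snd w = \<alpha> l}" for l
    by (intro closed_Collect_eq continuous_intros)
  have Im: "I l \<in> borel_measurable \<mu>" for l
    unfolding I_def using clI[of l] by (intro borel_measurable_indicator) (simp add: sets)
  have I_lines: "(\<Sum>l\<in>UNIV. I l w * (fst w ^ i * \<alpha> l ^ j)) =
      indicator (lines \<alpha>) w *\<^sub>R (case w of (x, y) \<Rightarrow> x ^ i * y ^ j)" for w and i j :: nat
  proof (cases "w \<in> lines \<alpha>")
    case True
    then obtain l where l: "snd w = \<alpha> l" by (auto simp: lines_def)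
    hence "I l' w = of_bool (l' = l)" for l' using inj by (auto simp: I_def indicator_def dest: injD)
    hence "(\<Sum>l'\<in>UNIV. I l' w * (fst w ^ i * \<alpha> l' ^ j)) =
      (\<Sum>l'\<in>UNIV. if l' = l then fst w ^ i * \<alpha> l ^ j else 0)" by (intro sum.cong) auto
    thus ?thesis using True l by (simp add: case_prod_beta)
  next
    case False
    hence "I l w = 0" for l by (auto simp: I_def lines_def case_prod_beta indicator_def)
    thus ?thesis using False by simp
  qed
  have int: "integrable \<mu> (\<lambda>w. I l w * fst w ^ i)" if i: "i \<le> 2 * k" for l i
  proof -
    have "set_integrable \<mu> (lines \<alpha>) (\<lambda>(x, y). x ^ i * y ^ 0)"
      using rep i unfolding representing_measure_def by (metis add_0_right)
    hence 1: "integrable \<mu> (\<lambda>w. indicator (lines \<alpha>) w *\<^sub>R (case w of (x, y) \<Rightarrow> x ^ i * y ^ 0))"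
      by (simp add: set_integrable_def)
    have "(\<lambda>w :: real \<times> real. fst w ^ i) \<in> borel_measurable \<mu>"
      unfolding measurable_cong_sets[OF sets refl]
      by (intro borel_measurable_continuous_onI continuous_intros)
    hence "(\<lambda>w. I l w * fst w ^ i) \<in> borel_measurable \<mu>" by (intro borel_measurable_times Im)
    thus ?thesis
      by (intro Bochner_Integration.integrable_bound[OF 1])
         (auto simp: I_def lines_def indicator_def intro!: AE_I2)
  qed
  have intp: "integrable \<mu> (\<lambda>w. I l w * poly p (fst w))"
    and momp: "mom (m l) p = integral\<^sup>L \<mu> (\<lambda>w. I l w * poly p (fst w))"
    if p: "p \<in> polys (2 * k + 1)" for l p
  proof -
    have d: "degree p \<le> 2 * k" using p by (simp add: polys_Suc_iff)
    have eq: "(\<lambda>w. I l w * poly p (fst w)) = (\<lambda>w. \<Sum>i\<le>degree p. coeff p i * (I l w * fst w ^ i))"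
      by (simp add: poly_altdef sum_distrib_left mult_ac)
    show "integrable \<mu> (\<lambda>w. I l w * poly p (fst w))"
      unfolding eq using d by (intro Bochner_Integration.integrable_sum integrable_mult_right int) auto
    have "integral\<^sup>L \<mu> (\<lambda>w. I l w * poly p (fst w)) = (\<Sum>i\<le>degree p. coeff p i * m l i)"
      unfolding eq m_def using d by (subst Bochner_Integration.integral_sum) (auto intro!: int)
    thus "mom (m l) p = integral\<^sup>L \<mu> (\<lambda>w. I l w * poly p (fst w))" by (simp add: mom_def)
  qed
  have "line_moments k \<alpha> \<beta> m"
    unfolding line_moments_def
  proof (intro allI impI)
    fix i j assume ij: "i + j \<le> 2 * k"
    have "\<beta> i j = integral\<^sup>L \<mu> (\<lambda>w. \<Sum>l\<in>UNIV. I l w * (fst w ^ i * \<alpha> l ^ j))"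
      using rep ij unfolding I_lines by (simp add: representing_measure_def set_lebesgue_integral_def)
    also have "\<dots> = integral\<^sup>L \<mu> (\<lambda>w. \<Sum>l\<in>UNIV. \<alpha> l ^ j * (I l w * fst w ^ i))"
      by (simp add: mult_ac)
    also have "\<dots> = (\<Sum>l\<in>UNIV. \<alpha> l ^ j * m l i)"
      unfolding m_def using ij by (subst Bochner_Integration.integral_sum) (auto intro!: int)
    finally show "\<beta> i j = (\<Sum>l\<in>UNIV. \<alpha> l ^ j * m l i)" .
  qed
  moreover have "hamburger k (m l)" for l
    unfolding hamburger_def
  proof (intro conjI ballI impI)
    have sq: "p * p \<in> polys (2 * k + 1)" if "p \<in> polys (Suc k)" for p
      using mult_in_polys[OF that that] by (simp add: mult_2)
    show "mom.psd_on (m l) (polys (Suc k))"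
      unfolding mom.psd_on_def
      by (auto simp: momp[OF sq] I_def intro!: Bochner_Integration.integral_nonneg)
    fix p assume p: "p \<in> polys k" "mom (m l) (p * p) = 0"
    have pk: "p \<in> polys (Suc k)" "pCons 0 p \<in> polys (Suc k)"
      using p by (auto simp: polys_iff)
    have "AE w in \<mu>. I l w * poly (p * p) (fst w) = 0"
      using p(2) integral_nonneg_eq_0_iff_AE[OF intp[OF sq[OF pk(1)], of l]]
      by (simp add: momp[OF sq[OF pk(1)]] I_def)
    hence "AE w in \<mu>. I l w * poly (pCons 0 p * pCons 0 p) (fst w) = 0"
      by eventually_elim auto
    hence "integral\<^sup>L \<mu> (\<lambda>w. I l w * poly (pCons 0 p * pCons 0 p) (fst w)) = 0"
      by (rule integral_eq_zero_AE)
    thus "mom (m l) (pCons 0 p * pCons 0 p) = 0" by (simp only: momp[OF sq[OF pk(2)]])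
  qed
  ultimately show thesis by (rule that)
qed


section \<open>Extending the moments on the lines\<close>

lemma frame_cong:
  assumes B: "symmetric_form B" "symmetric_form B'" and eq: "\<And>x y. x \<in> S \<Longrightarrow> y \<in> S \<Longrightarrow> B x y = B' x y"
    and S: "subspace S" and fr: "symmetric_form.frame B S r g"
  shows "symmetric_form.frame B' S r g"
proof -
  interpret B: symmetric_form B by fact
  interpret B': symmetric_form B' by fact
  have g: "g j \<in> S" if "j < r" for j using fr that by (simp add: B.frame_def)
  have res: "B'.residual r g x = B.residual r g x" if "x \<in> S" for x
    using that g by (simp add: B.residual_def B'.residual_def eq)
  have "B.residual r g x \<in> S" if "x \<in> S" for x
    using S that g by (rule B.residual_mem)
  thus ?thesis
    using fr g by (simp add: B.frame_def B'.frame_def res eq[symmetric])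
qed

lemma psd_on_cong:
  assumes B: "symmetric_form B" "symmetric_form B'" and eq: "\<And>x. x \<in> S \<Longrightarrow> B x x = B' x x"
  shows "symmetric_form.psd_on B S \<longleftrightarrow> symmetric_form.psd_on B' S"
  using B eq by (simp add: symmetric_form.psd_on_def)

lemma (in symmetric_form) frame_exists_subspace:
  assumes S: "subspace S" "S \<subseteq> span F" "finite F" and psd: "psd_on S"
  shows "\<exists>r g. frame S r g"
proof -
  obtain A where A: "A \<subseteq> S" "independent A" "S \<subseteq> span A"
    using maximal_independent_subset by blast
  have "finite A" using independent_span_bound[OF S(3) A(2)] A(1) S(2) by blast
  then obtain n f where f: "A = f ` {..<n::nat}"
    using finite_imp_nat_seg_image_inj_on by (metis lessThan_def)
  have "span A = S" using A S(1) by (metis span_minimal subset_antisym)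
  thus ?thesis using frame_exists[of f n] psd by (simp add: f)
qed

section \<open>Dependence of the form on the moments of degree 2k - 1 and 2k\<close>

lemma polys_diff_reduce:
  assumes "p \<in> polys (Suc k)" "r \<in> polys (Suc k)" "coeff p k = coeff r k"
  shows "p - r \<in> polys k"
  unfolding polys_def
proof clarify
  fix i assume "k \<le> i"
  thus "coeff (p - r) i = 0" using assms by (cases "i = k") (auto simp: polys_def)
qed

lemma mom_change:
  assumes p: "p \<in> polys (2 * k + 1)" and k: "k \<ge> 1" and eq: "\<And>i. i < 2 * k - 1 \<Longrightarrow> s i = s' i"
  shows "mom s p = mom s' p + coeff p (2 * k - 1) * (s (2 * k - 1) - s' (2 * k - 1))
    + coeff p (2 * k) * (s (2 * k) - s' (2 * k))"
proof -
  obtain k' where k': "k = Suc k'" using k by (cases k) auto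
  have d: "degree p \<le> Suc (Suc (2 * k'))" using p by (simp add: polys_Suc_iff k')
  have "(\<Sum>i\<le>2 * k'. coeff p i * s i) = (\<Sum>i\<le>2 * k'. coeff p i * s' i)"
    using eq by (intro sum.cong) (auto simp: k')
  thus ?thesis by (simp add: mom_eq[OF d] k' algebra_simps)
qed

lemma coeff_mult_top:
  assumes "f \<in> polys (Suc k)" "g \<in> polys (Suc k)"
  shows "coeff (f * g) (2 * k) = coeff f k * coeff g k"
proof -
  have "coeff f i * coeff g (2 * k - i) = 0" if "i \<noteq> k" for i
    using assms that by (cases "i < k") (auto simp: polys_def)
  hence "coeff (f * g) (2 * k) = (\<Sum>i\<in>{k}. coeff f i * coeff g (2 * k - i))"
    unfolding coeff_mult by (intro sum.mono_neutral_right) auto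
  thus ?thesis by simp
qed

lemma coeff_mult_top':
  assumes "f \<in> polys (Suc k)" "g \<in> polys (Suc k)" "k \<ge> 1"
  shows "coeff (f * g) (2 * k - 1) = coeff f k * coeff g (k - 1) + coeff f (k - 1) * coeff g k"
proof -
  have "coeff f i * coeff g (2 * k - 1 - i) = 0" if "i \<le> 2 * k - 1" "i \<notin> {k - 1, k}" for i
  proof (cases "i < k - 1")
    case True
    hence "2 * k - 1 - i \<ge> Suc k" using that by auto
    thus ?thesis using assms by (simp add: polys_def)
  next
    case False
    hence "i \<ge> Suc k" using that by auto
    thus ?thesis using assms by (simp add: polys_def)
  qed
  hence "coeff (f * g) (2 * k - 1) = (\<Sum>i\<in>{k - 1, k}. coeff f i * coeff g (2 * k - 1 - i))"
    unfolding coeff_mult using assms by (intro sum.mono_neutral_right) auto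
  moreover have "2 * k - 1 - (k - 1) = k" "2 * k - 1 - k = k - 1" "k - 1 \<noteq> k" using assms by auto
  ultimately show ?thesis by simp
qed

text \<open>The origin of the perturbation treated in \<open>psd_completion\<close>: in a product of
  two elements of \<open>mid_space\<close> the moment of degree \<open>2 * k - 1\<close> is weighted
  by the top coefficient of one factor times the next coefficient of the other. Any line may serve
  as \<open>l0\<close>, the top coefficient being common.\<close>

lemma lform_change:
  fixes m m' :: "'n::finite \<Rightarrow> nat \<Rightarrow> real"
  assumes f: "f \<in> mid_space k" "g \<in> mid_space k" and k: "k \<ge> 1"
    and eq: "\<And>l i. i < 2 * k - 1 \<Longrightarrow> m l i = m' l i"
    and top: "(\<Sum>l\<in>UNIV. m l (2 * k)) = (\<Sum>l\<in>UNIV. m' l (2 * k))"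
  shows "lform m f g = lform m' f g +
    coeff (vec_nth f l0) k * (\<Sum>l\<in>UNIV. (m l (2 * k - 1) - m' l (2 * k - 1)) * coeff (vec_nth g l) (k - 1)) +
    (\<Sum>l\<in>UNIV. (m l (2 * k - 1) - m' l (2 * k - 1)) * coeff (vec_nth f l) (k - 1)) * coeff (vec_nth g l0) k"
proof -
  define d where "d l = m l (2 * k - 1) - m' l (2 * k - 1)" for l
  define e where "e l = m l (2 * k) - m' l (2 * k)" for l
  have fl: "vec_nth f l \<in> polys (Suc k)" "vec_nth g l \<in> polys (Suc k)"
      "coeff (vec_nth f l) k = coeff (vec_nth f l0) k" "coeff (vec_nth g l) k = coeff (vec_nth g l0) k" for l
    using f by (auto simp: mid_space_def)
  have "mom (m l) (vec_nth f l * vec_nth g l) = mom (m' l) (vec_nth f l * vec_nth g l) +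
      (coeff (vec_nth f l0) k * (d l * coeff (vec_nth g l) (k - 1)) +
       d l * coeff (vec_nth f l) (k - 1) * coeff (vec_nth g l0) k +
       coeff (vec_nth f l0) k * coeff (vec_nth g l0) k * e l)" for l
  proof -
    have "vec_nth f l * vec_nth g l \<in> polys (2 * k + 1)"
      using mult_in_polys[OF fl(1,2), of l l] by (simp add: mult_2)
    from mom_change[OF this k, of "m l" "m' l", OF eq, folded d_def e_def] show ?thesis
      unfolding coeff_mult_top[OF fl(1,2)] coeff_mult_top'[OF fl(1,2) k] fl(3)[of l] fl(4)[of l]
      by (simp add: algebra_simps)
  qed
  moreover have "(\<Sum>l\<in>UNIV. e l) = 0" using top by (simp add: e_def sum_subtractf)
  ultimately show ?thesis
    by (simp add: lform_def sum.distrib sum_distrib_left[symmetric] sum_distrib_right[symmetric] d_def)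
qed

lemma lform_axis: "lform m (axis l p) f = mom (m l) (p * vec_nth f l)"
proof -
  have "lform m (axis l p) f = (\<Sum>l'\<in>UNIV. if l' = l then mom (m l) (p * vec_nth f l) else 0)"
    unfolding lform_def by (intro sum.cong) (auto simp: axis_def)
  thus ?thesis by simp
qed

lemma axis_low [simp]: "p \<in> polys k \<Longrightarrow> axis l p \<in> low_space k"
  by (auto simp: low_space_def axis_def polys_def)

lemma low_in_mid [simp]: "f \<in> low_space k \<Longrightarrow> f \<in> mid_space k"
  using low_subset_mid by blast

definition top_power :: "nat \<Rightarrow> real poly ^ 'n::finite" where
  "top_power k = (\<chi> l. monom 1 k)"

lemma top_power_nth [simp]: "vec_nth (top_power k) l = monom 1 k"
  by (simp add: top_power_def)

lemma top_power_mid [simp]: "top_power k \<in> mid_space k"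
  by (simp add: mid_space_def)

lemma mid_decompose:
  assumes "f \<in> mid_space k"
  obtains h where "h \<in> low_space k" "f = coeff (vec_nth f l0) k *\<^sub>R top_power k + h"
proof
  let ?h = "f - coeff (vec_nth f l0) k *\<^sub>R top_power k"
  show "?h \<in> low_space k"
    unfolding low_space_def mem_Collect_eq
  proof
    fix l
    have "vec_nth f l \<in> polys (Suc k)" "coeff (vec_nth f l) k = coeff (vec_nth f l0) k"
      using assms by (auto simp: mid_space_def)
    hence "vec_nth f l - monom (coeff (vec_nth f l0) k) k \<in> polys k"
      by (intro polys_diff_reduce) auto
    thus "vec_nth ?h l \<in> polys k" by (simp add: smult_monom)
  qed
qed simp

lemma psd_line:
  assumes "lform.psd_on m (low_space k)"
  shows "mom.psd_on (m l) (polys k)"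
  unfolding mom.psd_on_def
proof
  fix p assume "p \<in> polys k"
  hence "0 \<le> lform m (axis l p) (axis l p)" using assms by (auto simp: lform.psd_on_def)
  thus "0 \<le> mom (m l) (p * p)" by (simp add: lform_axis axis_nth)
qed

lemma hamburger_imp_psd_mid:
  assumes "\<And>l. hamburger k (m l)"
  shows "lform.psd_on m (mid_space k)"
  using assms by (auto simp: lform.psd_on_def hamburger_def mom.psd_on_def lform_def mid_space_def
      intro!: sum_nonneg)

text \<open>\<open>axis l p\<close> is null in \<open>mid_space\<close>, hence orthogonal to
  \<open>top_power k\<close>. For \<open>p\<close> of degree \<open>k - 1\<close> this is a linear
  equation that determines the moment of degree \<open>2 * k - 1\<close> of the line.\<close>

lemma null_line_top:
  assumes psd: "lform.psd_on m (mid_space k)" and p: "p \<in> polys k" "mom (m l) (p * p) = 0"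
  shows "mom (m l) (p * monom 1 k) = 0"
proof -
  have "lform m (axis l p) (axis l p) = 0" using p by (simp add: lform_axis axis_nth)
  from lform.psd_null[OF subspace_mid psd low_in_mid[OF axis_low[OF p(1)]] this top_power_mid]
  have "lform m (axis l p) (top_power k) = 0" .
  thus ?thesis by (simp add: lform_axis)
qed

text \<open>A null polynomial p of greatest degree has degree \<open>k - 1\<close>: it is orthogonal
  to all polynomials of degree up to \<open>k\<close>, so if x^2 p still has degree at most
  \<open>k\<close>, then x p is null as well and has larger degree.\<close>

lemma monic_null_exists:
  assumes psd: "mom.psd_on s (polys k)"
    and top: "\<And>p. p \<in> polys k \<Longrightarrow> mom s (p * p) = 0 \<Longrightarrow> mom s (p * monom 1 k) = 0"
    and nd: "\<not> definite_on s (polys k)"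
  obtains q where "q \<in> polys k" "coeff q (k - 1) = 1" "mom s (q * q) = 0"
proof -
  define P where "P d \<longleftrightarrow> (\<exists>p\<in>polys k. p \<noteq> 0 \<and> mom s (p * p) = 0 \<and> degree p = d)" for d
  have "\<exists>d. P d" using nd by (auto simp: P_def definite_on_def)
  moreover have bound: "d < k" if "P d" for d using that by (auto simp: P_def polys_iff)
  ultimately obtain d where d: "P d" "\<And>d'. P d' \<Longrightarrow> d' \<le> d"
    using ex_has_greatest_nat[of P _ id k] by (metis id_apply less_imp_le)
  then obtain p where p: "p \<in> polys k" "p \<noteq> 0" "mom s (p * p) = 0" "degree p = d"
    by (auto simp: P_def)
  have null: "mom s (p * f) = 0" if f: "f \<in> polys (Suc k)" for f
  proof -
    have e: "f = (f - monom (coeff f k) k) + smult (coeff f k) (monom 1 k)" by (simp add: smult_monom)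
    have "f - monom (coeff f k) k \<in> polys k"
      using f by (intro polys_diff_reduce) auto
    hence "mom s (p * (f - monom (coeff f k) k)) = 0"
      using mom.psd_null[OF subspace_polys psd p(1,3)] by simp
    moreover have "mom s (p * monom 1 k) = 0" using top p by blast
    ultimately show ?thesis by (subst e) (simp only: mom_add mom_smult distrib_left mult_smult_right)
  qed
  have "d = k - 1"
  proof (rule ccontr)
    assume "d \<noteq> k - 1"
    hence dk: "Suc d < k" using bound[OF d(1)] by auto
    have "mom s (pCons 0 p * pCons 0 p) = mom s (p * pCons 0 (pCons 0 p))" by simp
    also have "\<dots> = 0" using p dk by (intro null) (auto simp: polys_iff)
    finally have "P (Suc d)"
      using p dk unfolding P_def by (intro bexI[of _ "pCons 0 p"]) (auto simp: polys_iff)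
    thus False using d(2) by fastforce
  qed
  define q where "q = smult (1 / lead_coeff p) p"
  show thesis
  proof (rule that[of q])
    show "q \<in> polys k" using p by (auto simp: q_def polys_iff)
    show "coeff q (k - 1) = 1" using p(2) p(4)[unfolded \<open>d = k - 1\<close>, symmetric] by (simp add: q_def)
    show "mom s (q * q) = 0" using p by (simp add: q_def mom_smult)
  qed
qed

text \<open>The top moment of \<open>s'\<close> is chosen so that \<open>monom 1 k - w\<close> gets squared norm \<open>\<epsilon>\<close>.\<close>

lemma hamburger_top_change:
  assumes psd: "mom.psd_on s (polys k)" and k: "k \<ge> 1"
    and w: "w \<in> polys k" "\<And>p. p \<in> polys k \<Longrightarrow> mom s ((monom 1 k - w) * p) = 0"
    and \<epsilon>: "\<epsilon> \<ge> 0"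
    and s': "s' = s(2 * k := mom s (monom 1 k * w) + \<epsilon>)"
  shows "mom.psd_on s' (polys (Suc k))"
    and "p \<in> polys k \<Longrightarrow> mom s' ((monom 1 k - w) * p) = 0"
    and "mom s' ((monom 1 k - w) * (monom 1 k - w)) = \<epsilon>"
    and "\<epsilon> = 0 \<or> definite_on s (polys k) \<Longrightarrow> hamburger k s'"
    and "\<epsilon> = 0 \<Longrightarrow> \<not> definite_on s' (polys (Suc k))"
proof -
  define q where "q = monom 1 k - w"
  have qk: "q \<in> polys (Suc k)" and q1: "coeff q k = 1"
    using w(1) by (auto simp: q_def polys_def)
  have low: "mom s' (f * p) = mom s (f * p)" if "f \<in> polys (Suc k)" "p \<in> polys k" for f p
    using mult_in_polys[OF that] by (intro mom_cong[of _ "2 * k"]) (auto simp: s' mult_2)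
  have qp: "mom s' (q * p) = 0" if "p \<in> polys k" for p
    using low[OF qk that] w(2)[OF that] by (simp add: q_def)
  have "mom s' (q * q) = mom s' (q * monom 1 k)"
    using qp[OF w(1)] by (simp add: q_def mom_diff right_diff_distrib)
  also have "\<dots> = mom s' (monom 1 (2 * k)) - mom s' (monom 1 k * w)"
    by (simp add: q_def left_diff_distrib mom_diff mult_monom mult_2 mult.commute[of w])
  also have "\<dots> = \<epsilon>" using low[of "monom 1 k" w] w(1) by (simp add: s')
  finally have qq: "mom s' (q * q) = \<epsilon>" .
  have dec: "\<exists>p\<in>polys k. f = smult (coeff f k) q + p" if "f \<in> polys (Suc k)" for f
  proof
    show "f - smult (coeff f k) q \<in> polys k"
      using that qk q1 subspace_scale[OF subspace_polys qk, of "coeff f k"]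
      by (intro polys_diff_reduce) auto
  qed simp
  have form: "mom s' (f * f) = coeff f k * coeff f k * \<epsilon> + mom s (p * p)"
    and form': "mom s' (f * p) = mom s (p * p)"
    if p: "p \<in> polys k" and f: "f = smult (coeff f k) q + p" for f p
  proof -
    define c where "c = coeff f k"
    have fc: "f = smult c q + p" using f by (simp add: c_def)
    have pS: "p \<in> polys (Suc k)" using p polys_mono[of k "Suc k"] by auto
    have "mom s' (f * f) = c * c * \<epsilon> + mom s (p * p)"
      using mom.form_quadratic[of s' 0 c q 1 p] by (simp add: fc qq qp[OF p] low[OF pS p])
    thus "mom s' (f * f) = coeff f k * coeff f k * \<epsilon> + mom s (p * p)" by (simp add: c_def)
    have "f * p = smult c (q * p) + p * p" unfolding fc by (simp add: algebra_simps)
    thus "mom s' (f * p) = mom s (p * p)"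
      using qp[OF p] low[OF pS p] by (simp add: mom_add mom_smult)
  qed
  show psd': "mom.psd_on s' (polys (Suc k))"
    unfolding mom.psd_on_def
  proof
    fix f assume "f \<in> polys (Suc k)"
    then obtain p where p: "p \<in> polys k" "f = smult (coeff f k) q + p" using dec by blast
    show "0 \<le> mom s' (f * f)"
      unfolding form[OF p] using psd p \<epsilon> by (auto simp: mom.psd_on_def)
  qed
  show "mom s' ((monom 1 k - w) * p) = 0" if "p \<in> polys k" for p using qp[OF that] by (simp add: q_def)
  show "mom s' ((monom 1 k - w) * (monom 1 k - w)) = \<epsilon>" using qq by (simp add: q_def)
  have "mom s' (pCons 0 p * pCons 0 p) = 0"
    if p: "p \<in> polys k" "mom s' (p * p) = 0" and d: "\<epsilon> = 0 \<or> definite_on s (polys k)" for p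
  proof -
    have pS: "p \<in> polys (Suc k)" using p polys_mono[of k "Suc k"] by auto
    have gS: "pCons 0 p \<in> polys (Suc k)" using p by (auto simp: polys_iff)
    show ?thesis
    proof (cases "\<epsilon> = 0")
      case False
      hence "p = 0" using d p low[OF pS p(1)] by (auto simp: definite_on_def)
      thus ?thesis by simp
    next
      case True
      obtain p' where p': "p' \<in> polys k" "pCons 0 p = smult (coeff (pCons 0 p) k) q + p'"
        using dec[OF gS] by blast
      \<comment> \<open>With \<open>\<epsilon> = 0\<close> the monic \<open>q\<close> is null, so in
        one factor x p may be replaced by its part \<open>p'\<close> below degree \<open>k\<close>;
        moving x to that factor leaves a product with the null \<open>p\<close>.\<close>
      have "mom s' (pCons 0 p * pCons 0 p) = mom s' (pCons 0 p * p')"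
        using form[OF p'] form'[OF p'] True by simp
      also have "pCons 0 p * p' = p * pCons 0 p'" by simp
      also have "mom s' (p * pCons 0 p') = 0"
        by (rule mom.psd_null[OF subspace_polys psd' pS p(2)]) (use p'(1) in \<open>auto simp: polys_iff\<close>)
      finally show ?thesis .
    qed
  qed
  thus "hamburger k s'" if "\<epsilon> = 0 \<or> definite_on s (polys k)"
    using psd' that by (auto simp: hamburger_def)
  show "\<not> definite_on s' (polys (Suc k))" if "\<epsilon> = 0"
    using qq qk q1 that by (auto simp: definite_on_def intro!: bexI[of _ q])
qed

section \<open>The excess in the moments of degree 2k\<close>

lemma orthogonal_top_exists:
  assumes psd: "lform.psd_on m (mid_space k)" and fr: "lform.frame m (low_space k) r g"
  obtains w where "w \<in> low_space k" "\<And>f. f \<in> low_space k \<Longrightarrow> lform m (top_power k - w) f = 0"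
  using lform.projection_exists[OF fr subspace_low low_subset_mid subspace_mid psd top_power_mid] by blast

lemma orthogonal_top_line:
  assumes "\<And>f. f \<in> low_space k \<Longrightarrow> lform m (top_power k - w) f = 0" "p \<in> polys k"
  shows "mom (m l) ((monom 1 k - vec_nth w l) * p) = 0"
  using assms(1)[OF axis_low[OF assms(2), of l]] lform.commute[of m "top_power k - w"]
  by (simp add: lform_axis mult.commute)

text \<open>For a semidefinite form the summand of line \<open>l\<close> on the right is the least
  moment of degree \<open>2 * k\<close> that this line admits, so the squared distance is the amount
  left to distribute over the lines.\<close>

lemma excess_eq:
  assumes w: "w \<in> low_space k" "\<And>f. f \<in> low_space k \<Longrightarrow> lform m (top_power k - w) f = 0"
  shows "(\<Sum>l\<in>UNIV. m l (2 * k)) =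
    (\<Sum>l\<in>UNIV. mom (m l) (monom 1 k * vec_nth w l)) + lform m (top_power k - w) (top_power k - w)"
proof -
  have "lform m (top_power k - w) (top_power k - w) = lform m (top_power k - w) (top_power k)"
    using w by (simp add: lform.diff_right)
  also have "\<dots> = lform m (top_power k) (top_power k) - lform m (top_power k) w"
    using lform.commute[of m w] by (simp add: lform.diff_left)
  finally have "lform m (top_power k - w) (top_power k - w) =
    lform m (top_power k) (top_power k) - lform m (top_power k) w" .
  moreover have "lform m (top_power k) (top_power k) = (\<Sum>l\<in>UNIV. m l (2 * k))"
    by (simp add: lform_def mult_monom mult_2)
  moreover have "lform m (top_power k) w = (\<Sum>l\<in>UNIV. mom (m l) (monom 1 k * vec_nth w l))"
    by (simp add: lform_def)
  ultimately show ?thesis by linarith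
qed

text \<open>Every line gets its least top moment, except that a definite line \<open>l0\<close>
  takes the whole excess. The other lines are then singular in degree \<open>k\<close>, as
  \<open>atomic_representation\<close> demands, and the form on \<open>mid_space\<close> is
  unchanged because it depends only on the sum.\<close>

lemma representation_from_psd:
  fixes \<alpha> :: "'n::finite \<Rightarrow> real"
  assumes dec: "line_moments k \<alpha> \<beta> m" and psd: "lform.psd_on m (mid_space k)" and k: "k \<ge> 1"
    and inj: "inj \<alpha>"
    and w: "w \<in> low_space k" "\<And>f. f \<in> low_space k \<Longrightarrow> lform m (top_power k - w) f = 0"
    and ex: "lform m (top_power k - w) (top_power k - w) = 0 \<or> (\<exists>l. definite_on (m l) (polys k))"
  shows "\<exists>n \<mu> g. representing_measure (lines \<alpha>) k \<beta> \<mu> \<and> atomic_measure n \<mu> \<and>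
    lform.frame m (mid_space k) n g"
proof -
  define s where "s = lform m (top_power k - w) (top_power k - w)"
  obtain l0 where l0: "s = 0 \<or> definite_on (m l0) (polys k)" using ex by (auto simp: s_def)
  define \<epsilon> where "\<epsilon> l = (if l = l0 then s else 0)" for l
  define m' where "m' l = (m l)(2 * k := mom (m l) (monom 1 k * vec_nth w l) + \<epsilon> l)" for l
  have "top_power k - w \<in> mid_space k" using w by (intro subspace_diff) auto
  hence s0: "s \<ge> 0" using psd by (auto simp: s_def lform.psd_on_def)
  have pl: "mom.psd_on (m l) (polys k)" for l
    by (intro psd_line lform.psd_on_mono[OF psd low_subset_mid])
  have wl: "vec_nth w l \<in> polys k" for l using w by (simp add: low_space_def)
  have \<epsilon>: "\<epsilon> l \<ge> 0" "\<epsilon> l = 0 \<or> definite_on (m l) (polys k)" for l using s0 l0 by (auto simp: \<epsilon>_def)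
  have wo: "mom (m l) ((monom 1 k - vec_nth w l) * p) = 0" if "p \<in> polys k" for l p
    using w(2) that by (rule orthogonal_top_line)
  have ham: "hamburger k (m' l)" "\<epsilon> l = 0 \<Longrightarrow> \<not> definite_on (m' l) (polys (Suc k))" for l
    using hamburger_top_change(4,5)[OF pl k wl _ \<epsilon>(1) m'_def] wo \<epsilon>(2) by blast+
  have top: "(\<Sum>l\<in>UNIV. m' l (2 * k)) = (\<Sum>l\<in>UNIV. m l (2 * k))"
    using excess_eq[OF w] by (simp add: m'_def sum.distrib \<epsilon>_def s_def)
  have eq: "m' l i = m l i" if "i \<noteq> 2 * k" for l i using that by (simp add: m'_def)
  have dec': "line_moments k \<alpha> \<beta> m'"
    unfolding line_moments_def
  proof (intro allI impI)
    fix i j assume ij: "i + j \<le> 2 * k"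
    hence "\<beta> i j = (\<Sum>l\<in>UNIV. \<alpha> l ^ j * m l i)" using dec by (simp add: line_moments_def)
    also have "\<dots> = (\<Sum>l\<in>UNIV. \<alpha> l ^ j * m' l i)"
    proof (cases "i = 2 * k")
      case True
      thus ?thesis using ij top by simp
    qed (simp add: eq)
    finally show "\<beta> i j = (\<Sum>l\<in>UNIV. \<alpha> l ^ j * m' l i)" .
  qed
  have "l = l0" if "definite_on (m' l) (polys (Suc k))" for l
    using ham(2)[of l] that by (cases "l = l0") (auto simp: \<epsilon>_def)
  hence "l = l'" if "definite_on (m' l) (polys (Suc k))" "definite_on (m' l') (polys (Suc k))" for l l'
    using that by blast
  from atomic_representation[OF dec' ham(1) inj this]
  obtain n \<mu> g where 1: "representing_measure (lines \<alpha>) k \<beta> \<mu>" "atomic_measure n \<mu>"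
    "lform.frame m' (mid_space k) n g" by blast
  have "lform m' f h = lform m f h" if "f \<in> mid_space k" "h \<in> mid_space k" for f h
  proof -
    have "2 * k - 1 \<noteq> 2 * k" using k by simp
    thus ?thesis using lform_change[of f k h m' m undefined] that top eq k by simp
  qed
  from frame_cong[OF lform.symmetric_form_axioms lform.symmetric_form_axioms this subspace_mid 1(3)]
  show ?thesis using 1 by blast
qed


section \<open>Three lines\<close>

lemma inj_3:
  fixes \<alpha> :: "3 \<Rightarrow> real"
  assumes "inj \<alpha>"
  shows "\<alpha> 1 \<noteq> \<alpha> 2" "\<alpha> 1 \<noteq> \<alpha> 3" "\<alpha> 2 \<noteq> \<alpha> 3"
  using assms by (auto dest: injD)

lemma interpolation_3:
  fixes \<alpha> v :: "3 \<Rightarrow> real"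
  assumes "inj \<alpha>"
  obtains c0 c1 c2 where "\<And>l. v l = c0 + c1 * \<alpha> l + c2 * (\<alpha> l)\<^sup>2"
proof -
  note d = inj_3[OF assms]
  define e where "e = (v 2 - v 1) / (\<alpha> 2 - \<alpha> 1)"
  define c where "c = ((v 3 - v 1) / (\<alpha> 3 - \<alpha> 1) - e) / (\<alpha> 3 - \<alpha> 2)"
  have e: "e * (\<alpha> 2 - \<alpha> 1) = v 2 - v 1" using d by (simp add: e_def)
  have "c * (\<alpha> 3 - \<alpha> 2) = (v 3 - v 1) / (\<alpha> 3 - \<alpha> 1) - e" using d by (simp add: c_def)
  hence c: "c * (\<alpha> 3 - \<alpha> 2) * (\<alpha> 3 - \<alpha> 1) = v 3 - v 1 - e * (\<alpha> 3 - \<alpha> 1)"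
    using d by (simp add: field_simps)
  have "v l = (v 1 - e * \<alpha> 1 + c * \<alpha> 1 * \<alpha> 2) + (e - c * (\<alpha> 1 + \<alpha> 2)) * \<alpha> l + c * (\<alpha> l)\<^sup>2" for l
    using exhaust_3[of l] e c by (auto simp: power2_eq_square algebra_simps)
  thus thesis by (rule that)
qed

lemma vandermonde_3:
  fixes \<alpha> :: "3 \<Rightarrow> real"
  assumes "inj \<alpha>"
  obtains m where "(\<Sum>l\<in>UNIV. m l) = b0" "(\<Sum>l\<in>UNIV. \<alpha> l * m l) = b1"
    "(\<Sum>l\<in>UNIV. (\<alpha> l)\<^sup>2 * m l) = b2"
proof -
  note d = inj_3[OF assms]
  define z where "z = (b2 - (\<alpha> 1 + \<alpha> 2) * b1 + \<alpha> 1 * \<alpha> 2 * b0) / ((\<alpha> 3 - \<alpha> 1) * (\<alpha> 3 - \<alpha> 2))"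
  define y where "y = (b1 - \<alpha> 1 * b0 - (\<alpha> 3 - \<alpha> 1) * z) / (\<alpha> 2 - \<alpha> 1)"
  have z: "z * ((\<alpha> 3 - \<alpha> 1) * (\<alpha> 3 - \<alpha> 2)) = b2 - (\<alpha> 1 + \<alpha> 2) * b1 + \<alpha> 1 * \<alpha> 2 * b0"
    using d by (simp add: z_def)
  have y: "y * (\<alpha> 2 - \<alpha> 1) = b1 - \<alpha> 1 * b0 - (\<alpha> 3 - \<alpha> 1) * z" using d by (simp add: y_def)
  define m :: "3 \<Rightarrow> real" where "m l = (if l = 1 then b0 - y - z else if l = 2 then y else z)" for l
  have m: "m 1 = b0 - y - z" "m 2 = y" "m 3 = z" by (simp_all add: m_def)
  have 2: "\<alpha> 1 * (b0 - y - z) + \<alpha> 2 * y + \<alpha> 3 * z = b1" using y by (simp add: algebra_simps)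
  have "(\<alpha> 1)\<^sup>2 * (b0 - y - z) + (\<alpha> 2)\<^sup>2 * y + (\<alpha> 3)\<^sup>2 * z =
      (\<alpha> 1)\<^sup>2 * b0 + (\<alpha> 1 + \<alpha> 2) * (y * (\<alpha> 2 - \<alpha> 1)) + (\<alpha> 3 - \<alpha> 1) * (\<alpha> 3 + \<alpha> 1) * z"
    by (simp add: power2_eq_square algebra_simps)
  also have "\<dots> = (\<alpha> 1 + \<alpha> 2) * b1 - \<alpha> 1 * \<alpha> 2 * b0 + z * ((\<alpha> 3 - \<alpha> 1) * (\<alpha> 3 - \<alpha> 2))"
    unfolding y by (simp add: power2_eq_square algebra_simps)
  also have "\<dots> = b2" unfolding z by simp
  finally show thesis using 2 by (intro that[of m]) (simp_all add: sum_3 m)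
qed

text \<open>Interpolation writes \<open>d\<close> itself as a combination of the three vectors to
  which it is orthogonal, so \<open>d\<close> is orthogonal to itself.\<close>

lemma vandermonde_3_unique:
  fixes \<alpha> d :: "3 \<Rightarrow> real"
  assumes "inj \<alpha>" "(\<Sum>l\<in>UNIV. d l) = 0" "(\<Sum>l\<in>UNIV. \<alpha> l * d l) = 0" "(\<Sum>l\<in>UNIV. (\<alpha> l)\<^sup>2 * d l) = 0"
  shows "d l = 0"
proof -
  obtain c0 c1 c2 where c: "\<And>l. d l = c0 + c1 * \<alpha> l + c2 * (\<alpha> l)\<^sup>2"
    using interpolation_3[OF assms(1), of d] by blast
  have "(\<Sum>l\<in>UNIV. d l * d l) = (\<Sum>l\<in>UNIV. c0 * d l + c1 * (\<alpha> l * d l) + c2 * ((\<alpha> l)\<^sup>2 * d l))"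
    by (rule sum.cong[OF refl], subst (1) c) (simp add: algebra_simps)
  also have "\<dots> = 0" using assms(2-4) by (simp add: sum.distrib flip: sum_distrib_left)
  finally have "\<forall>l\<in>UNIV. d l * d l = 0" by (subst (asm) sum_nonneg_eq_0_iff) auto
  thus ?thesis by simp
qed

text \<open>The weights of the second divided difference. They span the solutions of the first two
  homogeneous Vandermonde equations and so give the direction in which the moments of degree
  \<open>2 * k - 1\<close> may move.\<close>

definition divdiff :: "(3 \<Rightarrow> real) \<Rightarrow> 3 \<Rightarrow> real" where
  "divdiff \<alpha> l = 1 / (\<Prod>l'\<in>UNIV - {l}. \<alpha> l - \<alpha> l')"

lemma divdiff_nonzero: "inj \<alpha> \<Longrightarrow> divdiff \<alpha> l \<noteq> 0"
  by (auto simp: divdiff_def dest: injD)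

lemma divdiff_sums:
  assumes "inj \<alpha>"
  shows "(\<Sum>l\<in>UNIV. divdiff \<alpha> l) = 0" "(\<Sum>l\<in>UNIV. \<alpha> l * divdiff \<alpha> l) = 0"
    "(\<Sum>l\<in>UNIV. (\<alpha> l)\<^sup>2 * divdiff \<alpha> l) = 1"
proof -
  have U: "UNIV - {1 :: 3} = {2, 3}" "UNIV - {2 :: 3} = {1, 3}" "UNIV - {3 :: 3} = {1, 2}"
    unfolding UNIV_3 by (simp_all add: insert_Diff_if)
  define x where "x = \<alpha> 1"
  define p where "p = x - \<alpha> 2"
  define q where "q = x - \<alpha> 3"
  define E where "E = p * q * (q - p)"
  have \<alpha>: "\<alpha> 1 = x" "\<alpha> 2 = x - p" "\<alpha> 3 = x - q" by (simp_all add: x_def p_def q_def)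
  have n: "p \<noteq> 0" "q \<noteq> 0" "q - p \<noteq> 0" using inj_3[OF assms] by (auto simp: \<alpha>)
  hence E: "E \<noteq> 0" by (simp add: E_def)
  have D: "divdiff \<alpha> 1 = (q - p) / E" "divdiff \<alpha> 2 = - q / E" "divdiff \<alpha> 3 = p / E"
    using n by (simp_all add: divdiff_def U \<alpha> E_def divide_simps)
  show "(\<Sum>l\<in>UNIV. divdiff \<alpha> l) = 0" "(\<Sum>l\<in>UNIV. \<alpha> l * divdiff \<alpha> l) = 0"
    using E by (simp_all add: sum_3 D \<alpha> algebra_simps flip: add_divide_distrib diff_divide_distrib)
  have "(\<Sum>l\<in>UNIV. (\<alpha> l)\<^sup>2 * divdiff \<alpha> l) = (x\<^sup>2 * (q - p) + (x - p)\<^sup>2 * - q + (x - q)\<^sup>2 * p) / E"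
    by (simp add: sum_3 D \<alpha> add_divide_distrib diff_divide_distrib right_diff_distrib)
  also have "x\<^sup>2 * (q - p) + (x - p)\<^sup>2 * - q + (x - q)\<^sup>2 * p = E"
    by (simp add: E_def power2_eq_square algebra_simps)
  finally show "(\<Sum>l\<in>UNIV. (\<alpha> l)\<^sup>2 * divdiff \<alpha> l) = 1" using E by simp
qed

lemma divdiff_multiple:
  assumes "inj \<alpha>" "(\<Sum>l\<in>UNIV. d l) = 0" "(\<Sum>l\<in>UNIV. \<alpha> l * d l) = 0"
  obtains t where "\<And>l. d l = t * divdiff \<alpha> l"
proof
  define t where "t = (\<Sum>l\<in>UNIV. (\<alpha> l)\<^sup>2 * d l)"
  fix l
  have "(\<Sum>l\<in>UNIV. f l * (d l - t * divdiff \<alpha> l)) =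
      (\<Sum>l\<in>UNIV. f l * d l) - t * (\<Sum>l\<in>UNIV. f l * divdiff \<alpha> l)" for f
    by (simp only: right_diff_distrib sum_subtractf sum_distrib_left mult.left_commute)
  note s = this[of "\<lambda>_. 1"] this[of \<alpha>] this[of "\<lambda>l. (\<alpha> l)\<^sup>2"]
  have "d l - t * divdiff \<alpha> l = 0"
    by (rule vandermonde_3_unique[OF assms(1)])
       (use s assms(2,3) divdiff_sums[OF assms(1)] in \<open>simp_all add: t_def\<close>)
  thus "d l = (\<Sum>l\<in>UNIV. (\<alpha> l)\<^sup>2 * d l) * divdiff \<alpha> l" by (simp add: t_def)
qed

definition recurrence_3 :: "nat \<Rightarrow> (3 \<Rightarrow> real) \<Rightarrow> (nat \<Rightarrow> nat \<Rightarrow> real) \<Rightarrow> bool" where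
  "recurrence_3 k \<alpha> \<beta> \<longleftrightarrow> (\<forall>i j. i + j + 3 \<le> 2 * k \<longrightarrow>
     \<beta> i (j + 3) = (\<alpha> 1 + \<alpha> 2 + \<alpha> 3) * \<beta> i (j + 2)
       - (\<alpha> 1 * \<alpha> 2 + \<alpha> 1 * \<alpha> 3 + \<alpha> 2 * \<alpha> 3) * \<beta> i (j + 1) + \<alpha> 1 * \<alpha> 2 * \<alpha> 3 * \<beta> i j)"

lemma power_recurrence_3:
  fixes \<alpha> :: "3 \<Rightarrow> real"
  shows "\<alpha> l ^ (j + 3) = (\<alpha> 1 + \<alpha> 2 + \<alpha> 3) * \<alpha> l ^ (j + 2)
       - (\<alpha> 1 * \<alpha> 2 + \<alpha> 1 * \<alpha> 3 + \<alpha> 2 * \<alpha> 3) * \<alpha> l ^ (j + 1) + \<alpha> 1 * \<alpha> 2 * \<alpha> 3 * \<alpha> l ^ j"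
proof -
  have "(\<alpha> l - \<alpha> 1) * (\<alpha> l - \<alpha> 2) * (\<alpha> l - \<alpha> 3) * \<alpha> l ^ j = 0" using exhaust_3[of l] by auto
  thus ?thesis by (simp add: algebra_simps power_add power2_eq_square power3_eq_cube)
qed

lemma sum_recurrence_3:
  fixes \<alpha> m :: "3 \<Rightarrow> real"
  shows "(\<Sum>l\<in>UNIV. \<alpha> l ^ (j + 3) * m l) = (\<alpha> 1 + \<alpha> 2 + \<alpha> 3) * (\<Sum>l\<in>UNIV. \<alpha> l ^ (j + 2) * m l)
       - (\<alpha> 1 * \<alpha> 2 + \<alpha> 1 * \<alpha> 3 + \<alpha> 2 * \<alpha> 3) * (\<Sum>l\<in>UNIV. \<alpha> l ^ (j + 1) * m l)
       + \<alpha> 1 * \<alpha> 2 * \<alpha> 3 * (\<Sum>l\<in>UNIV. \<alpha> l ^ j * m l)"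
  unfolding power_recurrence_3[of \<alpha> _ j]
  by (simp only: left_diff_distrib distrib_right sum.distrib sum_subtractf sum_distrib_left mult.assoc)

text \<open>For each \<open>i\<close> the powers of y up to the second determine line moments; the
  recurrence, which the powers of every level satisfy, carries the formula to higher powers.\<close>

lemma line_moments_iff_recurrence:
  assumes "inj \<alpha>"
  shows "(\<exists>m. line_moments k \<alpha> \<beta> m) \<longleftrightarrow> recurrence_3 k \<alpha> \<beta>"
proof
  assume "\<exists>m. line_moments k \<alpha> \<beta> m"
  then obtain m where m: "\<And>i j. i + j \<le> 2 * k \<Longrightarrow> \<beta> i j = (\<Sum>l\<in>UNIV. \<alpha> l ^ j * m l i)"
    by (auto simp: line_moments_def)
  show "recurrence_3 k \<alpha> \<beta>"
    unfolding recurrence_3_def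
  proof (intro allI impI)
    fix i j assume "i + j + 3 \<le> 2 * k"
    thus "\<beta> i (j + 3) = (\<alpha> 1 + \<alpha> 2 + \<alpha> 3) * \<beta> i (j + 2)
       - (\<alpha> 1 * \<alpha> 2 + \<alpha> 1 * \<alpha> 3 + \<alpha> 2 * \<alpha> 3) * \<beta> i (j + 1) + \<alpha> 1 * \<alpha> 2 * \<alpha> 3 * \<beta> i j"
      using sum_recurrence_3[of \<alpha> j "\<lambda>l. m l i"] by (simp only: m)
  qed
next
  assume rec: "recurrence_3 k \<alpha> \<beta>"
  have "\<exists>f. \<forall>j\<le>2. i + j \<le> 2 * k \<longrightarrow> \<beta> i j = (\<Sum>l\<in>UNIV. \<alpha> l ^ j * f l)" for i
  proof -
    \<comment> \<open>For \<open>i\<close> above \<open>2 * k - 2\<close> some of these values of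
      \<open>\<beta>\<close> lie beyond the data; whatever they are, they select one admissible
      choice of the free moments.\<close>
    obtain f where "(\<Sum>l\<in>UNIV. f l) = \<beta> i 0" "(\<Sum>l\<in>UNIV. \<alpha> l * f l) = \<beta> i 1"
        "(\<Sum>l\<in>UNIV. (\<alpha> l)\<^sup>2 * f l) = \<beta> i 2" using vandermonde_3[OF assms] .
    hence "\<beta> i j = (\<Sum>l\<in>UNIV. \<alpha> l ^ j * f l)" if "j \<le> 2" for j
      using that by (auto simp: le_Suc_eq numeral_2_eq_2)
    thus ?thesis by blast
  qed
  then obtain F where F: "\<And>i j. j \<le> 2 \<Longrightarrow> i + j \<le> 2 * k \<Longrightarrow> \<beta> i j = (\<Sum>l\<in>UNIV. \<alpha> l ^ j * F i l)"
    by metis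
  have "\<beta> i j = (\<Sum>l\<in>UNIV. \<alpha> l ^ j * F i l)" if "i + j \<le> 2 * k" for i j
    using that
  proof (induction j rule: less_induct)
    case (less j)
    show ?case
    proof (cases "j \<le> 2")
      case False
      then obtain j' where j: "j = j' + 3" by (metis add.commute le_Suc_ex not_less_eq_eq numeral_3_eq_3 numeral_2_eq_2)
      have "\<beta> i (j' + 3) = (\<alpha> 1 + \<alpha> 2 + \<alpha> 3) * \<beta> i (j' + 2)
       - (\<alpha> 1 * \<alpha> 2 + \<alpha> 1 * \<alpha> 3 + \<alpha> 2 * \<alpha> 3) * \<beta> i (j' + 1) + \<alpha> 1 * \<alpha> 2 * \<alpha> 3 * \<beta> i j'"
        using rec less.prems unfolding recurrence_3_def j by auto
      moreover have "\<beta> i (j' + 2) = (\<Sum>l\<in>UNIV. \<alpha> l ^ (j' + 2) * F i l)"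
        "\<beta> i (j' + 1) = (\<Sum>l\<in>UNIV. \<alpha> l ^ (j' + 1) * F i l)" "\<beta> i j' = (\<Sum>l\<in>UNIV. \<alpha> l ^ j' * F i l)"
        using less by (auto simp: j)
      ultimately show ?thesis using sum_recurrence_3[of \<alpha> j' "F i"] unfolding j by metis
    qed (use F less.prems in auto)
  qed
  hence "line_moments k \<alpha> \<beta> (\<lambda>l i. F i l)" by (simp add: line_moments_def)
  thus "\<exists>m. line_moments k \<alpha> \<beta> m" by blast
qed

section \<open>Restrictions of the monomials x^i y^j to the lines\<close>

definition bpoly :: "('n::finite \<Rightarrow> real) \<Rightarrow> nat \<Rightarrow> nat \<Rightarrow> real poly ^ 'n" where
  "bpoly \<alpha> i j = (\<chi> l. monom (\<alpha> l ^ j) i)"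

lemma bpoly_nth [simp]: "vec_nth (bpoly \<alpha> i j) l = monom (\<alpha> l ^ j) i"
  by (simp add: bpoly_def)

lemma lform_bpoly: "lform m (bpoly \<alpha> i j) (bpoly \<alpha> i' j') = (\<Sum>l\<in>UNIV. \<alpha> l ^ (j + j') * m l (i + i'))"
  by (simp add: lform_def mult_monom power_add)

text \<open>The restrictions of polynomials of total degree at most \<open>k\<close>: their
  coefficient of x^k is constant and that of x^(k-1) is affine in the level, which is what the
  vanishing divided difference says.\<close>

definition moment_space :: "nat \<Rightarrow> (3 \<Rightarrow> real) \<Rightarrow> (real poly ^ 3) set" where
  "moment_space k \<alpha> = {f \<in> mid_space k. (\<Sum>l\<in>UNIV. divdiff \<alpha> l * coeff (vec_nth f l) (k - 1)) = 0}"

lemma subspace_moment_space [simp]: "subspace (moment_space k \<alpha>)"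
proof (rule subspaceI)
  show "f + g \<in> moment_space k \<alpha>" if "f \<in> moment_space k \<alpha>" "g \<in> moment_space k \<alpha>" for f g
    using that subspace_add[OF subspace_mid, of f k g]
    by (simp add: moment_space_def distrib_left sum.distrib)
  show "c *\<^sub>R f \<in> moment_space k \<alpha>" if "f \<in> moment_space k \<alpha>" for c f
    using that subspace_scale[OF subspace_mid, of f k c]
    by (simp add: moment_space_def mult.left_commute[of _ c] flip: sum_distrib_left)
  show "0 \<in> moment_space k \<alpha>" by (simp add: moment_space_def subspace_0)
qed

lemma moment_subset_mid: "moment_space k \<alpha> \<subseteq> mid_space k"
  by (auto simp: moment_space_def)

lemma bpoly_low [simp]: "i < k \<Longrightarrow> bpoly \<alpha> i j \<in> low_space k"
  by (simp add: low_space_def)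

lemma bpoly_moment_space:
  assumes "inj \<alpha>" "i + j \<le> k" "k \<ge> 1"
  shows "bpoly \<alpha> i j \<in> moment_space k \<alpha>"
proof -
  have "bpoly \<alpha> i j \<in> mid_space k"
    using assms by (cases "i = k") (auto simp: mid_space_def)
  moreover have "(\<Sum>l\<in>UNIV. divdiff \<alpha> l * coeff (vec_nth (bpoly \<alpha> i j) l) (k - 1)) = 0"
  proof (cases "i = k - 1")
    case True
    hence "j = 0 \<or> j = 1" using assms by auto
    thus ?thesis using True divdiff_sums[OF assms(1)] by (auto simp: mult.commute)
  qed (simp add: coeff_monom)
  ultimately show ?thesis by (simp add: moment_space_def)
qed

lemma level_expand:
  fixes v :: "3 \<Rightarrow> real"
  assumes "inj \<alpha>"
  obtains c0 c1 c2 where "\<And>l. v l = c0 + c1 * \<alpha> l + c2 * (\<alpha> l)\<^sup>2"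
    "(\<chi> l. monom (v l) i) = c0 *\<^sub>R bpoly \<alpha> i 0 + c1 *\<^sub>R bpoly \<alpha> i 1 + c2 *\<^sub>R bpoly \<alpha> i 2"
proof -
  obtain c0 c1 c2 where c: "\<And>l. v l = c0 + c1 * \<alpha> l + c2 * (\<alpha> l)\<^sup>2"
    using interpolation_3[OF assms, of v] by blast
  have "(\<chi> l. monom (v l) i) = c0 *\<^sub>R bpoly \<alpha> i 0 + c1 *\<^sub>R bpoly \<alpha> i 1 + c2 *\<^sub>R bpoly \<alpha> i 2"
    by (simp add: Finite_Cartesian_Product.vec_eq_iff c smult_monom add_monom)
  thus thesis using c that by blast
qed

lemma vec_poly_expand:
  assumes "\<And>l. vec_nth f l \<in> polys n"
  shows "f = (\<Sum>i<n. \<chi> l. monom (coeff (vec_nth f l) i) i)"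
  using polys_expand[OF assms] by (simp add: Finite_Cartesian_Product.vec_eq_iff)

lemma span_low_space:
  fixes \<alpha> :: "3 \<Rightarrow> real"
  assumes "inj \<alpha>" and S: "\<And>i j. i < k \<Longrightarrow> j \<le> 2 \<Longrightarrow> bpoly \<alpha> i j \<in> S" "S \<subseteq> low_space k"
  shows "span S = low_space k"
proof
  show "span S \<subseteq> low_space k" using S(2) by (intro span_minimal) auto
  show "low_space k \<subseteq> span S"
  proof
    fix f :: "real poly ^ 3" assume "f \<in> low_space k"
    hence "f = (\<Sum>i<k. \<chi> l. monom (coeff (vec_nth f l) i) i)"
      by (intro vec_poly_expand) (simp add: low_space_def)
    moreover have "(\<chi> l. monom (coeff (vec_nth f l) i) i) \<in> span S" if "i < k" for i
    proof -
      obtain c0 c1 c2 where "(\<chi> l. monom (coeff (vec_nth f l) i) i) =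
          c0 *\<^sub>R bpoly \<alpha> i 0 + c1 *\<^sub>R bpoly \<alpha> i 1 + c2 *\<^sub>R bpoly \<alpha> i 2"
        using level_expand[OF assms(1)] by metis
      thus ?thesis using S(1)[OF that] by (simp only:) (intro span_add span_scale span_base, auto)
    qed
    ultimately show "f \<in> span S" by (metis (no_types, lifting) lessThan_iff span_sum)
  qed
qed

lemma span_moment_space:
  assumes "inj \<alpha>" and k: "k \<ge> 1"
    and S: "\<And>i j. i + j \<le> k \<Longrightarrow> j \<le> 2 \<Longrightarrow> bpoly \<alpha> i j \<in> S" "S \<subseteq> moment_space k \<alpha>"
  shows "span S = moment_space k \<alpha>"
proof
  show "span S \<subseteq> moment_space k \<alpha>" using S(2) by (intro span_minimal) auto
  show "moment_space k \<alpha> \<subseteq> span S"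
  proof
    fix f assume f: "f \<in> moment_space k \<alpha>"
    hence "f = (\<Sum>i<Suc k. \<chi> l. monom (coeff (vec_nth f l) i) i)"
      by (intro vec_poly_expand) (simp add: moment_space_def mid_space_def)
    moreover have "(\<chi> l. monom (coeff (vec_nth f l) i) i) \<in> span S" if i: "i < Suc k" for i
    proof (cases "i = k")
      case True
      have "(\<chi> l. monom (coeff (vec_nth f l) i) i) = coeff (vec_nth f 1) k *\<^sub>R bpoly \<alpha> k 0"
        using f True by (auto simp: Finite_Cartesian_Product.vec_eq_iff moment_space_def mid_space_def smult_monom)
      thus ?thesis using S(1)[of k 0] by (simp add: span_scale span_base)
    next
      case False
      obtain c0 c1 c2 where c: "\<And>l. coeff (vec_nth f l) i = c0 + c1 * \<alpha> l + c2 * (\<alpha> l)\<^sup>2"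
        "(\<chi> l. monom (coeff (vec_nth f l) i) i) =
          c0 *\<^sub>R bpoly \<alpha> i 0 + c1 *\<^sub>R bpoly \<alpha> i 1 + c2 *\<^sub>R bpoly \<alpha> i 2"
        using level_expand[OF assms(1), of "\<lambda>l. coeff (vec_nth f l) i" i] by blast
      have 01: "bpoly \<alpha> i 0 \<in> S" "bpoly \<alpha> i 1 \<in> S" using S(1)[of i 0] S(1)[of i 1] i False by auto
      \<comment> \<open>Below x^k only x^(k-1) y^2 may be missing from \<open>S\<close>, and its
        coefficient \<open>c2\<close> is the divided difference that \<open>moment_space\<close>
        sets to zero.\<close>
      have "c2 *\<^sub>R bpoly \<alpha> i 2 \<in> span S"
      proof (cases "i + 2 \<le> k")
        case True
        thus ?thesis using S(1)[of i 2] by (simp add: span_scale span_base)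
      next
        case False
        hence "i = k - 1" using i \<open>i \<noteq> k\<close> by auto
        hence "0 = (\<Sum>l\<in>UNIV. divdiff \<alpha> l * coeff (vec_nth f l) i)"
          using f by (simp add: moment_space_def)
        also have "\<dots> = (\<Sum>l\<in>UNIV. c0 * divdiff \<alpha> l + c1 * (\<alpha> l * divdiff \<alpha> l) + c2 * ((\<alpha> l)\<^sup>2 * divdiff \<alpha> l))"
          unfolding c(1) by (simp add: algebra_simps)
        also have "\<dots> = c2"
          using divdiff_sums[OF assms(1)] by (simp add: sum.distrib flip: sum_distrib_left)
        finally show ?thesis by (simp add: span_zero)
      qed
      moreover have "c0 *\<^sub>R bpoly \<alpha> i 0 \<in> span S" "c1 *\<^sub>R bpoly \<alpha> i 1 \<in> span S"
        using span_scale[OF span_base[OF 01(1)]] span_scale[OF span_base[OF 01(2)]] by blast+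
      ultimately show ?thesis unfolding c(2) by (intro span_add)
    qed
    ultimately show "f \<in> span S" by (metis (no_types, lifting) lessThan_iff span_sum)
  qed
qed

lemma line_moments_unique:
  fixes \<alpha> :: "3 \<Rightarrow> real"
  assumes inj: "inj \<alpha>" and m: "line_moments k \<alpha> \<beta> m" "line_moments k \<alpha> \<beta> m'"
  shows "i + 2 \<le> 2 * k \<Longrightarrow> m l i = m' l i"
    and "k \<ge> 1 \<Longrightarrow> \<exists>t. \<forall>l. m l (2 * k - 1) = m' l (2 * k - 1) + t * divdiff \<alpha> l"
    and "(\<Sum>l\<in>UNIV. m l (2 * k)) = (\<Sum>l\<in>UNIV. m' l (2 * k))"
proof -
  have s: "(\<Sum>l\<in>UNIV. \<alpha> l ^ j * (m l i - m' l i)) = 0" if "i + j \<le> 2 * k" for i j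
  proof -
    have "\<beta> i j = (\<Sum>l\<in>UNIV. \<alpha> l ^ j * m l i)" "\<beta> i j = (\<Sum>l\<in>UNIV. \<alpha> l ^ j * m' l i)"
      using m[unfolded line_moments_def, rule_format, OF that] .
    thus ?thesis by (simp only: right_diff_distrib sum_subtractf)
  qed
  show "m l i = m' l i" if "i + 2 \<le> 2 * k"
    using vandermonde_3_unique[OF inj, of "\<lambda>l. m l i - m' l i" l] s[of i 0] s[of i 1] s[of i 2] that
    by auto
  show "\<exists>t. \<forall>l. m l (2 * k - 1) = m' l (2 * k - 1) + t * divdiff \<alpha> l" if "k \<ge> 1"
  proof -
    have "(\<Sum>l\<in>UNIV. m l (2 * k - 1) - m' l (2 * k - 1)) = 0"
      "(\<Sum>l\<in>UNIV. \<alpha> l * (m l (2 * k - 1) - m' l (2 * k - 1))) = 0"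
      using s[of "2 * k - 1" 0] s[of "2 * k - 1" 1] that by simp_all
    then obtain t where t: "\<And>l. m l (2 * k - 1) - m' l (2 * k - 1) = t * divdiff \<alpha> l"
      using divdiff_multiple[OF inj, of "\<lambda>l. m l (2 * k - 1) - m' l (2 * k - 1)"] by blast
    have "m l (2 * k - 1) = m' l (2 * k - 1) + t * divdiff \<alpha> l" for l using t[of l] by simp
    thus ?thesis by blast
  qed
  show "(\<Sum>l\<in>UNIV. m l (2 * k)) = (\<Sum>l\<in>UNIV. m' l (2 * k))"
    using s[of "2 * k" 0] by (simp add: sum_subtractf)
qed

text \<open>The monic null polynomial of the singular line \<open>l0\<close> gives an equation in
  which its moment of degree \<open>2 * k - 1\<close> has coefficient one. Two candidates differ by
  a multiple of \<open>divdiff \<alpha>\<close>, which is nonzero on every line, so agreement on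
  \<open>l0\<close> is agreement everywhere.\<close>

lemma odd_moment_unique:
  fixes \<alpha> :: "3 \<Rightarrow> real"
  assumes inj: "inj \<alpha>" and k: "k \<ge> 1" and m: "line_moments k \<alpha> \<beta> m" "line_moments k \<alpha> \<beta> m'"
    and psd: "lform.psd_on m (mid_space k)" "lform.psd_on m' (mid_space k)"
    and nd: "\<not> definite_on (m l0) (polys k)"
  shows "i < 2 * k \<Longrightarrow> m l i = m' l i"
proof -
  have eq: "m l i = m' l i" if "i < 2 * k - 1" for l i
    using line_moments_unique(1)[OF inj m] that by simp
  have pl: "mom.psd_on (m l0) (polys k)"
    by (intro psd_line lform.psd_on_mono[OF psd(1) low_subset_mid])
  obtain q where q: "q \<in> polys k" "coeff q (k - 1) = 1" "mom (m l0) (q * q) = 0"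
    using monic_null_exists[OF pl null_line_top[OF psd(1)] nd] .
  have "q * q \<in> polys (2 * k - 1)" using mult_in_polys[OF q(1,1)] by (simp add: mult_2)
  hence "mom (m' l0) (q * q) = mom (m l0) (q * q)" by (rule mom_cong) (simp add: eq)
  hence "mom (m' l0) (q * monom 1 k) = 0" using null_line_top[OF psd(2) q(1)] q(3) by simp
  moreover have "mom (m l0) (q * monom 1 k) = 0" by (rule null_line_top[OF psd(1) q(1,3)])
  moreover have "q * monom 1 k \<in> polys (2 * k + 1)"
    using mult_in_polys[OF q(1), of "monom 1 k" "Suc k"] polys_mono[of "2 * k" "2 * k + 1"]
    by (auto simp: mult_2)
  note mom_change[OF this k, of "m l0" "m' l0", OF eq]
  moreover have qS: "q \<in> polys (Suc k)" using q(1) polys_mono[of k "Suc k"] by auto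
  have "coeff q k = 0" using q(1) by (simp add: polys_def)
  hence "coeff (q * monom 1 k) (2 * k) = 0" "coeff (q * monom 1 k) (2 * k - 1) = 1"
    using coeff_mult_top[OF qS, of "monom 1 k"] coeff_mult_top'[OF qS, of "monom 1 k"] k q(2) by auto
  ultimately have "m l0 (2 * k - 1) = m' l0 (2 * k - 1)" by simp
  moreover obtain t where t: "\<And>l. m l (2 * k - 1) = m' l (2 * k - 1) + t * divdiff \<alpha> l"
    using line_moments_unique(2)[OF inj m k] by blast
  ultimately have "t = 0" using divdiff_nonzero[OF inj, of l0] by simp
  show "m l i = m' l i" if "i < 2 * k"
  proof (cases "i = 2 * k - 1")
    case True
    thus ?thesis using t \<open>t = 0\<close> by simp
  next
    case False
    thus ?thesis using eq that by simp
  qed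
qed

text \<open>\<open>N\<close> lives on \<open>low_space\<close> and the moment matrix on
  \<open>moment_space\<close>; each is spanned by the common part \<open>S\<close> and one more
  vector. The unknown entry is the product of these two vectors, x^(k-1) y^2 and x^k, whose degree
  \<open>2 * k + 1\<close> is beyond the data.\<close>

lemma moment_completion:
  fixes \<alpha> :: "3 \<Rightarrow> real"
  assumes inj: "inj \<alpha>" and k: "k \<ge> 1" and m0: "line_moments k \<alpha> \<beta> m0"
    and psd: "lform.psd_on m0 (low_space k)" "lform.psd_on m0 (moment_space k \<alpha>)"
  obtains m r and p q :: bool where "line_moments k \<alpha> \<beta> m" "lform.psd_on m (mid_space k)"
    "\<exists>g. lform.frame m0 (low_space k) (r + of_bool p) g"
    "\<exists>g. lform.frame m0 (moment_space k \<alpha>) (r + of_bool q) g"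
    "\<exists>g. lform.frame m (mid_space k) (r + of_bool (p \<or> q)) g"
proof -
  define \<kappa> where "\<kappa> f = coeff (vec_nth f 1) k" for f :: "real poly ^ 3"
  define \<omega> where "\<omega> f = (\<Sum>l\<in>UNIV. divdiff \<alpha> l * coeff (vec_nth f l) (k - 1))" for f :: "real poly ^ 3"
  define S where "S = {f \<in> low_space k. \<omega> f = 0}"
  define u where "u = bpoly \<alpha> (k - 1) 2"
  define w :: "real poly ^ 3" where "w = top_power k"
  have lin: "linear \<kappa>" "linear \<omega>"
    by (auto intro!: linearI simp: \<kappa>_def \<omega>_def algebra_simps sum.distrib sum_distrib_left)
  have low_\<kappa>: "\<kappa> f = 0" if "f \<in> low_space k" for f
    using that by (simp add: \<kappa>_def low_space_def polys_def)
  have vals: "\<kappa> u = 0" "\<kappa> w = 1" "\<omega> u = 1" "\<omega> w = 0"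
    using k divdiff_sums[OF inj] by (auto simp: \<kappa>_def \<omega>_def u_def w_def coeff_monom mult.commute)
  have uw: "u \<in> low_space k" "w \<in> moment_space k \<alpha>"
    using k vals(4) by (auto simp: u_def w_def moment_space_def \<omega>_def)
  have S: "subspace S"
    using lin(2) by (intro subspaceI) (auto simp: S_def subspace_0 subspace_add subspace_scale
        linear_add linear_0 linear_cmul)
  have Sm: "S \<subseteq> moment_space k \<alpha>" by (auto simp: S_def moment_space_def \<omega>_def)
  have low: "span (insert u S) = low_space k"
  proof
    show "span (insert u S) \<subseteq> low_space k" using uw by (intro span_minimal) (auto simp: S_def)
    show "low_space k \<subseteq> span (insert u S)"
    proof
      fix f :: "real poly ^ 3" assume "f \<in> low_space k"
      hence "f - \<omega> f *\<^sub>R u \<in> S"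
        using uw vals lin by (auto simp: S_def linear_diff linear_cmul intro!: subspace_diff subspace_scale)
      thus "f \<in> span (insert u S)" using span_base by (auto simp: span_breakdown_eq)
    qed
  qed
  have \<kappa>_top: "f - \<kappa> f *\<^sub>R w \<in> low_space k" if "f \<in> mid_space k" for f
    using mid_decompose[OF that, of 1] by (metis \<kappa>_def add_diff_cancel_left' w_def)
  have mom: "span (insert w S) = moment_space k \<alpha>"
  proof
    show "span (insert w S) \<subseteq> moment_space k \<alpha>" using uw Sm by (intro span_minimal) auto
    show "moment_space k \<alpha> \<subseteq> span (insert w S)"
    proof
      fix f assume f: "f \<in> moment_space k \<alpha>"
      hence "\<omega> (f - \<kappa> f *\<^sub>R w) = 0"
        using vals lin by (simp add: linear_diff linear_cmul moment_space_def \<omega>_def[of f])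
      hence "f - \<kappa> f *\<^sub>R w \<in> S" using \<kappa>_top f moment_subset_mid by (auto simp: S_def)
      thus "f \<in> span (insert w S)" using span_base by (auto simp: span_breakdown_eq)
    qed
  qed
  have mid: "span (insert w (span (insert u S))) = mid_space k"
  proof
    show "span (insert w (span (insert u S))) \<subseteq> mid_space k"
      unfolding low using low_subset_mid by (intro span_minimal) (auto simp: w_def)
    show "mid_space k \<subseteq> span (insert w (span (insert u S)))"
      unfolding low using \<kappa>_top span_base by (fastforce simp: span_breakdown_eq)
  qed
  define F where "F = (\<lambda>(i, j). bpoly \<alpha> i j) ` ({..<k} \<times> {..2})"
  have "span F = low_space k"
    by (rule span_low_space[OF inj]) (auto simp: F_def)
  moreover have "finite F" by (simp add: F_def)
  moreover have "lform.psd_on m0 S" using psd(2) Sm by (rule lform.psd_on_mono)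
  ultimately obtain r g where fr: "lform.frame m0 S r g"
    using lform.frame_exists_subspace[OF S, of F m0] by (auto simp: S_def)
  define B where "B t = (\<lambda>x y. lform m0 x y + t * (\<kappa> x * \<omega> y + \<omega> x * \<kappa> y))" for t
  obtain t and p q :: bool where t: "symmetric_form (B t)" "symmetric_form.psd_on (B t) (mid_space k)"
    "\<exists>g. lform.frame m0 (low_space k) (r + of_bool p) g"
    "\<exists>g. lform.frame m0 (moment_space k \<alpha>) (r + of_bool q) g"
    "\<exists>g. symmetric_form.frame (B t) (mid_space k) (r + of_bool (p \<or> q)) g"
    by (rule lform.psd_completion[where B' = B, OF fr S lin _ _ vals psd[folded low mom] B_def,
          unfolded low mom mid[unfolded low]])
       (auto simp: S_def low_\<kappa>)
  \<comment> \<open>The parameter of the completed form is read back as a change of moments;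
    \<open>divdiff_sums\<close> preserves the two known equations in degree
    \<open>2 * k - 1\<close>.\<close>
  define m where "m l = (m0 l)(2 * k - 1 := m0 l (2 * k - 1) + t * divdiff \<alpha> l)" for l
  have ne: "2 * k \<noteq> 2 * k - 1" using k by simp
  have m: "line_moments k \<alpha> \<beta> m"
    unfolding line_moments_def
  proof (intro allI impI)
    fix i j assume ij: "i + j \<le> 2 * k"
    hence "\<beta> i j = (\<Sum>l\<in>UNIV. \<alpha> l ^ j * m0 l i)" using m0 by (simp add: line_moments_def)
    also have "\<dots> = (\<Sum>l\<in>UNIV. \<alpha> l ^ j * m l i)"
    proof (cases "i = 2 * k - 1")
      case True
      hence j: "j = 0 \<or> j = 1" using ij by auto
      have "(\<Sum>l\<in>UNIV. \<alpha> l ^ j * m l i) = (\<Sum>l\<in>UNIV. \<alpha> l ^ j * m0 l i) + t * (\<Sum>l\<in>UNIV. \<alpha> l ^ j * divdiff \<alpha> l)"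
        using True by (simp add: m_def distrib_left sum.distrib sum_distrib_left mult_ac)
      thus ?thesis using j divdiff_sums[OF inj] by auto
    qed (simp add: m_def)
    finally show "\<beta> i j = (\<Sum>l\<in>UNIV. \<alpha> l ^ j * m l i)" .
  qed
  have eq: "B t f g = lform m f g" if "f \<in> mid_space k" "g \<in> mid_space k" for f g
  proof -
    have d: "(\<Sum>l\<in>UNIV. (m l (2 * k - 1) - m0 l (2 * k - 1)) * coeff (vec_nth h l) (k - 1)) = t * \<omega> h" for h
      by (simp add: m_def \<omega>_def sum_distrib_left mult.assoc)
    have "lform m f g = lform m0 f g + \<kappa> f * (t * \<omega> g) + t * \<omega> f * \<kappa> g"
      using lform_change[OF that k, of m m0 1, unfolded d] ne by (simp add: m_def \<kappa>_def)
    thus ?thesis by (simp add: B_def algebra_simps)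
  qed
  show thesis
  proof (rule that[OF m _ t(3,4)])
    show "lform.psd_on m (mid_space k)"
      using t(2) psd_on_cong[OF t(1) lform.symmetric_form_axioms] eq by blast
    show "\<exists>g. lform.frame m (mid_space k) (r + of_bool (p \<or> q)) g"
      using t(5) frame_cong[OF t(1) lform.symmetric_form_axioms eq subspace_mid] by blast
  qed
qed


section \<open>The Moore--Penrose inverse of a Gram matrix\<close>

lemma moore_penrose_unique:
  assumes A: "A \<in> carrier_mat m n" and X: "is_moore_penrose A X" and Z: "is_moore_penrose A Z"
  shows "X = Z"
proof -
  have c: "X \<in> carrier_mat n m" "Z \<in> carrier_mat n m"
    using X Z A by (auto simp: is_moore_penrose_def)
  note x = X[unfolded is_moore_penrose_def] and z = Z[unfolded is_moore_penrose_def]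
  have AX: "A * X \<in> carrier_mat m m" "A * Z \<in> carrier_mat m m"
    and XA: "X * A \<in> carrier_mat n n" "Z * A \<in> carrier_mat n n" using A c by auto
  have "A * X = (A * Z * A) * X" using z by simp
  also have "\<dots> = (A * Z) * (A * X)" using A c by (intro assoc_mult_mat) auto
  finally have "(A * X)\<^sup>T = ((A * Z) * (A * X))\<^sup>T" by simp
  also have "\<dots> = (A * X)\<^sup>T * (A * Z)\<^sup>T" using AX by (intro transpose_mult) auto
  also have "\<dots> = (A * X) * (A * Z)" using x z by simp
  also have "\<dots> = (A * X * A) * Z" using A c by (intro assoc_mult_mat[symmetric]) auto
  finally have 1: "A * X = A * Z" using x by simp
  have "X * A = X * (A * Z * A)" using z by simp
  also have "\<dots> = X * (A * (Z * A))" using A c by (subst assoc_mult_mat) auto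
  also have "\<dots> = (X * A) * (Z * A)" using A c XA by (intro assoc_mult_mat[symmetric]) auto
  finally have "(X * A)\<^sup>T = ((X * A) * (Z * A))\<^sup>T" by simp
  also have "\<dots> = (Z * A)\<^sup>T * (X * A)\<^sup>T" using XA by (intro transpose_mult) auto
  also have "\<dots> = (Z * A) * (X * A)" using x z by simp
  also have "\<dots> = Z * (A * (X * A))" using A c XA by (intro assoc_mult_mat) auto
  also have "A * (X * A) = A" using x A c by (subst assoc_mult_mat[symmetric]) auto
  finally have 2: "X * A = Z * A" using x by simp
  have "X = X * A * X" using x by simp
  also have "\<dots> = Z * (A * X)" unfolding 2 using A c by (intro assoc_mult_mat) auto
  also have "\<dots> = Z * A * Z" unfolding 1 using A c by (intro assoc_mult_mat[symmetric]) auto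
  finally show ?thesis using z by simp
qed

text \<open>Full-rank factorisation: \<open>Z = Y * Y\<^sup>T\<close> is invertible as
  \<open>Y\<^sup>T\<close> is injective; with its inverse \<open>W\<close>, the matrix
  \<open>P = Y\<^sup>T * W\<close> is the Moore-Penrose inverse of \<open>Y\<close>, and
  \<open>P * P\<^sup>T\<close> that of \<open>Y\<^sup>T * Y\<close>.\<close>

lemma moore_penrose_factor:
  fixes Y Q :: "real mat"
  assumes Y: "Y \<in> carrier_mat r n" and Q: "Q \<in> carrier_mat n r" and YQ: "Y * Q = 1\<^sub>m r"
  shows "\<exists>X. is_moore_penrose (Y\<^sup>T * Y) X"
proof -
  define Z where "Z = Y * Y\<^sup>T"
  have Yt: "Y\<^sup>T \<in> carrier_mat n r" and Z: "Z \<in> carrier_mat r r" using Y by (auto simp: Z_def)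
  have Zt: "Z\<^sup>T = Z" unfolding Z_def using Y by (subst transpose_mult[OF Y Yt]) simp
  have "v = 0\<^sub>v r" if v: "v \<in> carrier_vec r" "Z *\<^sub>v v = 0\<^sub>v r" for v
  proof -
    define u where "u = Y\<^sup>T *\<^sub>v v"
    have u: "u \<in> carrier_vec n" using Yt v by (auto simp: u_def)
    have "u \<bullet> u = v \<bullet> (Y *\<^sub>v u)" using transpose_vec_mult_scalar[OF Y u v(1)] by (simp add: u_def)
    also have "Y *\<^sub>v u = Z *\<^sub>v v" unfolding u_def Z_def using assoc_mult_mat_vec[OF Y Yt v(1)] by simp
    finally have "u \<bullet> u = 0" using v by simp
    hence "(\<Sum>i<n. u $ i * u $ i) = 0" using u by (simp add: scalar_prod_def atLeast0LessThan)
    hence "\<forall>i\<in>{..<n}. u $ i * u $ i = 0" by (subst (asm) sum_nonneg_eq_0_iff) auto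
    hence "u = 0\<^sub>v n" using u by (intro eq_vecI) auto
    have "v = (Y * Q)\<^sup>T *\<^sub>v v" using YQ v by simp
    also have "(Y * Q)\<^sup>T = Q\<^sup>T * Y\<^sup>T" by (rule transpose_mult[OF Y Q])
    also have "Q\<^sup>T * Y\<^sup>T *\<^sub>v v = Q\<^sup>T *\<^sub>v u" unfolding u_def using Q Yt v by (intro assoc_mult_mat_vec) auto
    also have "\<dots> = 0\<^sub>v r" using Q by (auto simp: \<open>u = 0\<^sub>v n\<close> mult_mat_vec_def)
    finally show ?thesis .
  qed
  hence "invertible_mat Z" using invertible_mat_iff_kernel[OF Z] by blast
  then obtain W where "Z * W = 1\<^sub>m r" "W * Z = 1\<^sub>m (dim_row W)"
    using Z by (auto simp: invertible_mat_def inverts_mat_def)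
  moreover from this have "dim_row W = r" "dim_col W = r"
    using Z by (metis carrier_matD(2) index_mult_mat(3) index_one_mat(3))+
  ultimately have W: "W \<in> carrier_mat r r" "Z * W = 1\<^sub>m r" "W * Z = 1\<^sub>m r" by auto
  have "W\<^sup>T = W\<^sup>T * (Z * W)" using W by simp
  also have "\<dots> = W\<^sup>T * Z * W" using W Z by (intro assoc_mult_mat[symmetric]) auto
  also have "W\<^sup>T * Z = (Z * W)\<^sup>T" using transpose_mult[OF Z W(1)] Zt by simp
  finally have Wt: "W\<^sup>T = W" using W by simp
  define P where "P = Y\<^sup>T * W"
  have P: "P \<in> carrier_mat n r" "P\<^sup>T \<in> carrier_mat r n" using Yt W by (auto simp: P_def)
  have YP: "Y * P = 1\<^sub>m r"
    using assoc_mult_mat[OF Y Yt W(1)] W(2) by (simp add: P_def Z_def)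
  hence PY: "P\<^sup>T * Y\<^sup>T = 1\<^sub>m r" using transpose_mult[OF Y P(1)] by simp
  have "P\<^sup>T = W * Y" unfolding P_def using transpose_mult[OF Yt W(1)] Wt by simp
  \<comment> \<open>Both products are the orthogonal projection onto the row space of
    \<open>Y\<close>; the Penrose equations all reduce to it.\<close>
  hence S: "Y\<^sup>T * P\<^sup>T = P * Y" using assoc_mult_mat[OF Yt W(1) Y] by (simp add: P_def)
  have T: "(P * Y)\<^sup>T = Y\<^sup>T * P\<^sup>T" by (rule transpose_mult[OF P(1) Y])
  have cancel: "A * B * (C * D) = A * D"
    if A: "A \<in> carrier_mat n r" and B: "B \<in> carrier_mat r n" and C: "C \<in> carrier_mat n r"
      and D: "D \<in> carrier_mat r n" and BC: "B * C = 1\<^sub>m r" for A B C D :: "real mat"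
    by (simp only: assoc_mult_mat[OF A B mult_carrier_mat[OF C D]]
        assoc_mult_mat[OF B C D, symmetric] BC left_mult_one_mat[OF D])
  have "Y\<^sup>T * Y * (P * P\<^sup>T) = P * Y" "P * P\<^sup>T * (Y\<^sup>T * Y) = P * Y"
    "P * Y * (Y\<^sup>T * Y) = Y\<^sup>T * Y" "P * Y * (P * P\<^sup>T) = P * P\<^sup>T"
    using cancel[OF Yt Y P YP] cancel[OF P Yt Y PY] cancel[OF Yt P(2) Yt Y PY]
      cancel[OF P(1) Y P YP] by (simp_all only: S)
  hence "is_moore_penrose (Y\<^sup>T * Y) (P * P\<^sup>T)"
    using Y P T S by (simp add: is_moore_penrose_def)
  thus ?thesis by blast
qed

text \<open>Symmetry moves one Gram matrix F to the other side, and F X F = F does the rest. The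
  value is the squared norm of the combination of the \<open>f i\<close> with coefficients
  \<open>y\<close>.\<close>

lemma (in symmetric_form) moore_penrose_gram:
  fixes f :: "nat \<Rightarrow> 'v"
  assumes psd: "psd_on (span (f ` {..<n}))" and y: "y \<in> carrier_vec n"
  shows "(gram B n f *\<^sub>v y) \<bullet> (moore_penrose (gram B n f) *\<^sub>v (gram B n f *\<^sub>v y)) =
    y \<bullet> (gram B n f *\<^sub>v y)"
proof -
  let ?F = "gram B n f"
  have F: "?F \<in> carrier_mat n n" by simp
  obtain r g where fr: "frame (span (f ` {..<n})) r g" using frame_exists[OF psd] by blast
  obtain Y Q where "Y \<in> carrier_mat r n" "Q \<in> carrier_mat n r" "?F = Y\<^sup>T * Y" "Y * Q = 1\<^sub>m r"
    using gram_factor[OF fr psd] .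
  then obtain X0 where X0: "is_moore_penrose ?F X0" using moore_penrose_factor by metis
  have "is_moore_penrose ?F (moore_penrose ?F)"
    unfolding moore_penrose_def using X0 by (rule theI) (rule moore_penrose_unique[OF F _ X0])
  note mp = this[unfolded is_moore_penrose_def]
  define X where "X = moore_penrose ?F"
  have X: "X = moore_penrose ?F" "X \<in> carrier_mat n n" "?F * X * ?F = ?F"
    using mp[THEN conjunct1] mp[THEN conjunct2, THEN conjunct1] by (simp_all only: X_def gram_carrier dim_row_gram dim_col_gram)
  have Fy: "?F *\<^sub>v y \<in> carrier_vec n" and XFy: "X *\<^sub>v (?F *\<^sub>v y) \<in> carrier_vec n"
    using mult_mat_vec_carrier[OF F y] mult_mat_vec_carrier[OF X(2)] by auto
  have "(?F *\<^sub>v y) \<bullet> (X *\<^sub>v (?F *\<^sub>v y)) = y \<bullet> (?F *\<^sub>v (X *\<^sub>v (?F *\<^sub>v y)))"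
    using transpose_vec_mult_scalar[OF F XFy y] by (simp add: transpose_gram)
  also have "?F *\<^sub>v (X *\<^sub>v (?F *\<^sub>v y)) = ?F * X *\<^sub>v (?F *\<^sub>v y)"
    using assoc_mult_mat_vec[OF F X(2) Fy] by simp
  also have "\<dots> = ?F * X * ?F *\<^sub>v y"
    using X(2) y by (intro assoc_mult_mat_vec[symmetric]) auto
  finally show ?thesis by (simp only: X(3) X(1)[symmetric])
qed

section \<open>The matrices of the theorem\<close>

lemma hankel_mat_gram: "hankel_mat n s = gram (\<lambda>p q. mom s (p * q)) n (\<lambda>i. monom 1 i)"
  by (rule eq_matI) (auto simp: hankel_mat_def mult_monom)

lemma sum_monom_in_polys: "(\<Sum>i<n. c i *\<^sub>R monom 1 i) \<in> polys n"
  by (intro subspace_sum subspace_scale) auto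

lemma coeff_sum_monom: "i < n \<Longrightarrow> coeff (\<Sum>i<n. c i *\<^sub>R monom 1 i) i = (c i :: real)"
  by (simp add: coeff_sum smult_monom coeff_monom)

lemma sum_monom_coeff: "p \<in> polys n \<Longrightarrow> (\<Sum>i<n. coeff p i *\<^sub>R monom 1 i) = p"
  using polys_expand[of p n] by (simp add: smult_monom)

lemma invertible_hankel_iff:
  assumes "mom.psd_on s (polys n)"
  shows "invertible_mat (hankel_mat n s) \<longleftrightarrow> definite_on s (polys n)"
proof -
  have "invertible_mat (hankel_mat n s) \<longleftrightarrow>
    (\<forall>c. mom s ((\<Sum>i<n. c i *\<^sub>R monom 1 i) * (\<Sum>i<n. c i *\<^sub>R monom 1 i)) = 0 \<longrightarrow> (\<forall>i<n. c i = 0))"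
    unfolding hankel_mat_gram by (rule mom.invertible_gram_iff) (simp only: span_monom assms)
  also have "\<dots> \<longleftrightarrow> definite_on s (polys n)"
  proof
    assume L: "\<forall>c. mom s ((\<Sum>i<n. c i *\<^sub>R monom 1 i) * (\<Sum>i<n. c i *\<^sub>R monom 1 i)) = 0 \<longrightarrow> (\<forall>i<n. c i = 0)"
    show "definite_on s (polys n)"
      unfolding definite_on_def
    proof (intro ballI impI)
      fix p assume p: "p \<in> polys n" "mom s (p * p) = 0"
      hence "\<forall>i<n. coeff p i = 0"
        using spec[OF L, of "coeff p"] by (simp only: sum_monom_coeff[OF p(1)] simp_thms)
      thus "p = 0" using p(1) by (intro poly_eqI) (auto simp: polys_def not_less[symmetric])
    qed
  next
    assume R: "definite_on s (polys n)"
    show "\<forall>c. mom s ((\<Sum>i<n. c i *\<^sub>R monom 1 i) * (\<Sum>i<n. c i *\<^sub>R monom 1 i)) = 0 \<longrightarrow> (\<forall>i<n. c i = 0)"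
      using R sum_monom_in_polys[of _ n] coeff_sum_monom[of _ n]
      unfolding definite_on_def by (metis coeff_0)
  qed
  finally show ?thesis .
qed

lemma mom_scale: "mom (\<lambda>i. c * s i) p = c * mom s p"
  by (simp add: mom_def sum_distrib_left mult_ac)

lemma invertible_scaled_hankel_iff:
  assumes "mom.psd_on s (polys n)" "c > 0"
  shows "invertible_mat (hankel_mat n (\<lambda>i. c * s i)) \<longleftrightarrow> definite_on s (polys n)"
proof -
  have "mom.psd_on (\<lambda>i. c * s i) (polys n)" using assms unfolding mom.psd_on_def by (simp add: mom_scale)
  from invertible_hankel_iff[OF this] show ?thesis
    using assms by (simp add: definite_on_def mom_scale)
qed

text \<open>Bordering raises the rank exactly if \<open>\<epsilon>\<close> is nonzero, and the large
  matrix is then invertible exactly if \<open>s\<close> is definite below degree \<open>k\<close>.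
  The left-hand side thus says that the line can absorb the excess
  \<open>\<epsilon>\<close>.\<close>

lemma rank_hankel_extension:
  assumes psd: "mom.psd_on s (polys k)" and k: "k \<ge> 1"
    and w: "w \<in> polys k" "\<And>p. p \<in> polys k \<Longrightarrow> mom s ((monom 1 k - w) * p) = 0"
    and \<epsilon>: "\<epsilon> \<ge> 0"
    and s': "s' = s(2 * k := mom s (monom 1 k * w) + \<epsilon>)"
  shows "invertible_mat (hankel_mat (Suc k) s') \<or>
      mat_rank (hankel_mat (Suc k) s') = mat_rank (hankel_mat k s') \<longleftrightarrow>
    definite_on s (polys k) \<or> \<epsilon> = 0"
proof -
  have top: "mom.psd_on s' (polys (Suc k))" "mom s' ((monom 1 k - w) * (monom 1 k - w)) = \<epsilon>"
    using hamburger_top_change(1,3)[OF psd k w(1) _ \<epsilon> s'] w(2) by blast+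
  have top2: "mom s' ((monom 1 k - w) * p) = 0" if "p \<in> polys k" for p
    using hamburger_top_change(2)[OF psd k w(1) _ \<epsilon> s' that] w(2) by blast
  have low: "mom s' (f * p) = mom s (f * p)" if "f \<in> polys k" "p \<in> polys k" for f p
    using mult_in_polys[OF that] k by (intro mom_cong[of _ "2 * k - 1"]) (auto simp: s' mult_2)
  have sub: "polys k \<subseteq> polys (Suc k)" by (rule polys_mono) simp
  have inv: "invertible_mat (hankel_mat (Suc k) s') \<longleftrightarrow> definite_on s' (polys (Suc k))"
    by (rule invertible_hankel_iff[OF top(1)])
  have d1: "definite_on s (polys k)" if "definite_on s' (polys (Suc k))"
    using that low sub by (auto simp: definite_on_def)
  have d2: "definite_on s' (polys (Suc k))" if d: "definite_on s (polys k)" and e: "\<epsilon> \<noteq> 0"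
    unfolding definite_on_def
  proof (intro ballI impI)
    fix f assume f: "f \<in> polys (Suc k)" "mom s' (f * f) = 0"
    define q where "q = monom 1 k - w"
    have q: "q \<in> polys (Suc k)" "coeff q k = 1" using w(1) sub by (auto simp: q_def polys_def intro!: subspace_diff)
    define p where "p = f - coeff f k *\<^sub>R q"
    have p: "p \<in> polys k"
      unfolding p_def using f q by (intro polys_diff_reduce subspace_scale) auto
    have fp: "f = coeff f k *\<^sub>R q + p" by (simp add: p_def)
    have "0 = mom s' (f * q)" using mom.psd_null[OF subspace_polys top(1) f q(1)] by simp
    also have "f * q = (coeff f k *\<^sub>R q + p) * q" using fp by simp
    also have "mom s' ((coeff f k *\<^sub>R q + p) * q) = coeff f k * mom s' (q * q) + mom s' (q * p)"
      by (simp only: scaleR_real_poly distrib_right mult_smult_left mom_add mom_smult mult.commute[of p q])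
    also have "\<dots> = coeff f k * \<epsilon>" using top2[OF p] top(2) by (simp add: q_def)
    finally have "f \<in> polys k" using e p fp by simp
    thus "f = 0" using d f(2) low[of f f] by (simp add: definite_on_def)
  qed
  have "mat_rank (hankel_mat (Suc k) s') = mat_rank (hankel_mat k s') +
      of_bool (mom s' ((monom 1 k - w) * (monom 1 k - w)) \<noteq> 0)"
    unfolding hankel_mat_gram
    by (rule mom.mat_rank_gram_Suc) (simp_all only: span_monom top(1) w(1) top2)
  thus ?thesis using inv d1 d2 top(2) by auto
qed

section \<open>Shifted moments, and the moment matrix and N as Gram matrices\<close>

lemma coeff_lift_power: "coeff ([:[:- a:], 1:] ^ j) s = [:coeff ([:- a, 1:] ^ j) s:]"
  for a :: real
proof (induction j arbitrary: s)
  case 0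
  thus ?case by (cases s) (auto simp: coeff_1)
next
  case (Suc j)
  thus ?case by (cases s) (auto simp: coeff_pCons)
qed

lemma riesz_functional_mom: "riesz_functional \<beta> p = (\<Sum>j\<le>degree p. mom (\<lambda>i. \<beta> i j) (coeff p j))"
  by (simp add: riesz_functional_def mom_def)

lemma shifted_moment_lines:
  assumes m: "line_moments k \<alpha> \<beta> m" and ij: "i + j \<le> 2 * k"
  shows "shifted_moment a \<beta> i j = (\<Sum>l\<in>UNIV. (\<alpha> l - a) ^ j * m l i)"
proof -
  define q where "q = [:- a, 1:] ^ j"
  define p where "p = [:monom 1 i:] * [:[:- a:], 1:] ^ j"
  have c: "coeff p s = monom (coeff q s) i" for s
    by (simp add: p_def q_def coeff_lift_power smult_monom)
  have dq: "degree q = j" by (simp add: q_def degree_linear_power)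
  have dp: "degree p \<le> j"
    by (rule degree_le) (simp add: c coeff_eq_0 dq)
  have "shifted_moment a \<beta> i j = (\<Sum>s\<le>degree p. coeff q s * \<beta> i s)"
    unfolding shifted_moment_def p_def[symmetric] riesz_functional_mom c by simp
  also have "\<dots> = (\<Sum>s\<le>j. coeff q s * \<beta> i s)"
  proof (rule sum.mono_neutral_left)
    show "\<forall>s\<in>{..j} - {..degree p}. coeff q s * \<beta> i s = 0"
    proof
      fix s assume "s \<in> {..j} - {..degree p}"
      hence "coeff p s = 0" by (simp add: coeff_eq_0)
      thus "coeff q s * \<beta> i s = 0" by (simp add: c)
    qed
  qed (use dp in auto)
  also have "\<dots> = (\<Sum>s\<le>j. \<Sum>l\<in>UNIV. coeff q s * \<alpha> l ^ s * m l i)"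
    using m ij by (intro sum.cong) (auto simp: line_moments_def sum_distrib_left mult.assoc)
  also have "\<dots> = (\<Sum>l\<in>UNIV. poly q (\<alpha> l) * m l i)"
    by (subst sum.swap) (simp add: poly_altdef dq sum_distrib_right)
  also have "\<dots> = (\<Sum>l\<in>UNIV. (\<alpha> l - a) ^ j * m l i)" by (simp add: q_def)
  finally show ?thesis .
qed

lemma set_monomials: "set (monomials k) = {(i, j). i + j \<le> k}"
proof (intro equalityI subsetI)
  fix x assume "x \<in> {(i, j). i + j \<le> k}"
  then obtain i j where x: "x = (i, j)" "i + j \<le> k" by auto
  hence "x \<in> (\<lambda>j'. (i + j - j', j')) ` {0..<i + j + 1}"
    by (intro image_eqI[of _ _ j]) auto
  thus "x \<in> set (monomials k)"
    using x(2) by (auto simp: monomials_def simp del: upt_Suc intro!: bexI[of _ "i + j"])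
qed (auto simp: monomials_def)

definition monomial_vec :: "nat \<Rightarrow> (3 \<Rightarrow> real) \<Rightarrow> nat \<Rightarrow> real poly ^ 3" where
  "monomial_vec k \<alpha> r = bpoly \<alpha> (fst (monomials k ! r)) (snd (monomials k ! r))"

lemma moment_mat_gram:
  assumes m: "line_moments k \<alpha> \<beta> m"
  shows "moment_mat k \<beta> = gram (lform m) (length (monomials k)) (monomial_vec k \<alpha>)"
proof (rule eq_matI)
  fix r c assume "r < dim_row (gram (lform m) (length (monomials k)) (monomial_vec k \<alpha>))"
    "c < dim_col (gram (lform m) (length (monomials k)) (monomial_vec k \<alpha>))"
  hence rc: "r < length (monomials k)" "c < length (monomials k)" by auto
  have "monomials k ! r \<in> set (monomials k)" "monomials k ! c \<in> set (monomials k)" using rc by auto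
  hence "fst (monomials k ! r) + snd (monomials k ! r) \<le> k" "fst (monomials k ! c) + snd (monomials k ! c) \<le> k"
    by (auto simp: set_monomials case_prod_beta)
  hence "(fst (monomials k ! r) + fst (monomials k ! c)) + (snd (monomials k ! r) + snd (monomials k ! c)) \<le> 2 * k"
    by simp
  thus "moment_mat k \<beta> $$ (r, c) = gram (lform m) (length (monomials k)) (monomial_vec k \<alpha>) $$ (r, c)"
    using rc m unfolding line_moments_def
    by (simp add: moment_mat_def Let_def monomial_vec_def lform_bpoly)
qed (simp_all add: moment_mat_def Let_def)

lemma span_monomial_vec:
  assumes "inj \<alpha>" "k \<ge> 1"
  shows "span (monomial_vec k \<alpha> ` {..<length (monomials k)}) = moment_space k \<alpha>"
proof (rule span_moment_space[OF assms])
  have e: "monomial_vec k \<alpha> ` {..<length (monomials k)} = (\<lambda>(i, j). bpoly \<alpha> i j) ` {(i, j). i + j \<le> k}"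
  proof -
    have "monomial_vec k \<alpha> ` {..<length (monomials k)} =
        (\<lambda>x. bpoly \<alpha> (fst x) (snd x)) ` ((!) (monomials k) ` {..<length (monomials k)})"
      by (simp add: image_image monomial_vec_def)
    also have "(!) (monomials k) ` {..<length (monomials k)} = set (monomials k)"
      by (auto simp: set_conv_nth)
    finally show ?thesis by (simp add: set_monomials case_prod_beta)
  qed
  show "bpoly \<alpha> i j \<in> monomial_vec k \<alpha> ` {..<length (monomials k)}" if "i + j \<le> k" for i j
    unfolding e using that by (auto intro!: image_eqI[of _ _ "(i, j)"])
  show "monomial_vec k \<alpha> ` {..<length (monomials k)} \<subseteq> moment_space k \<alpha>"
    unfolding e using bpoly_moment_space[OF assms(1) _ assms(2)] by auto
qed

text \<open>The shift of y changes the monomials but not their span, so \<open>N\<close>, built from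
  shifted moments, is a Gram matrix on the same \<open>low_space\<close>.\<close>

lemma span_block_monomials:
  assumes "inj h"
  shows "span ((\<lambda>r. bpoly h (r mod k) (r div k)) ` {..<3 * k}) = (low_space k :: (real poly ^ 3) set)"
proof (rule span_low_space[OF assms])
  show "bpoly h i j \<in> (\<lambda>r. bpoly h (r mod k) (r div k)) ` {..<3 * k}" if "i < k" "j \<le> 2" for i j
  proof (rule image_eqI[of _ _ "j * k + i"])
    have "j * k + i < j * k + k" using that by simp
    also have "\<dots> = (j + 1) * k" by simp
    also have "\<dots> \<le> 3 * k" using that by (intro mult_right_mono) auto
    finally show "j * k + i \<in> {..<3 * k}" by simp
  qed (use that in auto)
  show "(\<lambda>r. bpoly h (r mod k) (r div k)) ` {..<3 * k} \<subseteq> low_space k"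
  proof (rule image_subsetI)
    fix r assume "r \<in> {..<3 * k}"
    hence "r mod k < k" by (cases "k = 0") auto
    thus "bpoly h (r mod k) (r div k) \<in> low_space k" by simp
  qed
qed


text \<open>Kernel vectors of a semidefinite Hankel matrix are the coefficient vectors of null
  polynomials. The factor \<open>c\<close> will be \<open>a3 - a2\<close>.\<close>

lemma hankel_kernel_iff:
  assumes psd: "mom.psd_on s (polys k)" and c: "c > 0" and u: "u \<in> carrier_vec k"
  shows "hankel_mat k (\<lambda>i. c * s i) *\<^sub>v u = 0\<^sub>v k \<longleftrightarrow>
    mom s ((\<Sum>i<k. (u $ i) *\<^sub>R monom 1 i) * (\<Sum>i<k. (u $ i) *\<^sub>R monom 1 i)) = 0"
proof -
  define q where "q = (\<Sum>i<k. (u $ i) *\<^sub>R monom 1 i :: real poly)"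
  define s' where "s' = (\<lambda>i. c * s i)"
  have s': "mom s' p = c * mom s p" for p by (simp add: s'_def mom_scale)
  have psd': "mom.psd_on s' (polys k)" using psd c unfolding mom.psd_on_def by (simp add: s')
  have q: "q \<in> polys k" unfolding q_def by (rule sum_monom_in_polys)
  have idx: "(hankel_mat k s' *\<^sub>v u) $ i = mom s' (monom 1 i * q)" if "i < k" for i
    unfolding hankel_mat_gram q_def by (rule mom.gram_mult_vec[OF u that])
  have quad: "u \<bullet> (hankel_mat k s' *\<^sub>v u) = mom s' (q * q)"
    unfolding hankel_mat_gram q_def by (rule mom.gram_quadratic[OF u u])
  have "hankel_mat k s' *\<^sub>v u = 0\<^sub>v k \<longleftrightarrow> mom s' (q * q) = 0"
  proof
    assume "hankel_mat k s' *\<^sub>v u = 0\<^sub>v k"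
    thus "mom s' (q * q) = 0" using quad u by simp
  next
    assume n: "mom s' (q * q) = 0"
    show "hankel_mat k s' *\<^sub>v u = 0\<^sub>v k"
    proof (rule eq_vecI)
      fix i assume "i < dim_vec (0\<^sub>v k)"
      hence i: "i < k" by simp
      have "mom s' (q * monom 1 i) = 0"
        using mom.psd_null[OF subspace_polys psd' q n, of "monom 1 i"] i by simp
      thus "(hankel_mat k s' *\<^sub>v u) $ i = 0\<^sub>v k $ i" using idx[OF i] i by (simp add: mult.commute)
    qed (simp add: hankel_mat_def)
  qed
  thus ?thesis using c unfolding s'_def[symmetric] q_def[symmetric] by (simp add: s')
qed

lemma append_singleton_index:
  assumes "i < Suc (dim_vec v)"
  shows "(v @\<^sub>v singleton_vec t) $ i = (if i < dim_vec v then v $ i else t)"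
  using assms by (subst index_append_vec(1)) (auto simp: vec_of_list_index less_Suc_eq)

lemma append_singleton_append_index:
  assumes "i < dim_vec v + Suc (dim_vec w)"
  shows "(v @\<^sub>v singleton_vec t @\<^sub>v w) $ i =
    (if i < dim_vec v then v $ i else if i = dim_vec v then t else w $ (i - Suc (dim_vec v)))"
proof -
  have "(v @\<^sub>v singleton_vec t @\<^sub>v w) $ i =
      (if i < dim_vec v then v $ i else (singleton_vec t @\<^sub>v w) $ (i - dim_vec v))"
    using assms by (subst index_append_vec(1)) auto
  also have "(singleton_vec t @\<^sub>v w) $ (i - dim_vec v) =
      (if i = dim_vec v then t else w $ (i - Suc (dim_vec v)))" if "\<not> i < dim_vec v"
    using assms that by (subst index_append_vec(1)) (auto simp: vec_of_list_index)
  ultimately show ?thesis by auto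
qed

section \<open>The equivalence\<close>

locale shifted_lines =
  fixes k :: nat and c1 c2 c3 a2 a3 :: real and \<beta> b :: "nat \<Rightarrow> nat \<Rightarrow> real"
  assumes k: "k \<ge> 3" and \<alpha>_less: "c1 \<noteq> c2" "c1 < c3" "c2 < c3"
    and a_def: "a2 = c2 - c1" "a3 = c3 - c1"
    and b_def: "b = ext_moment k c1 a2 a3 \<beta>"
begin

definition \<alpha> :: "3 \<Rightarrow> real" where
  "\<alpha> l = (if l = 1 then c1 else if l = 2 then c2 else c3)"

definition h :: "3 \<Rightarrow> real" where
  "h l = \<alpha> l - c1"

lemma \<alpha>_simps [simp]: "\<alpha> 1 = c1" "\<alpha> 2 = c2" "\<alpha> 3 = c3"
  and h_simps [simp]: "h 1 = 0" "h 2 = a2" "h 3 = a3"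
  by (simp_all add: \<alpha>_def h_def a_def)

definition condition :: bool where
  "condition \<longleftrightarrow> invertible_mat (mat_A01 k b - a2 \<cdot>\<^sub>m mat_B00 k a2 a3 b) \<or>
    invertible_mat (a3 \<cdot>\<^sub>m mat_B00 k a2 a3 b - mat_A01 k b) \<or>
    (\<forall>v \<in> carrier_vec (k - 1).
      (a3 \<cdot>\<^sub>m mat_B00 k a2 a3 b - mat_A01 k b) *\<^sub>v (v @\<^sub>v singleton_vec 1) = 0\<^sub>v k \<longrightarrow>
      (let t' = t_prime k a2 a3 b v; u' = u_prime k a2 a3 b t'; A\<gamma> = mat_A_gamma k a2 a3 \<beta> b t' u'
       in invertible_mat A\<gamma> \<or> mat_rank A\<gamma> = mat_rank (corner_mat k A\<gamma>)))"

lemma inj_\<alpha>: "inj \<alpha>"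
proof (rule injI)
  fix l l' assume "\<alpha> l = \<alpha> l'"
  thus "l = l'" using exhaust_3[of l] exhaust_3[of l'] \<alpha>_less by auto
qed

lemma inj_h: "inj h"
  using inj_\<alpha> by (auto simp: h_def inj_def)

lemma a_facts: "a2 \<noteq> 0" "a3 > 0" "a2 < a3" "a3 \<noteq> 0" "a3 - a2 > 0"
  using \<alpha>_less by (auto simp: a_def)

lemma k1: "k \<ge> 1"
  using k by simp

lemma lines_eq: "lines \<alpha> = {(x, y). (y - c1) * (y - c2) * (y - c3) = 0}"
proof -
  have "range \<alpha> = {c1, c2, c3}" by (simp add: UNIV_3)
  thus ?thesis by (auto simp: lines_def)
qed

lemma recurrence_iff: "recurrence_3 k \<alpha> \<beta> \<longleftrightarrow> (\<forall>i j. i + j \<le> 2 * k - 3 \<longrightarrow>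
    \<beta> i (j + 3) = (c1 + c2 + c3) * \<beta> i (j + 2)
      - (c1 * c2 + c1 * c3 + c2 * c3) * \<beta> i (j + 1)
      + c1 * c2 * c3 * \<beta> i j)"
proof -
  have "i + j + 3 \<le> 2 * k \<longleftrightarrow> i + j \<le> 2 * k - 3" for i j using k by auto
  thus ?thesis by (simp only: recurrence_3_def \<alpha>_simps)
qed

context
  fixes m
  assumes m: "line_moments k \<alpha> \<beta> m"
begin

lemma b_low: "i + j \<le> 2 * k \<Longrightarrow> b i j = (\<Sum>l\<in>UNIV. h l ^ j * m l i)"
  using shifted_moment_lines[OF m, of i j c1] by (simp add: b_def ext_moment_def Let_def h_def)

text \<open>The three entries beyond the data are defined by the recurrence of y (y - a2) (y - a3),
  which the powers of the shifted levels satisfy; hence the formula of \<open>b_low\<close> persists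
  for them.\<close>

lemma b_block:
  assumes "i + 2 \<le> 2 * k" "j \<le> 4"
  shows "b i j = (\<Sum>l\<in>UNIV. h l ^ j * m l i)"
proof (cases "i + j \<le> 2 * k")
  case False
  have s: "shifted_moment c1 \<beta> i' j' = (\<Sum>l\<in>UNIV. h l ^ j' * m l i')" if "i' + j' \<le> 2 * k" for i' j'
    using shifted_moment_lines[OF m that, of c1] by (simp add: h_def)
  have ij: "i = 2 * k - 3 \<and> j = 4 \<or> i = 2 * k - 2 \<and> j = 3 \<or> i = 2 * k - 2 \<and> j = 4"
    using assms False by auto
  have ne: "2 * k - 3 \<noteq> 2 * k - 2" using k by simp
  define S where "S = shifted_moment c1 \<beta>"
  have "b (2 * k - 3) 4 = (a2 + a3) * S (2 * k - 3) 3 - a2 * a3 * S (2 * k - 3) 2"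
    "b (2 * k - 2) 3 = (a2 + a3) * S (2 * k - 2) 2 - a2 * a3 * S (2 * k - 2) 1"
    "b (2 * k - 2) 4 = (a2 + a3) * ((a2 + a3) * S (2 * k - 2) 2 - a2 * a3 * S (2 * k - 2) 1)
      - a2 * a3 * S (2 * k - 2) 2"
    using k ne by (auto simp: b_def ext_moment_def Let_def S_def)
  moreover define p q where "p = 2 * k - 3" and "q = 2 * k - 2"
  moreover have "S p 3 = a2 ^ 3 * m 2 p + a3 ^ 3 * m 3 p" "S p 2 = a2\<^sup>2 * m 2 p + a3\<^sup>2 * m 3 p"
      "S q 2 = a2\<^sup>2 * m 2 q + a3\<^sup>2 * m 3 q" "S q 1 = a2 * m 2 q + a3 * m 3 q"
    using s[of p 3] s[of p 2] s[of q 2] s[of q 1] k by (simp_all add: sum_3 S_def p_def q_def)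
  ultimately have "b p 4 = a2 ^ 4 * m 2 p + a3 ^ 4 * m 3 p" "b q 3 = a2 ^ 3 * m 2 q + a3 ^ 3 * m 3 q"
    "b q 4 = a2 ^ 4 * m 2 q + a3 ^ 4 * m 3 q"
    by (simp_all add: power2_eq_square power3_eq_cube power4_eq_xxxx algebra_simps)
  moreover have "i = p \<and> j = 4 \<or> i = q \<and> j = 3 \<or> i = q \<and> j = 4" using ij by (simp add: p_def q_def)
  ultimately show ?thesis by (auto simp: sum_3)
qed (rule b_low)

lemma b_1: "i + 1 \<le> 2 * k \<Longrightarrow> b i (Suc 0) = a2 * m 2 i + a3 * m 3 i"
  and b_2: "i + 2 \<le> 2 * k \<Longrightarrow> b i 2 = a2\<^sup>2 * m 2 i + a3\<^sup>2 * m 3 i"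
  using b_low[of i 1] b_low[of i 2] by (simp_all add: sum_3)

lemma \<beta>_0: "i \<le> 2 * k \<Longrightarrow> \<beta> i 0 = m 1 i + m 2 i + m 3 i"
  using m by (simp add: line_moments_def sum_3)

lemma two_line_moment:
  assumes "i + 2 \<le> 2 * k"
  shows "inverse (a2 * a3) * ((a2 + a3) * b i (Suc 0) - b i 2) = m 2 i + m 3 i"
proof -
  have "(a2 + a3) * b i (Suc 0) - b i 2 = (a2 * a3) * (m 2 i + m 3 i)"
    using assms by (simp add: b_1 b_2 power2_eq_square algebra_simps)
  hence "inverse (a2 * a3) * ((a2 + a3) * b i (Suc 0) - b i 2) =
      (inverse (a2 * a3) * (a2 * a3)) * (m 2 i + m 3 i)" by (simp only: mult.assoc)
  also have "inverse (a2 * a3) * (a2 * a3) = 1" using a_facts by (intro left_inverse) simp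
  finally show ?thesis by simp
qed

lemma mat_B00_index: "i < k \<Longrightarrow> j < k \<Longrightarrow> mat_B00 k a2 a3 b $$ (i, j) = m 2 (i + j) + m 3 (i + j)"
  using two_line_moment[of "i + j"] by (simp add: mat_B00_def hankel_mat_def)

lemma mat_A01_index: "i < k \<Longrightarrow> j < k \<Longrightarrow> mat_A01 k b $$ (i, j) = a2 * m 2 (i + j) + a3 * m 3 (i + j)"
  by (simp add: mat_A01_def hankel_mat_def b_1)

lemma mat_A11_index: "i < k \<Longrightarrow> j < k \<Longrightarrow> mat_A11 k b $$ (i, j) = a2\<^sup>2 * m 2 (i + j) + a3\<^sup>2 * m 3 (i + j)"
  by (simp add: mat_A11_def hankel_mat_def b_2)

lemma mat_dims [simp]:
  "dim_row (mat_B00 k a2 a3 b) = k" "dim_col (mat_B00 k a2 a3 b) = k"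
  "dim_row (mat_A01 k b) = k" "dim_col (mat_A01 k b) = k"
  "dim_row (mat_A11 k b) = k" "dim_col (mat_A11 k b) = k"
  by (simp_all add: mat_B00_def mat_A01_def mat_A11_def hankel_mat_def)

lemma line_3_hankel: "mat_A01 k b - a2 \<cdot>\<^sub>m mat_B00 k a2 a3 b = hankel_mat k (\<lambda>i. (a3 - a2) * m 3 i)"
  by (rule eq_matI) (auto simp: mat_A01_index mat_B00_index hankel_mat_def algebra_simps)

lemma line_2_hankel: "a3 \<cdot>\<^sub>m mat_B00 k a2 a3 b - mat_A01 k b = hankel_mat k (\<lambda>i. (a3 - a2) * m 2 i)"
  by (rule eq_matI) (auto simp: mat_A01_index mat_B00_index hankel_mat_def algebra_simps)

lemma mat_N_gram: "mat_N k b = gram (lform m) (3 * k) (\<lambda>r. bpoly h (r mod k) (r div k))"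
proof (rule eq_matI)
  fix r c assume "r < dim_row (gram (lform m) (3 * k) (\<lambda>r. bpoly h (r mod k) (r div k)))"
    "c < dim_col (gram (lform m) (3 * k) (\<lambda>r. bpoly h (r mod k) (r div k)))"
  hence rc: "r < 3 * k" "c < 3 * k" by auto
  hence "r div k < 3" "c div k < 3" by (auto simp: less_mult_imp_div_less)
  hence d: "r div k + c div k \<le> 4" by linarith
  have "r mod k < k" "c mod k < k" using k by auto
  hence "r mod k + c mod k + 2 \<le> 2 * k" by linarith
  hence "b (r mod k + c mod k) (r div k + c div k) =
      (\<Sum>l\<in>UNIV. h l ^ (r div k + c div k) * m l (r mod k + c mod k))"
    using d by (rule b_block)
  thus "mat_N k b $$ (r, c) = gram (lform m) (3 * k) (\<lambda>r. bpoly h (r mod k) (r div k)) $$ (r, c)"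
    using rc by (simp add: mat_N_def lform_bpoly)
qed (simp_all add: mat_N_def)

lemma psd_mat_N_iff: "psd_mat (mat_N k b) \<longleftrightarrow> lform.psd_on m (low_space k)"
  unfolding mat_N_gram lform.psd_mat_gram span_block_monomials[OF inj_h] ..

lemma psd_moment_mat_iff: "psd_mat (moment_mat k \<beta>) \<longleftrightarrow> lform.psd_on m (moment_space k \<alpha>)"
  unfolding moment_mat_gram[OF m] lform.psd_mat_gram span_monomial_vec[OF inj_\<alpha> k1] ..

lemma mat_rank_N:
  assumes "lform.psd_on m (low_space k)" "lform.frame m (low_space k) r g"
  shows "mat_rank (mat_N k b) = r"
  unfolding mat_N_gram
  by (rule lform.mat_rank_gram[where g = g]) (simp_all only: span_block_monomials[OF inj_h] assms)

lemma mat_rank_M: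
  assumes "lform.psd_on m (moment_space k \<alpha>)" "lform.frame m (moment_space k \<alpha>) r g"
  shows "mat_rank (moment_mat k \<beta>) = r"
  unfolding moment_mat_gram[OF m]
  by (rule lform.mat_rank_gram[where g = g]) (simp_all only: span_monomial_vec[OF inj_\<alpha> k1] assms)

section \<open>The conditions (a), (b) and (c) for a semidefinite form\<close>

context
  assumes psd: "lform.psd_on m (mid_space k)"
begin

lemma psd_l: "mom.psd_on (m l) (polys k)"
  by (intro psd_line lform.psd_on_mono[OF psd low_subset_mid])

lemma condition_a_iff: "invertible_mat (mat_A01 k b - a2 \<cdot>\<^sub>m mat_B00 k a2 a3 b) \<longleftrightarrow> definite_on (m 3) (polys k)"
  unfolding line_3_hankel using a_facts by (intro invertible_scaled_hankel_iff psd_l)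

lemma condition_b_iff: "invertible_mat (a3 \<cdot>\<^sub>m mat_B00 k a2 a3 b - mat_A01 k b) \<longleftrightarrow> definite_on (m 2) (polys k)"
  unfolding line_2_hankel using a_facts by (intro invertible_scaled_hankel_iff psd_l)

text \<open>The vector lists the coefficients of the monic null polynomial of degree
  \<open>k - 1\<close>. Its existence shows that (c), quantified over all such vectors, is not
  vacuous when (b) fails.\<close>

lemma kernel_vector_exists:
  assumes "\<not> definite_on (m 2) (polys k)"
  shows "\<exists>v\<in>carrier_vec (k - 1). (a3 \<cdot>\<^sub>m mat_B00 k a2 a3 b - mat_A01 k b) *\<^sub>v (v @\<^sub>v singleton_vec 1) = 0\<^sub>v k"
proof -
  obtain q where q: "q \<in> polys k" "coeff q (k - 1) = 1" "mom (m 2) (q * q) = 0"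
    using monic_null_exists[OF psd_l null_line_top[OF psd] assms] by blast
  define v where "v = vec (k - 1) (coeff q)"
  have u: "v @\<^sub>v singleton_vec 1 \<in> carrier_vec k" 
    by (rule carrier_vecI) (use k in \<open>simp add: v_def\<close>)
  have "(v @\<^sub>v singleton_vec 1) $ i = coeff q i" if "i < k" for i
  proof (cases "i = k - 1")
    case True
    thus ?thesis using that q(2) by (subst append_singleton_index) (auto simp: v_def)
  next
    case False
    thus ?thesis using that by (subst append_singleton_index) (auto simp: v_def)
  qed
  hence "(\<Sum>i<k. ((v @\<^sub>v singleton_vec 1) $ i) *\<^sub>R monom 1 i) = q"
    using sum_monom_coeff[OF q(1)] by simp
  hence "(a3 \<cdot>\<^sub>m mat_B00 k a2 a3 b - mat_A01 k b) *\<^sub>v (v @\<^sub>v singleton_vec 1) = 0\<^sub>v k"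
    unfolding line_2_hankel using hankel_kernel_iff[OF psd_l _ u, of "a3 - a2" 2] a_facts q(3) by simp
  thus ?thesis by (intro bexI[of _ v]) (simp_all add: v_def)
qed

lemma t_prime_eq:
  assumes v: "v \<in> carrier_vec (k - 1)"
    and ker: "(a3 \<cdot>\<^sub>m mat_B00 k a2 a3 b - mat_A01 k b) *\<^sub>v (v @\<^sub>v singleton_vec 1) = 0\<^sub>v k"
  shows "t_prime k a2 a3 b v = m 2 (2 * k - 1) + m 3 (2 * k - 1)"
proof -
  obtain k' where k': "k = Suc k'" using k by (cases k) auto
  define u where "u = v @\<^sub>v singleton_vec 1"
  have dv: "dim_vec v = k'" using v by (simp add: k')
  have u: "u \<in> carrier_vec k" by (rule carrier_vecI) (simp add: u_def k' dv)
  define q where "q = (\<Sum>i<k. (u $ i) *\<^sub>R monom 1 i :: real poly)"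
  have "mom (m 2) (q * q) = 0"
    using hankel_kernel_iff[OF psd_l _ u, of "a3 - a2" 2] ker a_facts
    unfolding line_2_hankel q_def u_def by simp
  hence "0 = mom (m 2) (q * monom 1 k)"
    using null_line_top[OF psd] sum_monom_in_polys[of "\<lambda>i. u $ i" k] by (simp add: q_def)
  also have "\<dots> = (\<Sum>i<k. u $ i * m 2 (i + k))"
    by (simp add: q_def sum_distrib_right mom_sum mom_smult mult_monom)
  also have "\<dots> = (\<Sum>i<k'. v $ i * m 2 (i + k)) + m 2 (2 * k - 1)"
    by (simp add: k' u_def append_singleton_index dv mult_2)
  finally have ker': "(\<Sum>i<k'. v $ i * m 2 (i + k)) = - m 2 (2 * k - 1)" by simp
  have "vec_a01_hat k b \<bullet> v - a3 * (vec_h k a2 a3 b \<bullet> v) =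
      (\<Sum>i<k'. v $ i * (b (k + i) (Suc 0) - a3 * (m 2 (k + i) + m 3 (k + i))))"
  proof -
    have "vec_h k a2 a3 b \<bullet> v = (\<Sum>i<k'. (m 2 (k + i) + m 3 (k + i)) * v $ i)"
      unfolding scalar_prod_def dv atLeast0LessThan
      by (intro sum.cong refl arg_cong2[of _ _ _ _ "(*)"])
         (auto simp: vec_h_def vec_a01_hat_def vec_a02_def k' two_line_moment[of "Suc (k' + _)", symmetric])
    moreover have "vec_a01_hat k b \<bullet> v = (\<Sum>i<k'. b (k + i) (Suc 0) * v $ i)"
      unfolding scalar_prod_def dv atLeast0LessThan by (simp add: vec_a01_hat_def k')
    ultimately show ?thesis
      by (simp add: sum_distrib_left right_diff_distrib sum_subtractf mult_ac)
  qed
  also have "\<dots> = (\<Sum>i<k'. (a2 - a3) * (v $ i * m 2 (i + k)))"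
    by (intro sum.cong) (auto simp: b_1 k' algebra_simps)
  also have "\<dots> = (a3 - a2) * m 2 (2 * k - 1)"
    by (simp only: sum_distrib_left[symmetric] ker') (simp add: algebra_simps)
  finally have "vec_a01_hat k b \<bullet> v - a3 * (vec_h k a2 a3 b \<bullet> v) + b (2 * k - 1) 1 =
      a3 * (m 2 (2 * k - 1) + m 3 (2 * k - 1))"
    using b_1[of "2 * k - 1"] k by (simp add: algebra_simps)
  thus ?thesis unfolding t_prime_def using a_facts by simp
qed

context
  fixes w
  assumes w: "w \<in> low_space k" "\<And>f. f \<in> low_space k \<Longrightarrow> lform m (top_power k - w) f = 0"
begin

lemma u_prime_eq:
  assumes t: "t = m 2 (2 * k - 1) + m 3 (2 * k - 1)"
  shows "u_prime k a2 a3 b t = mom (m 2) (monom 1 k * vec_nth w 2) + mom (m 3) (monom 1 k * vec_nth w 3)"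
proof -
  define G :: "nat \<Rightarrow> real poly ^ 3" where
    "G r = (\<chi> l. if l = 1 then 0 else monom (h l ^ (r div k)) (r mod k))" for r
  define F where "F = gram (lform m) (2 * k) G"
  have LG: "lform m (G r) f = mom (m 2) (monom (a2 ^ (r div k)) (r mod k) * vec_nth f 2) +
      mom (m 3) (monom (a3 ^ (r div k)) (r mod k) * vec_nth f 3)" for r f
    by (simp add: lform_def sum_3 G_def)
  have GG: "lform m (G r) (G c) = a2 ^ (r div k + c div k) * m 2 (r mod k + c mod k) +
      a3 ^ (r div k + c div k) * m 3 (r mod k + c mod k)" for r c
    unfolding LG by (simp add: G_def mult_monom power_add)
  have dm: "r div k = (if r < k then 0 else 1)" "r mod k = (if r < k then r else r - k)"
    if "r < 2 * k" for r
    using that k by (auto simp: div_if mod_if)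
  have F: "four_block_mat (mat_B00 k a2 a3 b) (mat_A01 k b) (transpose_mat (mat_A01 k b)) (mat_A11 k b) = F"
    by (rule eq_matI)
       (auto simp: F_def GG dm mat_B00_index mat_A01_index mat_A11_index power2_eq_square add.commute)
  define c where "c = vec_h k a2 a3 b @\<^sub>v singleton_vec t @\<^sub>v vec_a01 k b"
  have low: "G r \<in> low_space k" for r
  proof -
    have "r mod k < k" using k by simp
    thus ?thesis by (simp add: low_space_def G_def subspace_0)
  qed
  have c_index: "c $ r = lform m (G r) (top_power k)" if r: "r < 2 * k" for r
  proof -
    have dh: "dim_vec (vec_h k a2 a3 b) = k - 1" and da: "dim_vec (vec_a01 k b) = k"
      by (simp_all add: vec_h_def vec_a01_hat_def vec_a02_def vec_a01_def)
    have c: "c $ r = (if r < k - 1 then vec_h k a2 a3 b $ r else if r = k - 1 then t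
        else vec_a01 k b $ (r - k))"
      unfolding c_def using r k by (subst append_singleton_append_index) (simp_all add: dh da)
    consider "r < k - 1" | "r = k - 1" | "r \<ge> k" by linarith
    thus ?thesis
    proof cases
      case 1
      thus ?thesis using r k two_line_moment[of "k + r"] unfolding c
        by (simp add: vec_h_def vec_a01_hat_def vec_a02_def LG dm mult_monom add.commute)
    next
      case 2
      thus ?thesis using r k unfolding c by (simp add: LG dm mult_monom t mult_2)
    next
      case 3
      have "r + 1 \<le> 2 * k" "\<not> r < k - 1" "r \<noteq> k - 1" using r 3 k by auto
      with b_1[of r] show ?thesis using r k 3 unfolding c
        by (simp add: vec_a01_def LG dm mult_monom)
    qed
  qed
  define w' where "w' = (\<chi> l. if l = 1 then 0 else vec_nth w l)"
  define e where "e i = (coeff (vec_nth w 3) i - coeff (vec_nth w 2) i) / (a3 - a2)" for i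
  define y where "y = vec (2 * k) (\<lambda>r. if r < k then coeff (vec_nth w 2) r - e r * a2 else e (r - k))"
  have y: "y \<in> carrier_vec (2 * k)" by (simp add: y_def)
  have "(\<Sum>r<2 * k. (y $ r) *\<^sub>R G r) = (\<Sum>r<k. (y $ r) *\<^sub>R G r) + (\<Sum>r<k. (y $ (r + k)) *\<^sub>R G (r + k))"
    by (simp add: mult_2 sum.atLeastLessThan_concat[symmetric, of 0 k "k + k"] lessThan_atLeast0
        sum.shift_bounds_nat_ivl[of _ 0 k k, simplified])
  also have "\<dots> = (\<Sum>r<k. \<chi> l. monom (if l = 1 then 0 else coeff (vec_nth w l) r) r)"
    unfolding sum.distrib[symmetric]
  proof (rule sum.cong[OF refl])
    fix r assume "r \<in> {..<k}"
    hence r: "r < k" by simp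
    have e3: "coeff (vec_nth w 2) r - e r * a2 + e r * a3 = coeff (vec_nth w 3) r"
    proof -
      have "e r * (a3 - a2) = coeff (vec_nth w 3) r - coeff (vec_nth w 2) r" using a_facts by (simp add: e_def)
      thus ?thesis by (simp add: algebra_simps)
    qed
    have yr: "y $ r = coeff (vec_nth w 2) r - e r * a2" "y $ (r + k) = e r" using r by (simp_all add: y_def)
    show "(y $ r) *\<^sub>R G r + (y $ (r + k)) *\<^sub>R G (r + k) =
        (\<chi> l. monom (if l = 1 then 0 else coeff (vec_nth w l) r) r)"
      unfolding Finite_Cartesian_Product.vec_eq_iff forall_3
      using r e3 by (simp add: G_def yr smult_monom add_monom)
  qed
  also have "\<dots> = w'"
  proof -
    have "vec_nth w' l \<in> polys k" for l using w(1) by (simp add: w'_def low_space_def subspace_0)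
    hence "w' = (\<Sum>r<k. \<chi> l. monom (coeff (vec_nth w' l) r) r)" by (rule vec_poly_expand)
    thus ?thesis by (simp add: w'_def if_distrib[of "\<lambda>p. coeff p _"] cong: if_cong)
  qed
  finally have yG: "(\<Sum>r<2 * k. (y $ r) *\<^sub>R G r) = w'" .
  \<comment> \<open>\<open>top_power k - w\<close> is orthogonal to \<open>low_space\<close>, so
    products with x^k may be taken with \<open>w\<close> instead; this puts \<open>c\<close> in the
    range of \<open>F\<close>, as \<open>moore_penrose_gram\<close> requires.\<close>
  have "c = F *\<^sub>v y"
  proof (rule eq_vecI)
    fix r assume "r < dim_vec (F *\<^sub>v y)"
    hence r: "r < 2 * k" by (simp add: F_def)
    have "(F *\<^sub>v y) $ r = lform m (G r) w'" unfolding F_def lform.gram_mult_vec[OF y r] yG ..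
    also have "\<dots> = lform m (G r) w" by (simp add: LG w'_def)
    also have "\<dots> = lform m (G r) (top_power k)"
      using w(2)[OF low[of r]] lform.commute[of m _ "G r"] by (simp add: lform.diff_left)
    finally show "c $ r = (F *\<^sub>v y) $ r" using c_index[OF r] by simp
  qed (use k in \<open>simp add: c_def F_def vec_h_def vec_a01_hat_def vec_a02_def vec_a01_def\<close>)
  moreover have "span (G ` {..<2 * k}) \<subseteq> mid_space k"
    using low low_subset_mid by (intro span_minimal) auto
  hence "lform.psd_on m (span (G ` {..<2 * k}))" by (rule lform.psd_on_mono[OF psd])
  ultimately have "c \<bullet> (moore_penrose F *\<^sub>v c) = y \<bullet> (F *\<^sub>v y)"
    unfolding F_def using lform.moore_penrose_gram[of m G "2 * k" y] y by simp
  also have "\<dots> = lform m w' w'" unfolding F_def lform.gram_quadratic[OF y y] yG ..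
  also have "\<dots> = mom (m 2) (vec_nth w 2 * vec_nth w 2) + mom (m 3) (vec_nth w 3 * vec_nth w 3)"
    by (simp add: lform_def sum_3 w'_def)
  finally have u: "c \<bullet> (moore_penrose F *\<^sub>v c) =
    mom (m 2) (vec_nth w 2 * vec_nth w 2) + mom (m 3) (vec_nth w 3 * vec_nth w 3)" .
  have "mom (m l) (vec_nth w l * vec_nth w l) = mom (m l) (monom 1 k * vec_nth w l)" for l
  proof -
    have "mom (m l) ((monom 1 k - vec_nth w l) * vec_nth w l) = 0"
      using w by (intro orthogonal_top_line) (auto simp: low_space_def)
    thus ?thesis by (simp add: left_diff_distrib mom_diff)
  qed
  hence "c \<bullet> (moore_penrose F *\<^sub>v c) =
    mom (m 2) (monom 1 k * vec_nth w 2) + mom (m 3) (monom 1 k * vec_nth w 3)" using u by simp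
  thus ?thesis unfolding u_prime_def Let_def F c_def .
qed

lemma mat_A_gamma_eq:
  assumes t: "t = m 2 (2 * k - 1) + m 3 (2 * k - 1)"
  shows "mat_A_gamma k a2 a3 \<beta> b t u = hankel_mat (Suc k) ((m 1)(2 * k := \<beta> (2 * k) 0 - u))"
proof -
  define c where "c = vec_h k a2 a3 b @\<^sub>v singleton_vec t"
  have dh: "dim_vec (vec_h k a2 a3 b) = k - 1"
    by (simp add: vec_h_def vec_a01_hat_def vec_a02_def)
  have ci: "c $ i = m 2 (k + i) + m 3 (k + i)" if "i < k" for i
  proof (cases "i = k - 1")
    case True
    thus ?thesis using k unfolding c_def
      by (subst append_singleton_index) (auto simp: dh t mult_2)
  next
    case False
    hence i: "i < k - 1" and "k + i + 2 \<le> 2 * k" using that by auto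
    from two_line_moment[OF this(2)] show ?thesis using i unfolding c_def
      by (subst append_singleton_index) (auto simp: dh vec_h_def vec_a01_hat_def vec_a02_def)
  qed
  have b00: "\<beta> i 0 = m 1 i + m 2 i + m 3 i" if "i < 2 * k" for i using \<beta>_0[of i] that by simp
  have "mat_A00 k \<beta> - four_block_mat (mat_B00 k a2 a3 b) (mat_of_cols k [c])
      (mat_of_rows k [c]) (mat 1 1 (\<lambda>_. u)) = hankel_mat (Suc k) ((m 1)(2 * k := \<beta> (2 * k) 0 - u))"
  proof (rule eq_matI)
    fix i j
    assume "i < dim_row (hankel_mat (Suc k) ((m 1)(2 * k := \<beta> (2 * k) 0 - u)))"
      "j < dim_col (hankel_mat (Suc k) ((m 1)(2 * k := \<beta> (2 * k) 0 - u)))"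
    hence ij: "i < Suc k" "j < Suc k" by (auto simp: hankel_mat_def)
    consider "i < k" "j < k" | "i < k" "j = k" | "i = k" "j < k" | "i = k" "j = k"
      using ij by linarith
    thus "(mat_A00 k \<beta> - four_block_mat (mat_B00 k a2 a3 b) (mat_of_cols k [c])
      (mat_of_rows k [c]) (mat 1 1 (\<lambda>_. u))) $$ (i, j) =
      hankel_mat (Suc k) ((m 1)(2 * k := \<beta> (2 * k) 0 - u)) $$ (i, j)"
      by cases
         (auto simp: mat_A00_def hankel_mat_def mat_B00_index b00 mat_of_cols_index mat_of_rows_index
          ci mult_2 add.commute)
  qed (simp_all add: mat_A00_def hankel_mat_def)
  thus ?thesis by (simp add: mat_A_gamma_def Let_def c_def)
qed

lemma condition_c_iff:
  assumes v: "v \<in> carrier_vec (k - 1)"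
    "(a3 \<cdot>\<^sub>m mat_B00 k a2 a3 b - mat_A01 k b) *\<^sub>v (v @\<^sub>v singleton_vec 1) = 0\<^sub>v k"
  shows "(let t' = t_prime k a2 a3 b v; u' = u_prime k a2 a3 b t'; A\<gamma> = mat_A_gamma k a2 a3 \<beta> b t' u'
      in invertible_mat A\<gamma> \<or> mat_rank A\<gamma> = mat_rank (corner_mat k A\<gamma>)) \<longleftrightarrow>
    definite_on (m 1) (polys k) \<or> lform m (top_power k - w) (top_power k - w) = 0"
proof -
  define t where "t = t_prime k a2 a3 b v"
  define u where "u = u_prime k a2 a3 b t"
  define s where "s = lform m (top_power k - w) (top_power k - w)"
  define s' where "s' = (m 1)(2 * k := mom (m 1) (monom 1 k * vec_nth w 1) + s)"
  have t: "t = m 2 (2 * k - 1) + m 3 (2 * k - 1)" unfolding t_def by (rule t_prime_eq[OF v])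
  have "\<beta> (2 * k) 0 - u = mom (m 1) (monom 1 k * vec_nth w 1) + s"
    using excess_eq[OF w] \<beta>_0[of "2 * k"] u_prime_eq[OF t] by (simp add: u_def sum_3 s_def)
  hence A: "mat_A_gamma k a2 a3 \<beta> b t u = hankel_mat (Suc k) s'"
    by (simp only: mat_A_gamma_eq[OF t] s'_def)
  have c: "corner_mat k (hankel_mat (Suc k) s') = hankel_mat k s'"
    by (rule eq_matI) (auto simp: corner_mat_def hankel_mat_def)
  have "top_power k - w \<in> mid_space k" using w by (intro subspace_diff) auto
  hence s0: "s \<ge> 0" using psd by (auto simp: s_def lform.psd_on_def)
  have w1: "vec_nth w 1 \<in> polys k" using w(1) by (simp add: low_space_def)
  have "mom (m 1) ((monom 1 k - vec_nth w 1) * p) = 0" if "p \<in> polys k" for p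
    using w(2) that by (rule orthogonal_top_line)
  from rank_hankel_extension[OF psd_l k1 w1 this s0 s'_def] show ?thesis
    unfolding Let_def t_def[symmetric] u_def[symmetric] A c s_def[symmetric] .
qed

lemma condition_iff:
  "condition \<longleftrightarrow> (\<exists>l. definite_on (m l) (polys k)) \<or> lform m (top_power k - w) (top_power k - w) = 0"
  (is "_ \<longleftrightarrow> ?d \<or> ?s")
proof -
  have d: "?d \<longleftrightarrow> definite_on (m 1) (polys k) \<or> definite_on (m 2) (polys k) \<or> definite_on (m 3) (polys k)"
    using exhaust_3 by metis
  show ?thesis
  proof (cases "definite_on (m 2) (polys k)")
    case True
    thus ?thesis unfolding condition_def using condition_b_iff by blast
  next
    case False
    thus ?thesis
      unfolding condition_def d condition_a_iff condition_b_iff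
      using kernel_vector_exists[OF False] condition_c_iff by blast
  qed
qed

text \<open>If no line is definite, the measure has the same line moments as \<open>m\<close> below
  degree \<open>2 * k\<close>. Each line has a monic null polynomial of degree \<open>k - 1\<close>,
  whose multiple by x is null for the measure; together they form a null element \<open>g\<close> of
  \<open>mid_space\<close> with top coefficient one, so x^k has distance zero from
  \<open>low_space\<close>.\<close>

lemma measure_imp_condition:
  assumes "representing_measure (lines \<alpha>) k \<beta> \<mu>"
  shows "(\<exists>l. definite_on (m l) (polys k)) \<or> lform m (top_power k - w) (top_power k - w) = 0"
proof (cases "\<exists>l. definite_on (m l) (polys k)")
  case nd: False
  obtain m' where m': "line_moments k \<alpha> \<beta> m'" "\<And>l. hamburger k (m' l)"
    using line_moments_of_measure[OF assms inj_\<alpha>] by blast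
  have psd': "lform.psd_on m' (mid_space k)" using m'(2) by (rule hamburger_imp_psd_mid)
  have eq: "m l i = m' l i" if "i < 2 * k" for l i
    using odd_moment_unique[OF inj_\<alpha> k1 m m'(1) psd psd'] nd that by blast
  have form: "lform m f g = lform m' f g" if "f \<in> mid_space k" "g \<in> mid_space k" for f g
    using lform_change[of f k g m m' 1] that k1 eq line_moments_unique(3)[OF inj_\<alpha> m m'(1)] by simp
  have "\<exists>q. q \<in> polys k \<and> coeff q (k - 1) = 1 \<and> mom (m l) (q * q) = 0" for l
    using monic_null_exists[OF psd_l[of l] null_line_top[OF psd]] nd by metis
  then obtain q where q: "\<And>l. q l \<in> polys k" "\<And>l. coeff (q l) (k - 1) = 1" "\<And>l. mom (m l) (q l * q l) = 0"
    by metis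
  define g where "g = (\<chi> l. pCons 0 (q l))"
  have null: "mom (m' l) (pCons 0 (q l) * pCons 0 (q l)) = 0" for l
  proof -
    have "q l * q l \<in> polys (k + k - 1)" by (rule mult_in_polys[OF q(1,1)])
    hence "mom (m' l) (q l * q l) = mom (m l) (q l * q l)" by (rule mom_cong) (simp add: eq)
    thus ?thesis using m'(2)[of l] q by (simp only: hamburger_def)
  qed
  have gk: "coeff (pCons 0 (q l)) k = 1" for l using q(2)[of l] k by (cases k) simp_all
  have gS: "pCons 0 (q l) \<in> polys (Suc k)" for l using q(1)[of l] by (auto simp: polys_iff)
  have g: "g \<in> mid_space k" using gk gS by (simp add: mid_space_def g_def)
  have tw: "top_power k - w \<in> mid_space k" using w(1) by (intro subspace_diff) auto
  have "top_power k - g \<in> low_space k"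
    using gk gS by (auto simp: low_space_def g_def intro!: polys_diff_reduce)
  hence low: "top_power k - g - w \<in> low_space k" by (rule subspace_diff[OF subspace_low _ w(1)])
  have "lform m' g g = 0" using null by (simp add: lform_def g_def)
  hence "lform m' g (top_power k - w) = 0" by (rule lform.psd_null[OF subspace_mid psd' g _ tw])
  hence 0: "lform m (top_power k - w) g = 0" using form[OF g tw] lform.commute by metis
  have "top_power k - w = g + (top_power k - g - w)" by simp
  hence "lform m (top_power k - w) (top_power k - w) = lform m (top_power k - w) (g + (top_power k - g - w))"
    by metis
  also have "\<dots> = 0" using 0 w(2)[OF low] by (simp only: lform.add_right)
  finally show ?thesis by blast
qed blast

end

end

end

section \<open>Completion and necessity in terms of the given matrices\<close>

lemma completion_exists:
  assumes m: "line_moments k \<alpha> \<beta> m\<^sub>0"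
    and psd: "psd_mat (moment_mat k \<beta>)" "psd_mat (mat_N k b)"
  obtains m w r and p q :: bool where "line_moments k \<alpha> \<beta> m" "lform.psd_on m (mid_space k)"
    "w \<in> low_space k" "\<And>f. f \<in> low_space k \<Longrightarrow> lform m (top_power k - w) f = 0"
    "mat_rank (mat_N k b) = r + of_bool p" "mat_rank (moment_mat k \<beta>) = r + of_bool q"
    "\<exists>g. lform.frame m (mid_space k) (r + of_bool (p \<or> q)) g"
proof -
  have p: "lform.psd_on m\<^sub>0 (low_space k)" "lform.psd_on m\<^sub>0 (moment_space k \<alpha>)"
    using psd psd_mat_N_iff[OF m] psd_moment_mat_iff[OF m] by auto
  obtain m r and p q :: bool where *: "line_moments k \<alpha> \<beta> m" "lform.psd_on m (mid_space k)"
    "\<exists>g. lform.frame m\<^sub>0 (low_space k) (r + of_bool p) g"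
    "\<exists>g. lform.frame m\<^sub>0 (moment_space k \<alpha>) (r + of_bool q) g"
    "\<exists>g. lform.frame m (mid_space k) (r + of_bool (p \<or> q)) g"
    using moment_completion[OF inj_\<alpha> k1 m p] .
  have "lform.psd_on m (span ((\<lambda>r. bpoly h (r mod k) (r div k)) ` {..<3 * k}))"
    unfolding span_block_monomials[OF inj_h] using *(2) low_subset_mid by (rule lform.psd_on_mono)
  from lform.frame_exists[OF this] obtain r' g where "lform.frame m (low_space k) r' g"
    unfolding span_block_monomials[OF inj_h] by blast
  from orthogonal_top_exists[OF *(2) this] obtain w where
    "w \<in> low_space k" "\<And>f. f \<in> low_space k \<Longrightarrow> lform m (top_power k - w) f = 0" by blast
  moreover have "mat_rank (mat_N k b) = r + of_bool p" "mat_rank (moment_mat k \<beta>) = r + of_bool q"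
    using *(3,4) mat_rank_N[OF m p(1)] mat_rank_M[OF m p(2)] by blast+
  ultimately show thesis using that *(1,2,5) by blast
qed

lemma measure_imp_psd:
  assumes "representing_measure (lines \<alpha>) k \<beta> \<mu>"
  shows "recurrence_3 k \<alpha> \<beta>" "psd_mat (moment_mat k \<beta>)" "psd_mat (mat_N k b)"
proof -
  obtain m where m: "line_moments k \<alpha> \<beta> m" "\<And>l. hamburger k (m l)"
    using line_moments_of_measure[OF assms inj_\<alpha>] by blast
  have psd: "lform.psd_on m (mid_space k)" using m(2) by (rule hamburger_imp_psd_mid)
  show "recurrence_3 k \<alpha> \<beta>" using line_moments_iff_recurrence[OF inj_\<alpha>] m(1) by blast
  show "psd_mat (moment_mat k \<beta>)"
    unfolding psd_moment_mat_iff[OF m(1)] using psd moment_subset_mid by (rule lform.psd_on_mono)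
  show "psd_mat (mat_N k b)"
    unfolding psd_mat_N_iff[OF m(1)] using psd low_subset_mid by (rule lform.psd_on_mono)
qed

end

theorem theorem4p2:
  fixes k :: nat and \<alpha>\<^sub>1 \<alpha>\<^sub>2 \<alpha>\<^sub>3 a2 a3 :: real and K :: "(real \<times> real) set"
    and \<beta> b :: "nat \<Rightarrow> nat \<Rightarrow> real" and M N A01 B00 :: "real mat"
  assumes "k \<ge> 3"
    and "\<alpha>\<^sub>1 \<noteq> \<alpha>\<^sub>2" and "\<alpha>\<^sub>1 < \<alpha>\<^sub>3" and "\<alpha>\<^sub>2 < \<alpha>\<^sub>3"
    and "K = {(x, y). (y - \<alpha>\<^sub>1) * (y - \<alpha>\<^sub>2) * (y - \<alpha>\<^sub>3) = 0}"
    and "\<beta> 0 0 > 0"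
    and "a2 = \<alpha>\<^sub>2 - \<alpha>\<^sub>1" and "a3 = \<alpha>\<^sub>3 - \<alpha>\<^sub>1"
    and "b = ext_moment k \<alpha>\<^sub>1 a2 a3 \<beta>"
    and "M = moment_mat k \<beta>"
    and "N = mat_N k b"
    and "A01 = mat_A01 k b"
    and "B00 = mat_B00 k a2 a3 b"
  shows
    "((\<exists>\<mu>. representing_measure K k \<beta> \<mu>) \<longleftrightarrow>
       psd_mat M \<and>
       (\<forall>i j. i + j \<le> 2 * k - 3 \<longrightarrow>
          \<beta> i (j + 3) = (\<alpha>\<^sub>1 + \<alpha>\<^sub>2 + \<alpha>\<^sub>3) * \<beta> i (j + 2)
            - (\<alpha>\<^sub>1 * \<alpha>\<^sub>2 + \<alpha>\<^sub>1 * \<alpha>\<^sub>3 + \<alpha>\<^sub>2 * \<alpha>\<^sub>3) * \<beta> i (j + 1)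
            + \<alpha>\<^sub>1 * \<alpha>\<^sub>2 * \<alpha>\<^sub>3 * \<beta> i j) \<and>
       psd_mat N \<and>
       (invertible_mat (A01 - a2 \<cdot>\<^sub>m B00) \<or>
        invertible_mat ((\<alpha>\<^sub>3 - \<alpha>\<^sub>1) \<cdot>\<^sub>m B00 - A01) \<or>
        (\<forall>v \<in> carrier_vec (k - 1).
           ((\<alpha>\<^sub>3 - \<alpha>\<^sub>1) \<cdot>\<^sub>m B00 - A01) *\<^sub>v (v @\<^sub>v singleton_vec 1) = 0\<^sub>v k \<longrightarrow>
           (let t' = t_prime k a2 a3 b v;
                u' = u_prime k a2 a3 b t';
                A\<gamma> = mat_A_gamma k a2 a3 \<beta> b t' u'
            in invertible_mat A\<gamma> \<or> mat_rank A\<gamma> = mat_rank (corner_mat k A\<gamma>)))))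
     \<and>
     ((\<exists>\<mu>. representing_measure K k \<beta> \<mu>) \<longrightarrow>
       (if mat_rank N \<le> mat_rank M
        then \<exists>\<mu>. representing_measure K k \<beta> \<mu> \<and> atomic_measure (mat_rank M) \<mu>
        else \<exists>\<mu>. representing_measure K k \<beta> \<mu> \<and> atomic_measure (mat_rank M + 1) \<mu>))"
  proof -
  note a = assms(7,8) and defs = assms(10-13)
  interpret S: shifted_lines k \<alpha>\<^sub>1 \<alpha>\<^sub>2 \<alpha>\<^sub>3 a2 a3 \<beta> b
    using assms(1-4,7-9) by unfold_locales
  have K: "K = lines S.\<alpha>" using assms(5) S.lines_eq by simp
  define C where "C \<longleftrightarrow> S.condition"
  define R where "R \<longleftrightarrow> recurrence_3 k S.\<alpha> \<beta>"
  have atomic: "C \<longleftrightarrow> (\<exists>\<mu>. representing_measure K k \<beta> \<mu>)"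
    "(\<exists>\<mu>. representing_measure K k \<beta> \<mu>) \<Longrightarrow> \<exists>\<mu>. representing_measure K k \<beta> \<mu> \<and>
      atomic_measure (if mat_rank N \<le> mat_rank M then mat_rank M else mat_rank M + 1) \<mu>"
    if R: R and pM: "psd_mat M" and pN: "psd_mat N"
  proof -
    obtain m\<^sub>0 where m0: "line_moments k S.\<alpha> \<beta> m\<^sub>0"
      using R line_moments_iff_recurrence[OF S.inj_\<alpha>] unfolding R_def by blast
    obtain m w r and p q :: bool where m: "line_moments k S.\<alpha> \<beta> m" and psd: "lform.psd_on m (mid_space k)"
      and w: "w \<in> low_space k" "\<And>f. f \<in> low_space k \<Longrightarrow> lform m (top_power k - w) f = 0"
      and rank: "mat_rank N = r + of_bool p" "mat_rank M = r + of_bool q"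
      and fr: "\<exists>g. lform.frame m (mid_space k) (r + of_bool (p \<or> q)) g"
      using S.completion_exists[OF m0] pM pN unfolding defs by metis
    \<comment> \<open>Here \<open>m\<close> is the completion and not the moments of a measure; the
      criterion holds for every semidefinite \<open>m\<close> compatible with
      \<open>\<beta>\<close>.\<close>
    have iff: "C \<longleftrightarrow> (\<exists>l. definite_on (m l) (polys k)) \<or> lform m (top_power k - w) (top_power k - w) = 0"
      unfolding C_def by (rule S.condition_iff[OF m psd w])
    have rep: "\<exists>\<mu>. representing_measure K k \<beta> \<mu> \<and> atomic_measure (r + of_bool (p \<or> q)) \<mu>" if c: C
    proof -
      obtain n \<mu> g where n: "representing_measure K k \<beta> \<mu>" "atomic_measure n \<mu>" "lform.frame m (mid_space k) n g"
        using representation_from_psd[OF m psd S.k1 S.inj_\<alpha> w(1)] w(2) c iff unfolding K by blast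
      \<comment> \<open>The atoms and the completion give two frames for the same form on
        \<open>mid_space\<close>, so their lengths agree.\<close>
      have "n = r + of_bool (p \<or> q)"
        using fr lform.frame_size_unique[OF n(3) _ subspace_mid psd] by blast
      thus ?thesis using n by blast
    qed
    have C: C if "representing_measure K k \<beta> \<mu>" for \<mu>
      using S.measure_imp_condition[OF m psd w] that iff unfolding K by blast
    show "C \<longleftrightarrow> (\<exists>\<mu>. representing_measure K k \<beta> \<mu>)" using rep C by blast
    \<comment> \<open>If \<open>p \<longrightarrow> q\<close>, the completed form has the rank of
      \<open>M\<close>; otherwise \<open>N\<close> has rank one more than \<open>M\<close>, and the
      completed form has the rank of \<open>N\<close>.\<close>
    have "(if mat_rank N \<le> mat_rank M then mat_rank M else mat_rank M + 1) = r + of_bool (p \<or> q)"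
      by (auto simp: rank)
    thus "\<exists>\<mu>. representing_measure K k \<beta> \<mu> \<and>
        atomic_measure (if mat_rank N \<le> mat_rank M then mat_rank M else mat_rank M + 1) \<mu>"
      if "\<exists>\<mu>. representing_measure K k \<beta> \<mu>" using rep C that by auto
  qed
  have nec: "R" "psd_mat M" "psd_mat N" if "\<exists>\<mu>. representing_measure K k \<beta> \<mu>"
    using that S.measure_imp_psd unfolding K R_def defs by blast+
  have "(\<exists>\<mu>. representing_measure K k \<beta> \<mu>) \<longleftrightarrow> psd_mat M \<and> R \<and> psd_mat N \<and> C"
    using atomic(1) nec by blast
  moreover have "(\<exists>\<mu>. representing_measure K k \<beta> \<mu>) \<longrightarrow> (if mat_rank N \<le> mat_rank M
        then \<exists>\<mu>. representing_measure K k \<beta> \<mu> \<and> atomic_measure (mat_rank M) \<mu>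
        else \<exists>\<mu>. representing_measure K k \<beta> \<mu> \<and> atomic_measure (mat_rank M + 1) \<mu>)"
    using atomic(2) nec by (cases "mat_rank N \<le> mat_rank M") (simp_all only: if_True if_False, blast+)
  ultimately show ?thesis
    unfolding R_def C_def S.condition_def S.recurrence_iff a(2)[symmetric] defs by blast
qed

end
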